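(* Let $d\geq 1$, $2<p<q<\infty$, $1\leq\theta\leq\infty$, $r>d/2$. Then, for $m\in\mathbb{N}$, $$ e_m(B^{r}_{p,\theta})_{B_{q,1}}\asymp m^{-\frac{r}{d}}. $$
   Context: $\mathbb{T}^d=[0,2\pi)^d$; $L_p(\mathbb{T}^d)$ is the space of functions $2\pi$-periodic in each variable with norm $\|f\|_p=\big((2\pi)^{-d}\int_{\mathbb{T}^d}|f|^p\big)^{1/p}$ ($1\le p<\infty$), $\|f\|_\infty=\operatorname{ess\,sup}|f|$. For $\boldsymbol h\in\mathbb{R}^d$, $\Delta_{\boldsymbol h}f(\boldsymbol x)=f(\boldsymbol x+\boldsymbol h)-f(\boldsymbol x)$, $\Delta^k_{\boldsymbol h}=\Delta_{\boldsymbol h}\Delta^{k-1}_{\boldsymbol h}$, and $\omega_k(f,t)_p=\sup_{|\boldsymbol h|\le t}\|\Delta^k_{\boldsymbol h}f\|_p$ (Euclidean $|\boldsymbol h|$). For $r>0$, $1\le p,\theta\le\infty$ and a fixed integer $k>r$, the Nikol'skii–Besov space $B^r_{p,\theta}$ consists of $f\in L_p(\mathbb{T}^d)$ with finite norm $\|f\|_{B^r_{p,\theta}}=\|f\|_p+\big(\int_0^\infty (t^{-r}\omega_k(f,t)_p)^\theta\,\frac{dt}{t}\big)^{1/\theta}$ for $\theta<\infty$, and $\|f\|_p+\sup_{t>0}t^{-r}\omega_k(f,t)_p$ for $\theta=\infty$; the class $B^r_{p,\theta}$ denotes its unit ball $\{f:\|f\|_{B^r_{p,\theta}}\le1\}$.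 Let $V_l(t)=l^{-1}\sum_{k=l}^{2l-1}D_k(t)$ with $D_k(t)=\sum_{|j|\le k}e^{ijt}$ be the de la Vallée-Poussin kernel, $V_l(\boldsymbol x)=\prod_{j=1}^dV_l(x_j)$, $V_l(f)=f*V_l$. Set $\sigma_0(f)=V_1(f)$ and $\sigma_s(f)=V_{2^s}(f)-V_{2^{s-1}}(f)$ for $s\in\mathbb{N}$. For $1\le q\le\infty$, $B_{q,1}$ is the space of $f\in L_q(\mathbb{T}^d)$ with $\|f\|_{B_{q,1}}:=\sum_{s\ge0}\|\sigma_s(f)\|_q<\infty$. For a normed space $\mathcal X$ of functions and $f\in\mathcal X$, the best $m$-term trigonometric approximation is $e_m(f)_{\mathcal X}=\inf_{\Theta_m}\inf_{c_{\boldsymbol k}}\|f-\sum_{\boldsymbol k\in\Theta_m}c_{\boldsymbol k}e^{i(\boldsymbol k,\boldsymbol x)}\|_{\mathcal X}$, where $\Theta_m$ ranges over sets of $m$ vectors in $\mathbb{Z}^d$ and $c_{\boldsymbol k}\in\mathbb{C}$; for a class $F$, $e_m(F)_{\mathcal X}=\sup_{f\in F}e_m(f)_{\mathcal X}$. The notation $a(m)\asymp b(m)$ means there are constants $0<C_1<C_2$ independent of $m$ (depending possibly on the other parameters) with $C_1a(m)\le b(m)\le C_2a(m)$ for all $m\in\mathbb{N}$. *)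

theory Defs
  imports "HOL-Analysis.Analysis"
begin

text \<open>Functions on the torus T^d are modelled as complex-valued functions on
  real^'n (d = CARD('n)) that are 2pi-periodic in each variable.\<close>

definition torus_cube :: "(real^'n) set" where
  "torus_cube = {x. \<forall>j. 0 \<le> x$j \<and> x$j < 2*pi}"

definition periodic_fun :: "(real^'n \<Rightarrow> complex) \<Rightarrow> bool" where
  "periodic_fun f \<longleftrightarrow> (\<forall>x j. f (x + axis j (2*pi)) = f x)"

definition in_Lp :: "real \<Rightarrow> (real^'n \<Rightarrow> complex) \<Rightarrow> bool" where
  "in_Lp p f \<longleftrightarrow> periodic_fun f \<and> f \<in> borel_measurable lborel \<and>
     set_integrable lborel torus_cube (\<lambda>x. norm (f x) powr p)"

definition Lp_norm :: "real \<Rightarrow> (real^'n \<Rightarrow> complex) \<Rightarrow> real" where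
  "Lp_norm p f = ((2*pi) powr (- real CARD('n)) *
      (LINT x:torus_cube|lborel. norm (f x) powr p)) powr (1/p)"

definition diff_op :: "real^'n \<Rightarrow> (real^'n \<Rightarrow> complex) \<Rightarrow> (real^'n \<Rightarrow> complex)" where
  "diff_op h g = (\<lambda>x. g (x + h) - g x)"

definition diff_pow :: "nat \<Rightarrow> real^'n \<Rightarrow> (real^'n \<Rightarrow> complex) \<Rightarrow> (real^'n \<Rightarrow> complex)" where
  "diff_pow k h f = (diff_op h ^^ k) f"

definition modulus :: "nat \<Rightarrow> real \<Rightarrow> (real^'n \<Rightarrow> complex) \<Rightarrow> real \<Rightarrow> real" where
  "modulus k p f t = (SUP h\<in>cball 0 t. Lp_norm p (diff_pow k h f))"

definition besov_norm :: "nat \<Rightarrow> real \<Rightarrow> real \<Rightarrow> ennreal \<Rightarrow> (real^'n \<Rightarrow> complex) \<Rightarrow> ennreal" where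
  "besov_norm k r p \<theta> f =
    (if \<theta> = \<infinity> then
       (if bdd_above ((\<lambda>t. t powr (-r) * modulus k p f t) ` {0<..})
        then ennreal (Lp_norm p f + (SUP t\<in>{0<..}. t powr (-r) * modulus k p f t))
        else \<infinity>)
     else
       (let I = (\<integral>\<^sup>+ t\<in>{0<..}. ennreal ((t powr (-r) * modulus k p f t) powr (enn2real \<theta>) / t) \<partial>lborel)
        in if I = \<infinity> then \<infinity>
           else ennreal (Lp_norm p f + (enn2real I) powr (1 / enn2real \<theta>))))"

definition besov_class :: "nat \<Rightarrow> real \<Rightarrow> real \<Rightarrow> ennreal \<Rightarrow> (real^'n \<Rightarrow> complex) set" where
  "besov_class k r p \<theta> = {f. in_Lp p f \<and> besov_norm k r p \<theta> f \<le> 1}"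

definition dirichlet :: "nat \<Rightarrow> real \<Rightarrow> complex" where
  "dirichlet k t = (\<Sum>j\<in>{-int k..int k}. cis (of_int j * t))"

definition vp1 :: "nat \<Rightarrow> real \<Rightarrow> complex" where
  "vp1 l t = (1 / of_nat l) * (\<Sum>k\<in>{l..2*l-1}. dirichlet k t)"

definition vp :: "nat \<Rightarrow> real^'n \<Rightarrow> complex" where
  "vp l x = (\<Prod>j\<in>UNIV. vp1 l (x$j))"

definition tconv :: "(real^'n \<Rightarrow> complex) \<Rightarrow> (real^'n \<Rightarrow> complex) \<Rightarrow> (real^'n \<Rightarrow> complex)" where
  "tconv f K = (\<lambda>x. complex_of_real ((2*pi) powr (- real CARD('n))) *
       (LINT y:torus_cube|lborel. f (x - y) * K y))"

definition vp_op :: "nat \<Rightarrow> (real^'n \<Rightarrow> complex) \<Rightarrow> (real^'n \<Rightarrow> complex)" where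
  "vp_op l f = tconv f (vp l)"

definition sigma_block :: "nat \<Rightarrow> (real^'n \<Rightarrow> complex) \<Rightarrow> (real^'n \<Rightarrow> complex)" where
  "sigma_block s f = (if s = 0 then vp_op 1 f
       else (\<lambda>x. vp_op (2^s) f x - vp_op (2^(s-1)) f x))"

definition Bq1_norm :: "real \<Rightarrow> (real^'n \<Rightarrow> complex) \<Rightarrow> ennreal" where
  "Bq1_norm q f = (\<Sum>s. ennreal (Lp_norm q (sigma_block s f)))"

definition char_exp :: "int^'n \<Rightarrow> real^'n \<Rightarrow> complex" where
  "char_exp k x = cis (\<Sum>j\<in>UNIV. of_int (k$j) * x$j)"

definition best_mterm :: "nat \<Rightarrow> real \<Rightarrow> (real^'n \<Rightarrow> complex) \<Rightarrow> ennreal" where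
  "best_mterm m q f = (INF \<Theta>\<in>{\<Theta> :: (int^'n) set. finite \<Theta> \<and> card \<Theta> = m}.
      INF c\<in>(UNIV :: (int^'n \<Rightarrow> complex) set).
        Bq1_norm q (\<lambda>x. f x - (\<Sum>k\<in>\<Theta>. c k * char_exp k x)))"

definition best_mterm_class :: "nat \<Rightarrow> real \<Rightarrow> (real^'n \<Rightarrow> complex) set \<Rightarrow> ennreal" where
  "best_mterm_class m q F = (SUP f\<in>F. best_mterm m q f)"

end

theory Submission
  imports Defs "HOL-Complex_Analysis.Cauchy_Integral_Formula"
begin

text \<open>
  Upper bound. Since p > 2, the class is contained in a Nikolskii class over L_2, and Bessel's inequality for
  the differences of f in coordinate directions bounds the sum of the absolute values of the Fourier
  coefficients over the dyadic shell of level s by a multiple of 2^(-b s), where b = r - d/2 > 0. All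
  frequencies of level at most n are kept, where 2^(n d) is comparable to m. On a shell of level s > n, a
  derandomised Maurey sampling with N = 2^(n d - (s - n) b) terms reduces that sum by the factor N^(-1/2) as a
  bound for the error in L_q, and these errors add up to a multiple of 2^(-n r). Every block operator meets
  only two shells, so the B_{q,1} norm is controlled without the boundedness of the de la Vallee-Poussin
  operators.

  Lower bound. A tensor product of Rudin-Shapiro polynomials with 2^(n d) >= 2 m frequencies has unimodular
  coefficients and a sup norm comparable to its L_2 norm. The Rudin-Shapiro recursion gives the same bound in
  a complex strip of width 2^(-n), so Cauchy's estimate controls its differences as Bernstein's inequality
  would, and a suitable multiple lies in the class. Removing m frequencies leaves a fixed part of its L_2 norm.
\<close>

section \<open>Normalised Lebesgue measure on the torus\<close>

text \<open>The rates fit because b + d/2 = r. Cauchy-Schwarz on a shell costs the factor 2^(s d/2),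
  which leaves 2^(-b s), and dividing by the square root of the sample size gives 2^(-r n) * 2^(-(s
  - n) b/2). Sample sizes and errors are thus both geometric in s - n, and where the sample size
  drops below one the shell is simply discarded. Each shell is seen by two blocks with different
  multipliers, so one choice of coefficients must be good for both. Hence four real families (two
  multipliers, real and imaginary part) share a single potential. It is built from cosh because cosh
  dominates every power |x|^q with q finite. Hoelder and Minkowski inequalities appear only as
  pointwise inequalities between powers, integrated with a loss of constants. For the lower bound a
  sup norm estimate controls the test function in every L_p at once. Its approximation error is
  bounded from below by Bessel's inequality applied to a single block.\<close>

definition torus_measure :: "(real^'n) measure" where
  "torus_measure = density lborel (\<lambda>x. ennreal ((2*pi) powr (- real CARD('n)) * indicator torus_cube x))"

lemma torus_cube_borel [measurable]: "torus_cube \<in> sets borel"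
  unfolding torus_cube_def by measurable

lemma space_torus_measure [simp]: "space torus_measure = UNIV"
  by (simp add: torus_measure_def)

lemma sets_torus_measure [simp, measurable_cong]: "sets torus_measure = sets borel"
  by (simp add: torus_measure_def)

text \<open>Lets the half-open cube be exchanged for the closed box, or compared with its own
  reflection, where only faces differ.\<close>

lemma AE_coord_neq: "AE x :: real^'n in lborel. x$j \<noteq> c"
proof -
  have "{x::real^'n. x$j = c} \<in> null_sets lebesgue"
    using negligible_standard_hyperplane[of "axis j 1 :: real^'n" c]
    by (simp add: inner_axis negligible_iff_null_sets axis_in_Basis_iff)
  moreover have "{x::real^'n. x$j = c} \<in> sets borel" by measurable
  ultimately have "{x::real^'n. x$j = c} \<in> null_sets lborel"
    by (simp add: null_sets_completion_iff)
  from AE_not_in[OF this] show ?thesis by simp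
qed

lemma AE_all_coords_neq: "AE x :: real^'n in lborel. \<forall>j. x$j \<noteq> c"
  by (simp add: AE_all_countable AE_coord_neq)

lemma emeasure_torus_cube: "emeasure lborel (torus_cube :: (real^'n) set) = ennreal ((2*pi) ^ CARD('n))"
proof -
  have "emeasure lborel (torus_cube :: (real^'n) set) = emeasure lborel (cbox 0 (\<chi> i. 2*pi) :: (real^'n) set)"
    by (rule emeasure_eq_AE, rule AE_mp[OF AE_all_coords_neq[of "2*pi"]])
       (auto simp: torus_cube_def mem_box_cart less_le intro!: AE_I2)
  also have "\<dots> = ennreal (\<Prod>b\<in>Basis. ((\<chi> i. 2*pi) :: real^'n) \<bullet> b)"
    by (subst emeasure_lborel_cbox) (auto simp: Basis_vec_def inner_axis)
  also have "(\<Prod>b\<in>Basis. ((\<chi> i. 2*pi) :: real^'n) \<bullet> b) = (\<Prod>b\<in>(Basis::(real^'n) set). 2*pi)"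
    by (rule prod.cong) (auto simp: Basis_vec_def inner_axis)
  finally show ?thesis by simp
qed

lemma nn_integral_torus:
  fixes g :: "real^'n \<Rightarrow> ennreal"
  assumes [measurable]: "g \<in> borel_measurable borel"
  shows "(\<integral>\<^sup>+x. g x \<partial>torus_measure) = ennreal ((2*pi) powr (- real CARD('n))) * (\<integral>\<^sup>+x. indicator torus_cube x * g x \<partial>lborel)"
proof -
  have "(\<integral>\<^sup>+x. g x \<partial>torus_measure) =
     (\<integral>\<^sup>+x. ennreal ((2*pi) powr (- real CARD('n))) * (indicator torus_cube x * g x) \<partial>lborel)"
    unfolding torus_measure_def
    by (subst nn_integral_density) (auto simp: ennreal_mult ennreal_indicator mult.assoc)
  then show ?thesis by (simp add: nn_integral_cmult)
qed

lemma emeasure_torus_measure: "emeasure (torus_measure :: (real^'n) measure) UNIV = 1"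
proof -
  have "emeasure (torus_measure :: (real^'n) measure) UNIV = (\<integral>\<^sup>+x. 1 \<partial>(torus_measure :: (real^'n) measure))"
    by simp
  also have "\<dots> = ennreal ((2*pi) powr (- real CARD('n))) * ennreal ((2*pi) ^ CARD('n))"
    by (subst nn_integral_torus) (auto simp: emeasure_torus_cube)
  also have "\<dots> = 1"
  proof -
    have "(2*pi) ^ CARD('n) = (2*pi) powr real CARD('n)" by (subst powr_realpow) auto
    then have "(2*pi) powr (- real CARD('n)) * (2*pi) ^ CARD('n) = 1"
      by (simp only: powr_minus) simp
    then show ?thesis by (subst ennreal_mult'[symmetric]) (auto simp only:, simp_all)
  qed
  finally show ?thesis .
qed

interpretation torus: finite_measure "torus_measure :: (real^'n) measure"
  by standard (simp add: emeasure_torus_measure)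

lemma measure_torus [simp]: "measure (torus_measure :: (real^'n) measure) UNIV = 1"
  by (simp add: measure_def emeasure_torus_measure)

lemma integral_torus:
  fixes g :: "real^'n \<Rightarrow> 'b::{banach, second_countable_topology}"
  assumes [measurable]: "g \<in> borel_measurable borel"
  shows "integral\<^sup>L torus_measure g = (2*pi) powr (- real CARD('n)) *\<^sub>R (LINT x:torus_cube|lborel. g x)"
  unfolding torus_measure_def set_lebesgue_integral_def
  by (subst integral_density) (auto simp: scaleR_scaleR[symmetric] simp del: scaleR_scaleR)

lemma integrable_torus:
  fixes g :: "real^'n \<Rightarrow> 'b::{banach, second_countable_topology}"
  assumes [measurable]: "g \<in> borel_measurable borel"
  shows "integrable torus_measure g \<longleftrightarrow> set_integrable lborel torus_cube g"
proof -
  let ?c = "(2*pi) powr (- real CARD('n))"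
  have "integrable torus_measure g \<longleftrightarrow> integrable lborel (\<lambda>x. ?c *\<^sub>R (indicator torus_cube x *\<^sub>R g x))"
    unfolding torus_measure_def by (subst integrable_density) auto
  also have "\<dots> \<longleftrightarrow> set_integrable lborel torus_cube g"
    unfolding set_integrable_def
  proof
    assume "integrable lborel (\<lambda>x. ?c *\<^sub>R (indicator torus_cube x *\<^sub>R g x))"
    from integrable_scaleR_right[OF this, of "inverse ?c"]
    show "integrable lborel (\<lambda>x. indicator torus_cube x *\<^sub>R g x)"
      by (simp only: scaleR_scaleR mult.assoc[symmetric]) simp
  qed (rule integrable_scaleR_right)
  finally show ?thesis .
qed

lemma integrable_torus_bounded:
  fixes g :: "real^'n \<Rightarrow> 'b::{banach, second_countable_topology}"
  assumes "g \<in> borel_measurable borel" "\<And>x. norm (g x) \<le> B"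
  shows "integrable torus_measure g"
  by (rule torus.integrable_const_bound[of _ B]) (use assms in \<open>auto\<close>)

text \<open>The sign condition on \<open>B\<close> covers functions that are not integrable, whose
  Bochner integral is 0 by convention.\<close>

lemma integral_torus_le:
  fixes g :: "real^'n \<Rightarrow> real"
  assumes "\<And>x. g x \<le> B" "0 \<le> B"
  shows "integral\<^sup>L torus_measure g \<le> B"
proof (cases "integrable torus_measure g")
  case True
  have "integral\<^sup>L torus_measure g \<le> integral\<^sup>L (torus_measure :: (real^'n) measure) (\<lambda>_. B)"
    by (rule integral_mono[OF True]) (auto simp: assms)
  then show ?thesis by simp
next
  case False
  then show ?thesis using assms(2) by (simp add: not_integrable_integral_eq)
qed

text \<open>Polymorphic counterpart of \<open>periodic_fun\<close>, so that it also applies to real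
  and \<open>ennreal\<close> valued functions such as powers of the modulus.\<close>

definition vperiodic :: "(real^'n \<Rightarrow> 'b) \<Rightarrow> bool" where
  "vperiodic f \<longleftrightarrow> (\<forall>x j. f (x + axis j (2*pi)) = f x)"

lemma vperiodic_nat: "vperiodic f \<Longrightarrow> f (x + axis j (2*pi * real m)) = f x"
proof (induction m arbitrary: x)
  case (Suc m)
  have "x + axis j (2*pi * real (Suc m)) = (x + axis j (2*pi * real m)) + axis j (2*pi)"
    by (simp add: vec_eq_iff axis_def algebra_simps)
  then show ?case using Suc unfolding vperiodic_def by metis
qed (simp add: axis_eq_0_iff[THEN iffD2])

lemma vperiodic_int: 
  assumes "vperiodic f" shows "f (x + axis j (2*pi * of_int m)) = f x"
proof (cases "m \<ge> 0")
  case True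
  then show ?thesis using vperiodic_nat[OF assms, of x j "nat m"] by simp
next
  case False
  have "(x + axis j (2*pi * of_int m)) + axis j (2*pi * real (nat (-m))) = x"
    using False by (simp add: vec_eq_iff axis_def)
  then show ?thesis using vperiodic_nat[OF assms, of "x + axis j (2*pi * of_int m)" j "nat (-m)"] by metis
qed

lemma nn_integral_lborel_translate:
  fixes g :: "real^'n \<Rightarrow> ennreal"
  assumes [measurable]: "g \<in> borel_measurable borel"
  shows "(\<integral>\<^sup>+x. g (x + a) \<partial>lborel) = (\<integral>\<^sup>+x. g x \<partial>lborel)"
proof -
  have "(\<integral>\<^sup>+x. g x \<partial>lborel) = (\<integral>\<^sup>+x. g x \<partial>(distr lborel borel ((+) a)))"
    by (simp add: lborel_distr_plus)
  also have "\<dots> = (\<integral>\<^sup>+x. g (x + a) \<partial>lborel)"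
    by (subst nn_integral_distr) (auto simp: add.commute)
  finally show ?thesis by simp
qed

text \<open>Only the remainder \<open>b\<close> of \<open>a\<close> modulo the period matters. The
  cube translated by \<open>b\<close> consists of \<open>C1\<close>, its overlap with the cube, and
  of \<open>C2\<close> moved by one period; periodicity of \<open>g\<close> moves the second piece
  back.\<close>

lemma nn_integral_torus_translate_axis:
  fixes g :: "real^'n \<Rightarrow> ennreal"
  assumes [measurable]: "g \<in> borel_measurable borel" and per: "vperiodic g"
  shows "(\<integral>\<^sup>+x. g (x + axis j a) \<partial>torus_measure) = (\<integral>\<^sup>+x. g x \<partial>torus_measure)"
proof -
  define b where "b = a - 2*pi * of_int \<lfloor>a / (2*pi)\<rfloor>"
  have b: "0 \<le> b" "b < 2*pi"
    using floor_divide_lower[of "2*pi" a] floor_divide_upper[of "2*pi" a]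
    by (simp_all add: b_def algebra_simps)
  have shift: "g (x + axis j a) = g (x + axis j b)" for x
  proof -
    have "x + axis j a = (x + axis j b) + axis j (2*pi * of_int \<lfloor>a / (2*pi)\<rfloor>)"
      by (simp add: vec_eq_iff axis_def b_def)
    then show ?thesis using vperiodic_int[OF per] by metis
  qed
  let ?C = "torus_cube :: (real^'n) set"
  define C1 where "C1 = {x\<in>?C. b \<le> x$j}"
  define C2 where "C2 = {x\<in>?C. x$j < b}"
  have [measurable]: "C1 \<in> sets borel" "C2 \<in> sets borel" unfolding C1_def C2_def by measurable
  have split: "indicator ?C (x - axis j b) = (indicator C1 x + indicator C2 (x - axis j (2*pi)) :: ennreal)" for x
  proof -
    have *: "(x - axis j b \<in> ?C) \<longleftrightarrow> (\<forall>i. i \<noteq> j \<longrightarrow> 0 \<le> x$i \<and> x$i < 2*pi) \<and> b \<le> x$j \<and> x$j < 2*pi + b"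
      by (auto simp: torus_cube_def axis_def split: if_splits; smt (verit))
    have **: "x \<in> C1 \<longleftrightarrow> (\<forall>i. i \<noteq> j \<longrightarrow> 0 \<le> x$i \<and> x$i < 2*pi) \<and> b \<le> x$j \<and> x$j < 2*pi"
      using b by (auto simp: torus_cube_def C1_def; smt (verit))
    have ***: "x - axis j (2*pi) \<in> C2 \<longleftrightarrow> (\<forall>i. i \<noteq> j \<longrightarrow> 0 \<le> x$i \<and> x$i < 2*pi) \<and> 2*pi \<le> x$j \<and> x$j < 2*pi + b"
      using b by (auto simp: torus_cube_def C2_def axis_def split: if_splits; smt (verit))
    show ?thesis using b by (auto simp: indicator_def * ** ***)
  qed
  have "(\<integral>\<^sup>+x. indicator ?C x * g (x + axis j b) \<partial>lborel) = (\<integral>\<^sup>+x. indicator ?C (x - axis j b) * g x \<partial>lborel)"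
    using nn_integral_lborel_translate[of "\<lambda>x. indicator ?C (x - axis j b) * g x" "axis j b"] by simp
  also have "\<dots> = (\<integral>\<^sup>+x. indicator C1 x * g x \<partial>lborel) + (\<integral>\<^sup>+x. indicator C2 (x - axis j (2*pi)) * g x \<partial>lborel)"
    by (subst nn_integral_add[symmetric]) (auto simp: split distrib_right)
  also have "(\<integral>\<^sup>+x. indicator C2 (x - axis j (2*pi)) * g x \<partial>lborel) = (\<integral>\<^sup>+x. indicator C2 x * g (x + axis j (2*pi)) \<partial>lborel)"
    using nn_integral_lborel_translate[of "\<lambda>x. indicator C2 (x - axis j (2*pi)) * g x" "axis j (2*pi)"] by simp
  also have "\<dots> = (\<integral>\<^sup>+x. indicator C2 x * g x \<partial>lborel)"
    using per by (simp add: vperiodic_def)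
  also have "(\<integral>\<^sup>+x. indicator C1 x * g x \<partial>lborel) + \<dots> = (\<integral>\<^sup>+x. indicator ?C x * g x \<partial>lborel)"
    by (subst nn_integral_add[symmetric])
       (auto intro!: nn_integral_cong simp: C1_def C2_def indicator_def)
  finally show ?thesis
    by (simp add: shift nn_integral_torus)
qed

lemma nn_integral_torus_translate:
  fixes g :: "real^'n \<Rightarrow> ennreal"
  assumes g: "g \<in> borel_measurable borel" "vperiodic g"
  shows "(\<integral>\<^sup>+x. g (x + h) \<partial>torus_measure) = (\<integral>\<^sup>+x. g x \<partial>torus_measure)"
proof -
  have "(\<integral>\<^sup>+x. g (x + (\<Sum>j\<in>S. axis j (h$j))) \<partial>torus_measure) = (\<integral>\<^sup>+x. g x \<partial>torus_measure)" if "finite S" for S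
    using that
  proof (induction S)
    case (insert j S)
    let ?v = "\<Sum>i\<in>S. axis i (h$i)"
    have [measurable]: "(\<lambda>x. g (x + ?v)) \<in> borel_measurable borel" using g(1) by measurable
    have "vperiodic (\<lambda>x. g (x + ?v))"
      using g(2) unfolding vperiodic_def by (metis (no_types, lifting) add.assoc add.commute)
    from nn_integral_torus_translate_axis[OF _ this, of j "h$j"] show ?case
      using insert by (simp add: add.assoc)
  qed simp
  from this[of UNIV] have "(\<integral>\<^sup>+x. g (x + (\<Sum>j\<in>UNIV. axis j (h$j))) \<partial>torus_measure) = (\<integral>\<^sup>+x. g x \<partial>torus_measure)"
    by simp
  moreover have "(\<Sum>j\<in>UNIV. axis j (h$j)) = h"
    by (simp add: vec_eq_iff axis_def)
  ultimately show ?thesis by simp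
qed

lemma nn_integral_lborel_reflect:
  fixes g :: "real^'n \<Rightarrow> ennreal"
  assumes [measurable]: "g \<in> borel_measurable borel"
  shows "(\<integral>\<^sup>+x. g (- x) \<partial>lborel) = (\<integral>\<^sup>+x. g x \<partial>lborel)"
proof -
  have "lborel = distr lborel borel (\<lambda>x::real^'n. - x)"
    using lborel_affine[of "-1" "0::real^'n"] by (simp add: density_1 flip: one_ennreal_def)
  then have "(\<integral>\<^sup>+x. g x \<partial>lborel) = (\<integral>\<^sup>+x. g x \<partial>(distr lborel borel (\<lambda>x::real^'n. - x)))" by simp
  also have "\<dots> = (\<integral>\<^sup>+x. g (- x) \<partial>lborel)"
    by (subst nn_integral_distr) auto
  finally show ?thesis by simp
qed

text \<open>Up to null faces the reflected cube is the cube moved back by one period in every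
  coordinate.\<close>

lemma nn_integral_torus_reflect:
  fixes g :: "real^'n \<Rightarrow> ennreal"
  assumes g [measurable]: "g \<in> borel_measurable borel" and "vperiodic g"
  shows "(\<integral>\<^sup>+x. g (- x) \<partial>torus_measure) = (\<integral>\<^sup>+x. g x \<partial>torus_measure)"
proof -
  let ?C = "torus_cube :: (real^'n) set" and ?v = "(\<chi> i. 2*pi) :: real^'n"
  have "(\<integral>\<^sup>+x. indicator ?C x * g (- x) \<partial>lborel) = (\<integral>\<^sup>+x. indicator ?C (- x) * g x \<partial>lborel)"
    using nn_integral_lborel_reflect[of "\<lambda>x. indicator ?C (- x) * g x"] by simp
  also have "\<dots> = (\<integral>\<^sup>+x. indicator ?C (x + ?v) * g x \<partial>lborel)"
  proof (rule nn_integral_cong_AE)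
    have *: "indicator ?C (- x) = (indicator ?C (x + ?v) :: ennreal)" if "\<forall>j. x$j \<noteq> 0" "\<forall>j. x$j \<noteq> - (2*pi)" for x
      using that by (auto simp: indicator_def torus_cube_def less_le; smt (verit))
    show "AE x in lborel. indicator ?C (- x) * g x = indicator ?C (x + ?v) * g x"
      using AE_all_coords_neq[of 0] AE_all_coords_neq[of "-(2*pi)"]
      by eventually_elim (simp add: *)
  qed
  also have "\<dots> = (\<integral>\<^sup>+x. indicator ?C x * g (x - ?v) \<partial>lborel)"
    using nn_integral_lborel_translate[of "\<lambda>x. indicator ?C x * g (x - ?v)" ?v] by simp
  finally have "(\<integral>\<^sup>+x. g (- x) \<partial>torus_measure) = (\<integral>\<^sup>+x. g (x + (- ?v)) \<partial>torus_measure)"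
    by (simp add: nn_integral_torus)
  then show ?thesis using nn_integral_torus_translate[OF assms, of "- ?v"] by simp
qed


text \<open>Passes from nonnegative to complex integrands: invariance is applied to
  \<open>norm\<close> of \<open>g\<close> for integrability, and to the positive and negative parts
  of \<open>Re\<close> and \<open>Im\<close> for the value. Serves both translations and the
  reflection.\<close>

lemma torus_integral_invariant:
  fixes g :: "real^'n \<Rightarrow> complex" and \<phi> :: "real^'n \<Rightarrow> real^'n"
  assumes inv: "\<And>G::real^'n \<Rightarrow> ennreal. G \<in> borel_measurable borel \<Longrightarrow> vperiodic G \<Longrightarrow>
      (\<integral>\<^sup>+x. G (\<phi> x) \<partial>torus_measure) = (\<integral>\<^sup>+x. G x \<partial>torus_measure)"
    and [measurable]: "\<phi> \<in> borel_measurable borel" "g \<in> borel_measurable borel" and per: "vperiodic g"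
  shows "integrable torus_measure (\<lambda>x. g (\<phi> x)) \<longleftrightarrow> integrable torus_measure g"
    and "integral\<^sup>L torus_measure (\<lambda>x. g (\<phi> x)) = integral\<^sup>L torus_measure g"
proof -
  have inv': "(\<integral>\<^sup>+x. ennreal (u (g (\<phi> x))) \<partial>torus_measure) = (\<integral>\<^sup>+x. ennreal (u (g x)) \<partial>torus_measure)"
    if [measurable]: "u \<in> borel_measurable borel" for u
    using per by (intro inv[of "\<lambda>x. ennreal (u (g x))"]) (auto simp: vperiodic_def)
  show int: "integrable torus_measure (\<lambda>x. g (\<phi> x)) \<longleftrightarrow> integrable torus_measure g"
    by (simp add: integrable_iff_bounded inv'[of norm])
  show "integral\<^sup>L torus_measure (\<lambda>x. g (\<phi> x)) = integral\<^sup>L torus_measure g"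
  proof (cases "integrable torus_measure g")
    case True
    have i: "integrable torus_measure (\<lambda>x. g (\<phi> x))" using True int by simp
    note [simp del] = integral_Re integral_Im
    have "integral\<^sup>L torus_measure (\<lambda>x. Re (g (\<phi> x))) = integral\<^sup>L torus_measure (\<lambda>x. Re (g x))"
      using True i inv'[of Re] inv'[of "\<lambda>z. - Re z"] by (simp add: real_lebesgue_integral_def)
    moreover have "integral\<^sup>L torus_measure (\<lambda>x. Im (g (\<phi> x))) = integral\<^sup>L torus_measure (\<lambda>x. Im (g x))"
      using True i inv'[of Im] inv'[of "\<lambda>z. - Im z"] by (simp add: real_lebesgue_integral_def)
    ultimately show ?thesis using True i by (simp add: complex_eq_iff flip: integral_Re integral_Im)
  next
    case False
    then show ?thesis using int by (simp add: not_integrable_integral_eq)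
  qed
qed

lemma torus_integral_translate:
  fixes g :: "real^'n \<Rightarrow> complex"
  assumes "g \<in> borel_measurable borel" "vperiodic g"
  shows "integrable torus_measure (\<lambda>x. g (x + h)) \<longleftrightarrow> integrable torus_measure g"
    and "integral\<^sup>L torus_measure (\<lambda>x. g (x + h)) = integral\<^sup>L torus_measure g"
  by (rule torus_integral_invariant[where \<phi>="\<lambda>x. x + h"]; use assms in \<open>simp add: nn_integral_torus_translate\<close>)+

lemma torus_integral_reflect:
  fixes g :: "real^'n \<Rightarrow> complex"
  assumes "g \<in> borel_measurable borel" "vperiodic g"
  shows "integrable torus_measure (\<lambda>x. g (- x)) \<longleftrightarrow> integrable torus_measure g"
    and "integral\<^sup>L torus_measure (\<lambda>x. g (- x)) = integral\<^sup>L torus_measure g"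
  by (rule torus_integral_invariant[where \<phi>="\<lambda>x. - x"]; use assms in \<open>simp add: nn_integral_torus_reflect\<close>)+

lemma torus_integral_translate_real:
  fixes g :: "real^'n \<Rightarrow> real"
  assumes [measurable]: "g \<in> borel_measurable borel" and "vperiodic g"
  shows "integrable torus_measure (\<lambda>x. g (x + h)) \<longleftrightarrow> integrable torus_measure g"
    and "integral\<^sup>L torus_measure (\<lambda>x. g (x + h)) = integral\<^sup>L torus_measure g"
proof -
  have "(\<lambda>x. complex_of_real (g x)) \<in> borel_measurable borel" "vperiodic (\<lambda>x. complex_of_real (g x))"
    using assms(2) by (auto simp: vperiodic_def)
  note * = torus_integral_translate[OF this, of h]
  show "integrable torus_measure (\<lambda>x. g (x + h)) \<longleftrightarrow> integrable torus_measure g"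
    using *(1) by (simp only: complex_of_real_integrable_eq)
  show "integral\<^sup>L torus_measure (\<lambda>x. g (x + h)) = integral\<^sup>L torus_measure g"
    using *(2) by simp
qed

section \<open>Fourier coefficients and the operators sigma\<close>

lemma periodic_fun_iff: "periodic_fun f \<longleftrightarrow> vperiodic f"
  by (simp add: periodic_fun_def vperiodic_def)

lemma char_exp_add: "char_exp k (x + y) = char_exp k x * char_exp k y"
  by (simp add: char_exp_def cis_mult distrib_left sum.distrib)

lemma char_exp_uminus: "char_exp k (- x) = cnj (char_exp k x)"
  by (simp add: char_exp_def sum_negf cis_cnj)

lemma char_exp_uminus_freq: "char_exp (- k) x = cnj (char_exp k x)"
  by (simp add: char_exp_def sum_negf cis_cnj)

lemma char_exp_add_freq: "char_exp (k + l) x = char_exp k x * char_exp l x"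
  by (simp add: char_exp_def cis_mult distrib_right sum.distrib)

lemma char_exp_0 [simp]: "char_exp 0 x = 1"
  by (simp add: char_exp_def)

lemma norm_char_exp [simp]: "norm (char_exp k x) = 1"
  by (simp add: char_exp_def)

lemma char_exp_times_cnj [simp]: "char_exp k x * cnj (char_exp k x) = 1"
  by (simp add: complex_norm_square[symmetric])

lemma char_exp_axis: "char_exp k (axis j a) = cis (of_int (k$j) * a)"
proof -
  have "(\<Sum>i\<in>UNIV. of_int (k$i) * axis j a $ i) = (\<Sum>i\<in>UNIV. if i = j then of_int (k$j) * a else 0)"
    by (rule sum.cong) (auto simp: axis_def)
  then show ?thesis by (simp add: char_exp_def)
qed

lemma char_exp_conv_prod: "char_exp k x = (\<Prod>j\<in>UNIV. cis (of_int (k$j) * x$j))"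
  by (simp add: char_exp_def cis_conv_exp sum_distrib_left exp_sum)

lemma vperiodic_char_exp: "vperiodic (char_exp k)"
proof -
  have "char_exp k (axis j (2*pi)) = 1" for j
    unfolding char_exp_axis by (metis cis_multiple_2pi Ints_of_int mult.commute)
  then show ?thesis by (simp add: vperiodic_def char_exp_add)
qed

lemma continuous_char_exp: "continuous_on UNIV (char_exp k)"
  unfolding char_exp_def cis_conv_exp by (intro continuous_intros)

lemma char_exp_measurable [measurable]: "char_exp k \<in> borel_measurable borel"
  by (rule borel_measurable_continuous_onI[OF continuous_char_exp])

lemma integral_char_exp:
  fixes k :: "int^'n"
  shows "integral\<^sup>L torus_measure (char_exp k) = (if k = 0 then 1 else 0)"
proof (cases "k = 0")
  case True
  then have "char_exp k = (\<lambda>_. 1)" by auto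
  with True show ?thesis by simp
next
  case False
  then obtain j where j: "k$j \<noteq> 0" by (auto simp: vec_eq_iff)
  \<comment> \<open>Half a period of the character in direction \<open>j\<close>: translation by
    \<open>h\<close> leaves the integral unchanged but flips the sign of the character.\<close>
  define h :: "real^'n" where "h = axis j (pi / of_int (k$j))"
  have "char_exp k h = -1" using j by (simp add: h_def char_exp_axis)
  then have "integral\<^sup>L torus_measure (char_exp k) = - integral\<^sup>L torus_measure (char_exp k)"
    using torus_integral_translate(2)[OF char_exp_measurable vperiodic_char_exp, of k h]
    by (simp add: char_exp_add)
  with False show ?thesis by simp
qed

lemma cnj_borel_measurable [measurable]: "cnj \<in> borel_measurable borel"
  by (rule borel_measurable_continuous_onI) (intro continuous_intros)

definition fcoef :: "(real^'n \<Rightarrow> complex) \<Rightarrow> int^'n \<Rightarrow> complex" where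
  "fcoef g k = (\<integral>x. g x * cnj (char_exp k x) \<partial>torus_measure)"

lemma integrable_times_cnj_char_exp:
  assumes g: "integrable torus_measure g"
  shows "integrable torus_measure (\<lambda>x. g x * cnj (char_exp k x))"
proof (rule Bochner_Integration.integrable_bound[OF g])
  have "g \<in> borel_measurable borel" using borel_measurable_integrable[OF g] by simp
  then show "(\<lambda>x. g x * cnj (char_exp k x)) \<in> borel_measurable torus_measure" by simp
qed (simp add: norm_mult)

lemma integrable_trig_poly [simp]:
  "integrable torus_measure (\<lambda>x. \<Sum>k\<in>S. c k * char_exp k x)"
  by (intro Bochner_Integration.integrable_sum integrable_mult_right integrable_torus_bounded[where B=1]) auto

lemma fcoef_diff:
  assumes "integrable torus_measure f" "integrable torus_measure g"
  shows "fcoef (\<lambda>x. f x - g x) k = fcoef f k - fcoef g k"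
  using assms[THEN integrable_times_cnj_char_exp, of k] by (simp add: fcoef_def left_diff_distrib)

lemma fcoef_char_exp: "fcoef (char_exp k) l = (if k = l then 1 else 0)"
proof -
  have "fcoef (char_exp k) l = (\<integral>x. char_exp (k + - l) x \<partial>torus_measure)"
    by (simp only: fcoef_def char_exp_add_freq char_exp_uminus_freq)
  then show ?thesis unfolding integral_char_exp by simp
qed

lemma fcoef_trig_poly:
  assumes "finite S"
  shows "fcoef (\<lambda>x. \<Sum>k\<in>S. c k * char_exp k x) l = (if l \<in> S then c l else 0)"
proof -
  have "fcoef (\<lambda>x. \<Sum>k\<in>S. c k * char_exp k x) l = (\<Sum>k\<in>S. c k * fcoef (char_exp k) l)"
    unfolding fcoef_def sum_distrib_right mult.assoc
    by (subst Bochner_Integration.integral_sum)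
       (auto intro!: integrable_mult_right integrable_times_cnj_char_exp integrable_torus_bounded[where B=1])
  also have "\<dots> = (\<Sum>k\<in>S. if k = l then c l else 0)"
    by (rule sum.cong) (auto simp: fcoef_char_exp)
  finally show ?thesis using assms by simp
qed

lemma integral_times_cnj_trig_poly:
  assumes g: "integrable torus_measure g"
  shows "integrable torus_measure (\<lambda>x. g x * cnj (\<Sum>k\<in>S. c k * char_exp k x))" (is ?A)
    and "(\<integral>x. g x * cnj (\<Sum>k\<in>S. c k * char_exp k x) \<partial>torus_measure) = (\<Sum>k\<in>S. cnj (c k) * fcoef g k)" (is ?B)
proof -
  have eq: "g x * cnj (\<Sum>k\<in>S. c k * char_exp k x) = (\<Sum>k\<in>S. cnj (c k) * (g x * cnj (char_exp k x)))" for x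
    by (simp add: sum_distrib_left mult_ac)
  show ?A unfolding eq
    by (intro Bochner_Integration.integrable_sum integrable_mult_right integrable_times_cnj_char_exp g)
  show ?B unfolding eq fcoef_def
    by (subst Bochner_Integration.integral_sum)
       (auto intro!: integrable_mult_right integrable_times_cnj_char_exp g)
qed

text \<open>Integrates \<open>(norm (g x - T x))\<^sup>2 \<ge> 0\<close> for the Fourier polynomial
  \<open>T\<close> over \<open>S\<close>. The products of \<open>g\<close> and of \<open>T\<close>
  with \<open>cnj (T x)\<close> both have the integral \<open>Q\<close>.\<close>

lemma bessel_inequality:
  fixes g :: "real^'n \<Rightarrow> complex"
  assumes g [measurable]: "g \<in> borel_measurable borel" and g2: "integrable torus_measure (\<lambda>x. (norm (g x))\<^sup>2)"
    and S: "finite S"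
  shows "(\<Sum>k\<in>S. (norm (fcoef g k))\<^sup>2) \<le> (\<integral>x. (norm (g x))\<^sup>2 \<partial>torus_measure)"
proof -
  have i: "integrable torus_measure g"
  proof (rule Bochner_Integration.integrable_bound)
    show "integrable torus_measure (\<lambda>x. 1 + (norm (g x))\<^sup>2)" using g2 by simp
    have "norm (g x) \<le> 1 + (norm (g x))\<^sup>2" for x
      using sum_squares_bound[of 1 "norm (g x)"] norm_ge_zero[of "g x"] by (simp; linarith)
    then show "AE x in torus_measure. norm (g x) \<le> norm (1 + (norm (g x))\<^sup>2)" by auto
  qed simp
  define T where "T x = (\<Sum>k\<in>S. fcoef g k * char_exp k x)" for x
  define Q where "Q = (\<Sum>k\<in>S. (norm (fcoef g k))\<^sup>2)"
  have gT: "integrable torus_measure (\<lambda>x. g x * cnj (T x))" "(\<integral>x. g x * cnj (T x) \<partial>torus_measure) = of_real Q"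
    unfolding T_def using integral_times_cnj_trig_poly[OF i, of "fcoef g" S]
    by (simp_all add: Q_def complex_norm_square mult.commute del: cnj_sum of_real_power)
  have iT: "integrable torus_measure T" unfolding T_def by simp
  have TT: "integrable torus_measure (\<lambda>x. T x * cnj (T x))" "(\<integral>x. T x * cnj (T x) \<partial>torus_measure) = of_real Q"
    using integral_times_cnj_trig_poly[OF iT, of "fcoef g" S] fcoef_trig_poly[OF S, of "fcoef g"] T_def[abs_def]
    by (simp_all add: Q_def complex_norm_square mult.commute del: cnj_sum of_real_power)
  have exp: "(norm (g x - T x))\<^sup>2 = (norm (g x))\<^sup>2 - 2 * Re (g x * cnj (T x)) + Re (T x * cnj (T x))" for x
    unfolding cmod_power2 by (simp add: power2_eq_square algebra_simps)
  have "0 \<le> (\<integral>x. (norm (g x - T x))\<^sup>2 \<partial>torus_measure)" by simp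
  also have "\<dots> = (\<integral>x. (norm (g x))\<^sup>2 \<partial>torus_measure) - 2 * (\<integral>x. Re (g x * cnj (T x)) \<partial>torus_measure) 
      + (\<integral>x. Re (T x * cnj (T x)) \<partial>torus_measure)"
    unfolding exp using g2 integrable_Re[OF gT(1)] integrable_Re[OF TT(1)] by (simp del: times_complex.sel integral_Re)
  also have "\<dots> = (\<integral>x. (norm (g x))\<^sup>2 \<partial>torus_measure) - Q"
    using integral_Re[OF gT(1)] integral_Re[OF TT(1)] gT(2) TT(2) by (simp del: times_complex.sel)
  finally show ?thesis by (simp add: Q_def)
qed

lemma fcoef_translate:
  assumes "g \<in> borel_measurable borel" "vperiodic g"
  shows "fcoef (\<lambda>x. g (x + h)) k = char_exp k h * fcoef g k"
proof -
  have "vperiodic (\<lambda>x. g x * cnj (char_exp k x))"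
    using assms(2) vperiodic_char_exp[of k] by (simp add: vperiodic_def)
  from torus_integral_translate(2)[OF _ this, of h] 
  have "fcoef g k = (\<integral>x. g (x + h) * cnj (char_exp k (x + h)) \<partial>torus_measure)"
    using assms(1) by (simp add: fcoef_def)
  also have "\<dots> = (\<integral>x. (g (x + h) * cnj (char_exp k x)) * cnj (char_exp k h) \<partial>torus_measure)"
    by (simp add: char_exp_add mult_ac)
  also have "\<dots> = fcoef (\<lambda>x. g (x + h)) k * cnj (char_exp k h)"
    by (simp add: fcoef_def)
  finally have "char_exp k h * fcoef g k = fcoef (\<lambda>x. g (x + h)) k * (char_exp k h * cnj (char_exp k h))"
    by (simp add: mult_ac)
  then show ?thesis by simp
qed

text \<open>Convolution with a character yields a multiple of that character. The integrand equals
  \<open>u (- y + x)\<close> for a periodic \<open>u\<close>, so reflection and translation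
  invariance reduce it to the integral defining the coefficient.\<close>

lemma integral_reflected_times_char_exp:
  assumes g [measurable]: "g \<in> borel_measurable borel" and "vperiodic g" and i: "integrable torus_measure g"
  shows "integrable torus_measure (\<lambda>y. g (x - y) * char_exp k y)"
    and "(\<integral>y. g (x - y) * char_exp k y \<partial>torus_measure) = fcoef g k * char_exp k x"
proof -
  define u where "u y = g y * cnj (char_exp k y) * char_exp k x" for y
  have [measurable]: "u \<in> borel_measurable borel" unfolding u_def by simp
  have p: "vperiodic u" 
    using assms(2) vperiodic_char_exp[of k] by (simp add: vperiodic_def u_def)
  have p': "vperiodic (\<lambda>y. u (y + x))" using p unfolding vperiodic_def
    by (metis (no_types, lifting) add.assoc add.commute)
  have iu: "integrable torus_measure u" unfolding u_def
    by (intro integrable_mult_left integrable_times_cnj_char_exp i)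
  have eq: "g (x - y) * char_exp k y = u (- y + x)" for y
  proof -
    have "char_exp k y = cnj (char_exp k (x - y)) * char_exp k x"
      using char_exp_add[of k "y - x" x] char_exp_uminus[of k "x - y"] by simp
    then show ?thesis by (simp add: u_def)
  qed
  show "integrable torus_measure (\<lambda>y. g (x - y) * char_exp k y)"
    unfolding eq using torus_integral_reflect(1)[OF _ p'] torus_integral_translate(1)[OF _ p, of x] iu by simp
  have "(\<integral>y. u (- y + x) \<partial>torus_measure) = integral\<^sup>L torus_measure u"
    using torus_integral_reflect(2)[OF _ p'] torus_integral_translate(2)[OF _ p, of x] by simp
  then show "(\<integral>y. g (x - y) * char_exp k y \<partial>torus_measure) = fcoef g k * char_exp k x"
    unfolding eq by (simp only:) (simp add: u_def[abs_def] fcoef_def)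
qed

section \<open>Multipliers of the de la Vallee-Poussin operators\<close>

text \<open>The inequality is strict so that \<open>ibox (2*l)\<close> is exactly the frequency
  range of \<open>vp l\<close> and \<open>ibox 1\<close> holds the zero frequency alone.\<close>

definition ibox :: "nat \<Rightarrow> (int^'n) set" where
  "ibox N = {k. \<forall>j. \<bar>k$j\<bar> < int N}"

lemma vec_set_eq_image_PiE:
  "{k::'a^'n. \<forall>j. k$j \<in> S} = vec_lambda ` (UNIV \<rightarrow>\<^sub>E S)"
proof (intro set_eqI iffI)
  fix k :: "'a^'n" assume "k \<in> {k. \<forall>j. k$j \<in> S}"
  then show "k \<in> vec_lambda ` (UNIV \<rightarrow>\<^sub>E S)" by (intro image_eqI[of _ _ "\<lambda>j. k$j"]) auto
qed auto

lemma inj_vec_lambda: "inj_on vec_lambda A"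
  by (rule inj_onI) (metis vec_lambda_inverse UNIV_I)

lemma finite_vec_set: "finite S \<Longrightarrow> finite {k::'a^'n. \<forall>j. k$j \<in> S}"
  unfolding vec_set_eq_image_PiE by (intro finite_imageI finite_PiE) auto

lemma card_vec_set: "finite S \<Longrightarrow> card {k::'a^'n. \<forall>j. k$j \<in> S} = card S ^ CARD('n)"
  unfolding vec_set_eq_image_PiE by (simp add: card_image inj_vec_lambda card_PiE)

text \<open>Expands tensor products of one-dimensional exponential sums; used for the kernels and
  again for the test polynomials.\<close>

lemma prod_sum_vec:
  fixes F :: "'n::finite \<Rightarrow> 'a \<Rightarrow> 'b::comm_semiring_1"
  assumes "finite S"
  shows "(\<Prod>j\<in>UNIV. \<Sum>i\<in>S. F j i) = (\<Sum>k\<in>{k::'a^'n. \<forall>j. k$j \<in> S}. \<Prod>j\<in>UNIV. F j (k$j))"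
  unfolding vec_set_eq_image_PiE
  by (subst prod_sum_PiE) (auto simp: assms sum.reindex inj_vec_lambda)

lemma ibox_eq: "ibox N = {k. \<forall>j. k$j \<in> {- int N<..<int N}}"
  by (auto simp: ibox_def abs_less_iff minus_less_iff[of _ "int N"])

lemma finite_ibox [simp]: "finite (ibox N)"
  unfolding ibox_eq by (rule finite_vec_set) simp

lemma card_ibox_le: "card (ibox N :: (int^'n) set) \<le> (2 * N) ^ CARD('n)"
proof -
  have "card {- int N<..<int N} \<le> 2 * N" by simp
  from power_mono[OF this] show ?thesis unfolding ibox_eq by (subst card_vec_set) auto
qed

lemma ibox_mono: "M \<le> N \<Longrightarrow> ibox M \<subseteq> ibox N"
  unfolding ibox_def by (auto intro: less_le_trans)

text \<open>The Fourier coefficient of \<open>vp1 l\<close> as the proportion of averaged Dirichlet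
  kernels that contain frequency \<open>j\<close>: a trapezoid, equal to 1 up to \<open>l\<close>
  and falling linearly to 0 at \<open>2*l\<close>.\<close>

definition vcoef :: "nat \<Rightarrow> int \<Rightarrow> real" where
  "vcoef l j = real (card {k\<in>{l..2*l-1}. \<bar>j\<bar> \<le> int k}) / real l"

lemma vcoef_nonneg: "0 \<le> vcoef l j" by (simp add: vcoef_def)

lemma vcoef_le_1: "vcoef l j \<le> 1"
proof (cases "l = 0")
  case False
  have "card {k\<in>{l..2*l-1}. \<bar>j\<bar> \<le> int k} \<le> card {l..2*l-1}" by (rule card_mono) auto
  with False show ?thesis by (simp add: vcoef_def)
qed (simp add: vcoef_def)

lemma vcoef_eq_1: "l > 0 \<Longrightarrow> \<bar>j\<bar> \<le> int l \<Longrightarrow> vcoef l j = 1"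
proof -
  assume l: "l > 0" "\<bar>j\<bar> \<le> int l"
  then have "{k\<in>{l..2*l-1}. \<bar>j\<bar> \<le> int k} = {l..2*l-1}" by auto
  with l show ?thesis by (simp add: vcoef_def)
qed

lemma vcoef_eq_0: "int (2*l) \<le> \<bar>j\<bar> \<Longrightarrow> vcoef l j = 0"
proof (cases "l = 0")
  case False
  assume "int (2*l) \<le> \<bar>j\<bar>"
  with False have "{k\<in>{l..2*l-1}. \<bar>j\<bar> \<le> int k} = {}" by auto
  then show ?thesis unfolding vcoef_def by (simp only:) simp
qed (simp add: vcoef_def)

text \<open>Measures the sloping side of the trapezoid. The lower bound takes
  \<open>l = 2^(n+1)\<close> and \<open>N = 3 * 2^n\<close>, where the value is 1/2.\<close>

lemma vcoef_le: 
  assumes "l > 0" "\<bar>j\<bar> \<ge> int N" "N \<le> 2*l" shows "vcoef l j \<le> (2 * real l - real N) / real l"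
proof -
  have "card {k\<in>{l..2*l-1}. \<bar>j\<bar> \<le> int k} \<le> card {N..<2*l}"
    using assms by (intro card_mono) auto
  also have "\<dots> = 2*l - N" by simp
  finally have "real (card {k\<in>{l..2*l-1}. \<bar>j\<bar> \<le> int k}) \<le> real (2*l - N)" by linarith
  also have "\<dots> = 2 * real l - real N" using assms(3) by simp
  finally show ?thesis unfolding vcoef_def by (rule divide_right_mono) simp
qed

lemma vp1_eq: 
  assumes "l > 0"
  shows "vp1 l t = (\<Sum>j\<in>{- int (2*l)<..<int (2*l)}. of_real (vcoef l j) * cis (of_int j * t))"
proof -
  let ?J = "{- int (2*l)<..<int (2*l)}"
  have "dirichlet k t = (\<Sum>j\<in>?J. if \<bar>j\<bar> \<le> int k then cis (of_int j * t) else 0)" if "k \<in> {l..2*l-1}" for k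
  proof -
    have "{-int k..int k} = ?J \<inter> {j. \<bar>j\<bar> \<le> int k}" using that assms by auto
    then show ?thesis by (simp add: dirichlet_def sum.inter_restrict[symmetric] flip: sum.inter_filter Collect_conj_eq)
      (auto simp: Int_def intro!: sum.cong)
  qed
  then have "(\<Sum>k\<in>{l..2*l-1}. dirichlet k t) = (\<Sum>j\<in>?J. \<Sum>k\<in>{l..2*l-1}. if \<bar>j\<bar> \<le> int k then cis (of_int j * t) else 0)"
    by (subst sum.swap) simp
  also have "\<dots> = (\<Sum>j\<in>?J. of_nat (card {k\<in>{l..2*l-1}. \<bar>j\<bar> \<le> int k}) * cis (of_int j * t))"
    by (simp flip: sum.inter_filter)
  finally show ?thesis
    by (simp add: vp1_def vcoef_def sum_distrib_left)
qed

definition vmult :: "nat \<Rightarrow> int^'n \<Rightarrow> real" where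
  "vmult l k = (\<Prod>j\<in>UNIV. vcoef l (k$j))"

lemma vmult_nonneg: "0 \<le> vmult l k" 
  unfolding vmult_def by (intro prod_nonneg) (simp add: vcoef_nonneg)

lemma vmult_le_vcoef: "vmult l k \<le> vcoef l (k$j)"
proof -
  have "vmult l k = vcoef l (k$j) * (\<Prod>i\<in>UNIV-{j}. vcoef l (k$i))"
    unfolding vmult_def by (rule prod.remove) auto
  also have "\<dots> \<le> vcoef l (k$j) * 1"
    by (intro mult_left_mono prod_le_1) (auto simp: vcoef_nonneg vcoef_le_1)
  finally show ?thesis by simp
qed

lemma vmult_le_1: "vmult l k \<le> 1"
  unfolding vmult_def by (intro prod_le_1) (auto simp: vcoef_nonneg vcoef_le_1)

lemma vmult_eq_1: "l > 0 \<Longrightarrow> (\<And>j. \<bar>k$j\<bar> \<le> int l) \<Longrightarrow> vmult l k = 1"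
  by (simp add: vmult_def vcoef_eq_1)

lemma vmult_eq_0: "k \<notin> ibox (2*l) \<Longrightarrow> vmult l k = 0"
  by (auto simp: vmult_def ibox_def not_less intro!: vcoef_eq_0) 

lemma vp_eq:
  assumes "l > 0"
  shows "vp l x = (\<Sum>k\<in>ibox (2*l). of_real (vmult l k) * char_exp k x)"
  unfolding vp_def vp1_eq[OF assms] ibox_eq
  by (subst prod_sum_vec) (simp_all add: vmult_def char_exp_conv_prod prod.distrib)

lemma vp_op_eq:
  fixes g :: "real^'n \<Rightarrow> complex"
  assumes g [measurable]: "g \<in> borel_measurable borel" and "vperiodic g" and i: "integrable torus_measure g"
    and l: "l > 0"
  shows "vp_op l g x = (\<Sum>k\<in>ibox (2*l). of_real (vmult l k) * fcoef g k * char_exp k x)"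
proof -
  have [measurable]: "vp l \<in> borel_measurable (borel :: (real^'n) measure)"
    unfolding vp_eq[OF l, abs_def] by measurable
  have "vp_op l g x = (\<integral>y. g (x - y) * vp l y \<partial>torus_measure)"
    unfolding vp_op_def tconv_def by (subst integral_torus) (auto simp: scaleR_conv_of_real)
  also have "\<dots> = (\<integral>y. (\<Sum>k\<in>ibox (2*l). of_real (vmult l k) * (g (x - y) * char_exp k y)) \<partial>torus_measure)"
    by (simp add: vp_eq[OF l] sum_distrib_left mult_ac)
  also have "\<dots> = (\<Sum>k\<in>ibox (2*l). of_real (vmult l k) * (fcoef g k * char_exp k x))"
    using integral_reflected_times_char_exp[OF assms(1-3)]
    by (subst Bochner_Integration.integral_sum) auto
  finally show ?thesis by (simp add: mult.assoc)
qed

definition sigma_mult :: "nat \<Rightarrow> int^'n \<Rightarrow> real" where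
  "sigma_mult s k = (if s = 0 then vmult 1 k else vmult (2^s) k - vmult (2^(s-1)) k)"

lemma abs_sigma_mult_le_1: "\<bar>sigma_mult s k\<bar> \<le> 1"
  using vmult_nonneg[of "2^s" k] vmult_nonneg[of "2^(s-1)" k] vmult_le_1[of "2^s" k] vmult_le_1[of "2^(s-1)" k]
    vmult_nonneg[of 1 k] vmult_le_1[of 1 k]
  unfolding sigma_mult_def by (simp split: if_split) linarith

lemma ibox_double: "s > 0 \<Longrightarrow> ibox (2 * 2^(s-1)) \<subseteq> ibox (2^(s+1))"
  by (rule ibox_mono) (cases s; simp)

lemma sigma_mult_eq_0: "k \<notin> ibox (2^(s+1)) \<Longrightarrow> sigma_mult s k = 0"
  using ibox_double[of s] vmult_eq_0[of k "2^s"] vmult_eq_0[of k "2^(s-1)"] vmult_eq_0[of k 1]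
  unfolding sigma_mult_def by (auto split: if_split)

text \<open>Both multipliers are 1 where all coordinates are at most \<open>2^(s-1)\<close> in
  modulus, and cancel; \<open>Suc\<close> turns the strict box into this closed one.\<close>

lemma sigma_mult_eq_0': "s > 0 \<Longrightarrow> k \<in> ibox (Suc (2^(s-1))) \<Longrightarrow> sigma_mult s k = 0"
proof -
  assume s: "s > 0" and k: "k \<in> ibox (Suc (2^(s-1)))"
  have 1: "\<bar>k$j\<bar> \<le> int (2^(s-1))" for j
  proof -
    have "\<bar>k$j\<bar> < int (Suc (2^(s-1)))" using k unfolding ibox_def by blast
    then show ?thesis by linarith
  qed
  have "(2::nat)^(s-1) \<le> 2^s" by (rule power_increasing) auto
  then have 2: "\<bar>k$j\<bar> \<le> int (2^s)" for j using 1[of j] by linarith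
  show ?thesis using s vmult_eq_1[of "2^(s-1)" k] vmult_eq_1[of "2^s" k] 1 2 by (simp add: sigma_mult_def)
qed

lemma sigma_block_eq:
  fixes g :: "real^'n \<Rightarrow> complex"
  assumes g: "g \<in> borel_measurable borel" "vperiodic g" "integrable torus_measure g"
  shows "sigma_block s g x = (\<Sum>k\<in>ibox (2^(s+1)). of_real (sigma_mult s k) * fcoef g k * char_exp k x)"
proof (cases "s = 0")
  case True
  then show ?thesis by (simp add: sigma_block_def vp_op_eq[OF g] sigma_mult_def)
next
  case False
  have "vp_op (2^(s-1)) g x = (\<Sum>k\<in>ibox (2^(s+1)). of_real (vmult (2^(s-1)) k) * fcoef g k * char_exp k x)"
    using False ibox_double[of s] by (subst vp_op_eq[OF g]) (auto intro!: sum.mono_neutral_left simp: vmult_eq_0)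
  then show ?thesis using False
    by (simp add: sigma_block_def vp_op_eq[OF g] sigma_mult_def sum_subtractf left_diff_distrib)
qed

section \<open>Sparse approximation by greedy selection\<close>

text \<open>For negative arguments the reciprocal is estimated: with \<open>z = - y\<close> the
  product of \<open>1 - z + z\<^sup>2\<close> and the quadratic Taylor minorant of
  \<open>exp z\<close> is at least 1.\<close>

lemma exp_le_quadratic:
  fixes y :: real assumes "\<bar>y\<bar> \<le> 1" shows "exp y \<le> 1 + y + y\<^sup>2"
proof (cases "y \<ge> 0")
  case True
  then show ?thesis using assms by (intro exp_bound) auto
next
  case False
  define z where "z = - y"
  have z: "0 \<le> z" "z \<le> 1" using False assms by (auto simp: z_def)
  have q: "1 + z + z\<^sup>2/2 \<le> exp z" using exp_lower_Taylor_quadratic[OF z(1)] by simp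
  have "1 \<le> (1 - z + z\<^sup>2) * (1 + z + z\<^sup>2/2)"
  proof -
    have "(1 - z + z\<^sup>2) * (1 + z + z\<^sup>2/2) = 1 + z^2/2 + z^3/2 + z^4/2"
      by (simp add: power2_eq_square power3_eq_cube power4_eq_xxxx field_simps)
    then show ?thesis using z by simp
  qed
  also have "\<dots> \<le> (1 - z + z\<^sup>2) * exp z" using q z by (intro mult_left_mono) auto
  finally have "exp (- z) \<le> 1 - z + z\<^sup>2" by (simp add: exp_minus divide_simps)
  then show ?thesis by (simp add: z_def)
qed

lemma exists_le_weighted_average:
  fixes w F :: "'a \<Rightarrow> real"
  assumes "finite A" "\<And>k. k \<in> A \<Longrightarrow> 0 \<le> w k" "sum w A = 1" "(\<Sum>k\<in>A. w k * F k) \<le> B"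
  shows "\<exists>k\<in>A. F k \<le> B"
proof (rule ccontr)
  assume "\<not> ?thesis"
  then have *: "B < F k" if "k \<in> A" for k using that by force
  have "\<exists>k\<in>A. w k \<noteq> 0" using assms(3) by (metis sum.neutral zero_neq_one)
  then obtain k0 where k0: "k0 \<in> A" "w k0 > 0" using assms(2) by force
  have "(\<Sum>k\<in>A. w k * B) < (\<Sum>k\<in>A. w k * F k)"
    by (rule sum_strict_mono_ex1) (use assms * k0 in \<open>auto intro!: mult_left_mono less_imp_le[OF *] bexI[of _ k0]\<close>)
  then show False using assms(3,4) by (simp flip: sum_distrib_right)
qed

text \<open>One sampling step. Expanding each exponential by \<open>exp_le_quadratic\<close>, the
  linear terms cancel because \<open>g\<close> has weighted mean zero, and the quadratic ones add at
  most \<open>c\<^sup>2\<close>. The signs \<open>\<sigma> = 1\<close> and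
  \<open>\<sigma> = -1\<close> give the two halves of cosh.\<close>

lemma weighted_cosh_shift_le:
  fixes w g :: "'a \<Rightarrow> real"
  assumes "finite A" "\<And>k. k \<in> A \<Longrightarrow> 0 \<le> w k" "sum w A = 1" "(\<Sum>k\<in>A. w k * g k) = 0"
    and "\<And>k. k \<in> A \<Longrightarrow> \<bar>g k\<bar> \<le> 1" "0 \<le> c" "c \<le> 1"
  shows "(\<Sum>k\<in>A. w k * cosh (u + c * g k)) \<le> (1 + c\<^sup>2) * cosh u"
proof -
  have e: "(\<Sum>k\<in>A. w k * exp (\<sigma> * u + \<sigma> * c * g k)) \<le> (1 + c\<^sup>2) * exp (\<sigma> * u)" if \<sigma>: "\<sigma> = 1 \<or> \<sigma> = -1" for \<sigma>
  proof -
    have "(\<Sum>k\<in>A. w k * exp (\<sigma> * u + \<sigma> * c * g k)) \<le> (\<Sum>k\<in>A. exp (\<sigma> * u) * (w k + \<sigma> * c * (w k * g k) + c\<^sup>2 * w k))"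
    proof (rule sum_mono)
      fix k assume k: "k \<in> A"
      have "\<bar>\<sigma> * c * g k\<bar> \<le> 1" using \<sigma> assms(5)[OF k] assms(6,7) by (auto simp: abs_mult intro!: mult_le_one)
      then have "exp (\<sigma> * c * g k) \<le> 1 + \<sigma> * c * g k + (\<sigma> * c * g k)\<^sup>2" by (rule exp_le_quadratic)
      also have "(\<sigma> * c * g k)\<^sup>2 \<le> c\<^sup>2"
        using \<sigma> assms(5)[OF k] by (auto simp: power_mult_distrib abs_square_le_1 intro!: mult_left_le)
      finally have "w k * (exp (\<sigma> * u) * exp (\<sigma> * c * g k)) \<le> w k * (exp (\<sigma> * u) * (1 + \<sigma> * c * g k + c\<^sup>2))"
        using assms(2)[OF k] by (intro mult_left_mono) auto
      then show "w k * exp (\<sigma> * u + \<sigma> * c * g k) \<le> exp (\<sigma> * u) * (w k + \<sigma> * c * (w k * g k) + c\<^sup>2 * w k)"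
        by (simp add: exp_add algebra_simps)
    qed
    also have "\<dots> = exp (\<sigma> * u) * (sum w A + \<sigma> * c * (\<Sum>k\<in>A. w k * g k) + c\<^sup>2 * sum w A)"
      by (simp add: sum_distrib_left[symmetric] sum.distrib)
    finally show ?thesis using assms(3,4) by (simp add: algebra_simps)
  qed
  have "(\<Sum>k\<in>A. w k * cosh (u + c * g k)) =
    ((\<Sum>k\<in>A. w k * exp (u + c * g k)) + (\<Sum>k\<in>A. w k * exp (- u + - c * g k))) / 2"
    by (simp add: cosh_field_def sum.distrib[symmetric] sum_divide_distrib distrib_left add_divide_distrib)
  also have "\<dots> \<le> ((1 + c\<^sup>2) * exp u + (1 + c\<^sup>2) * exp (- u)) / 2"
    using e[of 1] e[of "-1"] by simp
  also have "\<dots> = (1 + c\<^sup>2) * cosh u" by (simp add: cosh_field_def distrib_left add_divide_distrib)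
  finally show ?thesis .
qed

lemma integrable_cosh_bounded:
  fixes u :: "real^'n \<Rightarrow> real"
  assumes "u \<in> borel_measurable borel" "\<And>x. \<bar>u x\<bar> \<le> B"
  shows "integrable torus_measure (\<lambda>x. cosh (u x))"
proof (rule integrable_torus_bounded[where B="exp B"])
  have "continuous_on UNIV (cosh :: real \<Rightarrow> real)" by (intro continuous_intros)
  then show "(\<lambda>x. cosh (u x)) \<in> borel_measurable borel"
    using assms(1) borel_measurable_continuous_on by blast
  fix x
  have "exp (u x) \<le> exp B" "exp (- u x) \<le> exp B" using assms(2)[of x] by (auto simp: abs_le_iff)
  from add_mono[OF this] have "cosh (u x) \<le> exp B" unfolding cosh_field_def by simp
  then show "norm (cosh (u x)) \<le> exp B" by simp
qed

text \<open>A derandomised form of Maurey's sampling argument: the potential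
  \<^term>\<open>\<Sum>j\<in>J. \<integral>x. cosh (c * (\<Sum>i<N. g j (\<kappa> i) x)) \<partial>torus_measure\<close> grows on average
  by at most the factor \<^term>\<open>1 + c\<^sup>2\<close> when a further index is drawn with the probabilities
  \<^term>\<open>w\<close>, so some choice of the index achieves this.\<close>

lemma greedy_cosh_selection:
  fixes g :: "'j \<Rightarrow> 'a \<Rightarrow> real^'n \<Rightarrow> real"
  assumes A: "finite A" "\<And>k. k \<in> A \<Longrightarrow> 0 \<le> w k" "sum w A = 1"
    and g: "\<And>j k. g j k \<in> borel_measurable borel" "\<And>j k x. k \<in> A \<Longrightarrow> \<bar>g j k x\<bar> \<le> 1"
      "\<And>j x. (\<Sum>k\<in>A. w k * g j k x) = 0"
    and c: "0 \<le> c" "c \<le> 1"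
  shows "\<exists>\<kappa>. (\<forall>i<N. \<kappa> i \<in> A) \<and>
     (\<Sum>j\<in>J. \<integral>x. cosh (c * (\<Sum>i<N. g j (\<kappa> i) x)) \<partial>torus_measure) \<le> real (card J) * (1 + c\<^sup>2) ^ N"
proof (induction N)
  case 0
  show ?case by simp
next
  case (Suc N)
  then obtain \<kappa> where \<kappa>: "\<And>i. i < N \<Longrightarrow> \<kappa> i \<in> A"
    "(\<Sum>j\<in>J. \<integral>x. cosh (c * (\<Sum>i<N. g j (\<kappa> i) x)) \<partial>torus_measure) \<le> real (card J) * (1 + c\<^sup>2) ^ N" by auto
  define S where "S j x = c * (\<Sum>i<N. g j (\<kappa> i) x)" for j x
  have [measurable]: "S j \<in> borel_measurable borel" "g j k \<in> borel_measurable borel" for j k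
    unfolding S_def using g(1) by auto
  have S: "\<bar>S j x\<bar> \<le> real N" for j x
  proof -
    have "\<bar>\<Sum>i<N. g j (\<kappa> i) x\<bar> \<le> (\<Sum>i<N. 1)" 
      using \<kappa>(1) g(2) by (intro order.trans[OF sum_abs] sum_mono) auto
    then have "c * \<bar>\<Sum>i<N. g j (\<kappa> i) x\<bar> \<le> 1 * real N" using c by (intro mult_mono) auto
    then show ?thesis using c by (simp add: S_def abs_mult)
  qed
  have iS: "integrable torus_measure (\<lambda>x. cosh (S j x))" for j
    by (rule integrable_cosh_bounded[OF _ S]) simp
  have i: "integrable torus_measure (\<lambda>x. cosh (S j x + c * g j k x))" if "k \<in> A" for j k
  proof (rule integrable_cosh_bounded[where B="real N + 1"])
    fix x
    have "\<bar>c * g j k x\<bar> \<le> 1" using c g(2)[OF that, of j x] by (auto simp: abs_mult intro!: mult_le_one)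
    then show "\<bar>S j x + c * g j k x\<bar> \<le> real N + 1" using S[of j x] by linarith
  qed simp
  have "(\<Sum>k\<in>A. w k * (\<Sum>j\<in>J. \<integral>x. cosh (S j x + c * g j k x) \<partial>torus_measure))
      = (\<Sum>j\<in>J. \<Sum>k\<in>A. w k * (\<integral>x. cosh (S j x + c * g j k x) \<partial>torus_measure))"
    unfolding sum_distrib_left by (rule sum.swap)
  also have "\<dots> = (\<Sum>j\<in>J. \<integral>x. (\<Sum>k\<in>A. w k * cosh (S j x + c * g j k x)) \<partial>torus_measure)"
    using i by (intro sum.cong refl) (subst Bochner_Integration.integral_sum, auto)
  also have "\<dots> \<le> (\<Sum>j\<in>J. \<integral>x. (1 + c\<^sup>2) * cosh (S j x) \<partial>torus_measure)"
    using A g c i iS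
    by (intro sum_mono integral_mono weighted_cosh_shift_le Bochner_Integration.integrable_sum
        integrable_mult_right) auto
  also have "\<dots> = (1 + c\<^sup>2) * (\<Sum>j\<in>J. \<integral>x. cosh (S j x) \<partial>torus_measure)" by (simp add: sum_distrib_left)
  also have "\<dots> \<le> (1 + c\<^sup>2) * (real (card J) * (1 + c\<^sup>2) ^ N)"
    using \<kappa>(2) unfolding S_def by (intro mult_left_mono) auto
  finally have "(\<Sum>k\<in>A. w k * (\<Sum>j\<in>J. \<integral>x. cosh (S j x + c * g j k x) \<partial>torus_measure)) \<le> real (card J) * (1 + c\<^sup>2) ^ Suc N"
    by (simp add: mult_ac)
  from exists_le_weighted_average[OF A this] obtain k where k: "k \<in> A"
    "(\<Sum>j\<in>J. \<integral>x. cosh (S j x + c * g j k x) \<partial>torus_measure) \<le> real (card J) * (1 + c\<^sup>2) ^ Suc N" by blast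
  have eq: "c * (\<Sum>i<Suc N. g j ((\<kappa>(N := k)) i) x) = S j x + c * g j k x" for j x
    by (simp add: S_def distrib_left)
  show ?case
    by (rule exI[of _ "\<kappa>(N := k)"], unfold eq) (use k \<kappa> in \<open>auto simp: less_Suc_eq\<close>)
qed

text \<open>Raises \<open>y \<le> exp y\<close> at \<open>y = \<bar>x\<bar> / q\<close> to the power
  \<open>q\<close>. This turns a bound on the potential into a bound in L_q.\<close>

lemma powr_le_cosh:
  fixes x q :: real assumes "q > 0" shows "\<bar>x\<bar> powr q \<le> 2 * q powr q * cosh x"
proof -
  have "\<bar>x\<bar> / q \<le> exp (\<bar>x\<bar> / q)" using exp_ge_add_one_self[of "\<bar>x\<bar> / q"] by linarith
  then have "(\<bar>x\<bar> / q) powr q \<le> exp (\<bar>x\<bar> / q) powr q" using assms by (intro powr_mono2) auto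
  also have "\<dots> = exp \<bar>x\<bar>" using assms by (simp add: exp_powr_real)
  also have "\<dots> \<le> 2 * cosh x" by (cases "x \<ge> 0") (auto simp: cosh_field_def)
  finally have "q powr q * (\<bar>x\<bar> / q) powr q \<le> q powr q * (2 * cosh x)" by (intro mult_left_mono) auto
  then show ?thesis using assms by (simp add: powr_mult[symmetric] mult_ac)
qed

text \<open>Takes the place of the triangle inequality in L_q: the sum is at most twice the
  maximum.\<close>

lemma powr_add_le:
  fixes a b q :: real assumes "q > 0" "0 \<le> a" "0 \<le> b"
  shows "(a + b) powr q \<le> 2 powr q * (a powr q + b powr q)"
proof -
  have "(a + b) powr q \<le> (2 * max a b) powr q" using assms by (intro powr_mono2) auto
  also have "\<dots> = 2 powr q * max a b powr q" using assms by (simp add: powr_mult)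
  also have "max a b powr q \<le> a powr q + b powr q" by (simp add: max_def)
  finally show ?thesis by simp
qed

text \<open>Maurey's argument: frequency \<open>k\<close> is drawn with weight
  \<open>norm (a k) / L\<close>, and \<open>N\<close> draws are averaged. The index \<open>b\<close>
  lets one selection serve two multipliers. In the constant, 12 bounds the potential (four real
  families, each at most 3), and 24 includes the 2 of \<open>powr_le_cosh\<close>. The outer 4 is a
  2 undoing the halving in \<open>g\<close> times a 2 from \<open>powr_add_le\<close>.\<close>

lemma sparse_block_approximation:
  fixes a :: "int^'n \<Rightarrow> complex" and \<mu> :: "bool \<Rightarrow> int^'n \<Rightarrow> real"
  assumes q: "q > 0" and A: "finite A" and N: "N \<ge> 1" and \<mu>: "\<And>b k. \<bar>\<mu> b k\<bar> \<le> 1"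
  shows "\<exists>c. {k. c k \<noteq> 0} \<subseteq> A \<and> card {k. c k \<noteq> 0} \<le> N \<and>
     (\<forall>b. (\<integral>x. norm (\<Sum>k\<in>A. of_real (\<mu> b k) * (a k - c k) * char_exp k x) powr q \<partial>torus_measure)
       \<le> (4 * (24 * q powr q) powr (1/q) * ((\<Sum>k\<in>A. norm (a k)) / sqrt (real N))) powr q)"
proof -
  define L where "L = (\<Sum>k\<in>A. norm (a k))"
  show ?thesis
  proof (cases "L = 0")
    case True
    then have "a k = 0" if "k \<in> A" for k
      using that A by (simp add: L_def sum_nonneg_eq_0_iff)
    then show ?thesis using q by (intro exI[of _ "\<lambda>_. 0"]) simp
  next
    case False
    then have L: "L > 0" using sum_nonneg[of A "\<lambda>k. norm (a k)"] by (simp add: L_def)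
    define w where "w k = norm (a k) / L" for k
    have w: "\<And>k. k \<in> A \<Longrightarrow> 0 \<le> w k" "sum w A = 1"
      using L by (auto simp: w_def L_def sum_divide_distrib[symmetric])
    define T where "T b x = (\<Sum>l\<in>A. of_real (\<mu> b l) * a l * char_exp l x) / of_real L" for b x
    define G where "G b k x = of_real (\<mu> b k) * sgn (a k) * char_exp k x - T b x" for b k x
    \<comment> \<open>The centred samples \<open>G\<close> have modulus at most 2, so halving brings
      them into the range required by the selection. The pair \<open>j\<close> codes the multiplier
      and the choice of real or imaginary part.\<close>
    define g where "g j k x = (if snd j then Re else Im) (G (fst j) k x) / 2" for j k x
    have [measurable]: "T b \<in> borel_measurable borel" for b unfolding T_def by measurable
    have [measurable]: "G b k \<in> borel_measurable borel" for b k unfolding G_def by measurable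
    have g_meas [measurable]: "g j k \<in> borel_measurable borel" for j k
      by (cases "snd j") (simp_all add: g_def[abs_def])
    have T: "norm (T b x) \<le> 1" for b x
    proof -
      have "norm (\<Sum>l\<in>A. of_real (\<mu> b l) * a l * char_exp l x) \<le> (\<Sum>l\<in>A. norm (a l))"
        using \<mu> by (intro sum_norm_le) (simp add: norm_mult mult_left_le_one_le)
      then show ?thesis using L unfolding T_def norm_divide norm_of_real L_def[symmetric] by simp
    qed
    have G2: "norm (G b k x) \<le> 2" for b k x
    proof -
      have "norm (of_real (\<mu> b k) * sgn (a k) * char_exp k x) \<le> 1"
        using \<mu>[of b k] by (simp add: norm_mult norm_sgn)
      then show ?thesis using T[of b x] norm_triangle_ineq4[of "of_real (\<mu> b k) * sgn (a k) * char_exp k x" "T b x"]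
        unfolding G_def by linarith
    qed
    have g1: "\<bar>g j k x\<bar> \<le> 1" for j k x
      using G2[of "fst j" k x] abs_Re_le_cmod[of "G (fst j) k x"] abs_Im_le_cmod[of "G (fst j) k x"]
      by (simp add: g_def)
    have G0: "(\<Sum>k\<in>A. of_real (w k) * G b k x) = 0" for b x
    proof -
      have *: "of_real (w k) * (of_real (\<mu> b k) * sgn (a k) * char_exp k x) = of_real (\<mu> b k) * a k * char_exp k x / of_real L" for k
        by (simp add: w_def sgn_div_norm scaleR_conv_of_real field_simps)
      have "(\<Sum>k\<in>A. of_real (w k) * G b k x) = T b x - (\<Sum>k\<in>A. of_real (w k)) * T b x"
        by (simp add: G_def right_diff_distrib sum_subtractf * sum_distrib_right T_def sum_divide_distrib)
      also have "(\<Sum>k\<in>A. complex_of_real (w k)) = of_real (sum w A)" by simp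
      finally show ?thesis using w by simp
    qed
    have g0: "(\<Sum>k\<in>A. w k * g j k x) = 0" for j x
    proof -
      have "Re (\<Sum>k\<in>A. of_real (w k) * G (fst j) k x) = 0" "Im (\<Sum>k\<in>A. of_real (w k) * G (fst j) k x) = 0"
        by (simp_all only: G0 zero_complex.sel)
      then show ?thesis by (simp add: g_def sum_divide_distrib[symmetric])
    qed
    \<comment> \<open>The largest scale, up to a constant, at which the growth factor
      \<open>(1 + c\<^sup>2) ^ N\<close> stays bounded independently of \<open>N\<close>; here by
      e.\<close>
    define c where "c = 1 / sqrt (real N)"
    have c: "0 < c" "c \<le> 1" using N by (auto simp: c_def)
    obtain \<kappa> where \<kappa>: "\<And>i. i < N \<Longrightarrow> \<kappa> i \<in> A"
      "(\<Sum>j\<in>UNIV. \<integral>x. cosh (c * (\<Sum>i<N. g j (\<kappa> i) x)) \<partial>torus_measure) \<le> real (card (UNIV :: (bool \<times> bool) set)) * (1 + c\<^sup>2) ^ N"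
      using greedy_cosh_selection[where g=g and J=UNIV and N=N, OF A w g_meas g1 g0 less_imp_le[OF c(1)] c(2)] by blast
    have "(1 + c\<^sup>2) ^ N \<le> exp (c\<^sup>2) ^ N" by (intro power_mono exp_ge_add_one_self) auto
    also have "\<dots> = exp 1" using N by (simp add: exp_of_nat_mult[symmetric] c_def power_divide)
    also have "\<dots> \<le> 3" by (rule exp_le)
    finally have "(1 + c\<^sup>2) ^ N \<le> 3" .
    then have pot: "(\<Sum>j\<in>UNIV. \<integral>x. cosh (c * (\<Sum>i<N. g j (\<kappa> i) x)) \<partial>torus_measure) \<le> 12"
    proof -
      have card4: "real (card (UNIV :: (bool \<times> bool) set)) = 4" by simp
      have "4 * (1 + c\<^sup>2) ^ N \<le> 12" using \<open>(1 + c\<^sup>2) ^ N \<le> 3\<close> by linarith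
      from order.trans[OF \<kappa>(2)[unfolded card4] this] show ?thesis .
    qed
    \<comment> \<open>Empirical mean of the draws: \<open>k\<close> enters as often as it was
      selected, with the phase of \<open>a k\<close> and total mass \<open>L\<close>.\<close>
    define d where "d k = of_real (L / real N) * of_nat (card {i\<in>{..<N}. \<kappa> i = k}) * sgn (a k)" for k
    have supp: "{k. d k \<noteq> 0} \<subseteq> \<kappa> ` {..<N}" 
    proof -
      have "d k = 0" if "k \<notin> \<kappa> ` {..<N}" for k
      proof -
        have none: "{i\<in>{..<N}. \<kappa> i = k} = {}" using that by auto
        show ?thesis unfolding d_def none by simp
      qed
      then show ?thesis by auto
    qed
    have main: "(\<integral>x. norm (\<Sum>k\<in>A. of_real (\<mu> b k) * (a k - d k) * char_exp k x) powr q \<partial>torus_measure)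
       \<le> (4 * (24 * q powr q) powr (1/q) * (L / sqrt (real N))) powr q" for b
    proof -
      define D where "D x = (\<Sum>k\<in>A. of_real (\<mu> b k) * (a k - d k) * char_exp k x)" for x
      define R where "R r x = (\<Sum>i<N. g (b, r) (\<kappa> i) x)" for r x
      \<comment> \<open>The error is exactly the normalised sum of the centred samples, the quantity
        that the potential controls.\<close>
      have D: "D x = - of_real (L / real N) * (\<Sum>i<N. G b (\<kappa> i) x)" for x
      proof -
        have "(\<Sum>i<N. of_real (\<mu> b (\<kappa> i)) * sgn (a (\<kappa> i)) * char_exp (\<kappa> i) x)
          = (\<Sum>k\<in>A. \<Sum>i\<in>{i\<in>{..<N}. \<kappa> i = k}. of_real (\<mu> b (\<kappa> i)) * sgn (a (\<kappa> i)) * char_exp (\<kappa> i) x)"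
          using \<kappa>(1) A by (intro sum.group[symmetric]) auto
        also have "\<dots> = (\<Sum>k\<in>A. of_nat (card {i\<in>{..<N}. \<kappa> i = k}) * (of_real (\<mu> b k) * sgn (a k) * char_exp k x))"
          by (intro sum.cong refl) simp
        finally have "of_real (L / real N) * (\<Sum>i<N. of_real (\<mu> b (\<kappa> i)) * sgn (a (\<kappa> i)) * char_exp (\<kappa> i) x)
            = (\<Sum>k\<in>A. of_real (\<mu> b k) * d k * char_exp k x)"
          by (simp add: d_def sum_distrib_left mult_ac)
        moreover have "of_real (L / real N) * (\<Sum>i<N. T b x) = (\<Sum>k\<in>A. of_real (\<mu> b k) * a k * char_exp k x)"
          using L N by (simp add: T_def)
        ultimately show ?thesis
          by (simp only: G_def sum_subtractf right_diff_distrib D_def mult_minus_left left_diff_distrib) simp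
      qed
      have [measurable]: "R r \<in> borel_measurable borel" for r unfolding R_def by measurable
      have RN: "\<bar>R r x\<bar> \<le> real N" for r x
      proof -
        have "\<bar>R r x\<bar> \<le> (\<Sum>i<N. 1)" unfolding R_def using g1 by (intro order.trans[OF sum_abs] sum_mono) auto
        then show ?thesis by simp
      qed
      have iR: "integrable torus_measure (\<lambda>x. cosh (c * R r x))" for r
        by (rule integrable_cosh_bounded[where B="c * real N"]) (use c RN in \<open>auto simp: abs_mult\<close>)
      have pointwise: "norm (D x) powr q \<le> (4 * (L / sqrt (real N))) powr q * (2 * q powr q) * (cosh (c * R True x) + cosh (c * R False x))" for x
      proof -
        have "norm (\<Sum>i<N. G b (\<kappa> i) x) \<le> 2 * (\<bar>R True x\<bar> + \<bar>R False x\<bar>)"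
        proof -
          have "2 * R True x = Re (\<Sum>i<N. G b (\<kappa> i) x)" "2 * R False x = Im (\<Sum>i<N. G b (\<kappa> i) x)"
            by (simp_all add: R_def g_def sum_divide_distrib[symmetric])
          then show ?thesis using cmod_le[of "\<Sum>i<N. G b (\<kappa> i) x"] by (smt (verit))
        qed
        then have "norm (D x) \<le> L / real N * (2 * (\<bar>R True x\<bar> + \<bar>R False x\<bar>))"
          unfolding D norm_mult norm_minus_cancel norm_of_real using L by (simp add: divide_right_mono mult_left_mono)
        also have "\<dots> = 2 * (L / sqrt (real N)) * (\<bar>c * R True x\<bar> + \<bar>c * R False x\<bar>)"
        proof -
          have LN: "L / real N = (L / sqrt (real N)) * c" by (simp add: c_def)
          have ca: "\<bar>c * R r x\<bar> = c * \<bar>R r x\<bar>" for r using c by (simp add: abs_mult)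
          show ?thesis unfolding LN ca by (simp only: distrib_left mult_ac)
        qed
        finally have "norm (D x) powr q \<le> (2 * (L / sqrt (real N)) * (\<bar>c * R True x\<bar> + \<bar>c * R False x\<bar>)) powr q"
          using q by (intro powr_mono2) auto
        also have "\<dots> = (2 * (L / sqrt (real N))) powr q * (\<bar>c * R True x\<bar> + \<bar>c * R False x\<bar>) powr q"
          using L by (subst powr_mult) auto
        also have "\<dots> \<le> (2 * (L / sqrt (real N))) powr q * (2 powr q * (\<bar>c * R True x\<bar> powr q + \<bar>c * R False x\<bar> powr q))"
          using q by (intro mult_left_mono powr_add_le) auto
        also have "\<dots> = (4 * (L / sqrt (real N))) powr q * (\<bar>c * R True x\<bar> powr q + \<bar>c * R False x\<bar> powr q)"
        proof -
          have "4 * (L / sqrt (real N)) = (2 * (L / sqrt (real N))) * 2" by simp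
          then have "(4 * (L / sqrt (real N))) powr q = (2 * (L / sqrt (real N))) powr q * 2 powr q"
            using L by (simp only:) (subst powr_mult; simp)
          then show ?thesis by simp
        qed
        also have "\<dots> \<le> (4 * (L / sqrt (real N))) powr q * (2 * q powr q * cosh (c * R True x) + 2 * q powr q * cosh (c * R False x))"
          using q by (intro mult_left_mono add_mono powr_le_cosh) auto
        finally show ?thesis by (simp add: algebra_simps)
      qed
      have "(\<integral>x. norm (D x) powr q \<partial>torus_measure) \<le>
        (\<integral>x. (4 * (L / sqrt (real N))) powr q * (2 * q powr q) * (cosh (c * R True x) + cosh (c * R False x)) \<partial>torus_measure)"
        using iR pointwise by (intro integral_mono_AE') auto
      also have "\<dots> = (4 * (L / sqrt (real N))) powr q * (2 * q powr q) *
         ((\<integral>x. cosh (c * R True x) \<partial>torus_measure) + (\<integral>x. cosh (c * R False x) \<partial>torus_measure))"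
        using iR by simp
      also have "\<dots> \<le> (4 * (L / sqrt (real N))) powr q * (2 * q powr q) * 12"
      proof (rule mult_left_mono)
        have "(\<integral>x. cosh (c * R True x) \<partial>torus_measure) + (\<integral>x. cosh (c * R False x) \<partial>torus_measure) 
           = (\<Sum>j\<in>{(b, True), (b, False)}. \<integral>x. cosh (c * (\<Sum>i<N. g j (\<kappa> i) x)) \<partial>torus_measure)"
          by (simp add: R_def)
        also have "\<dots> \<le> (\<Sum>j\<in>UNIV. \<integral>x. cosh (c * (\<Sum>i<N. g j (\<kappa> i) x)) \<partial>torus_measure)"
          by (rule sum_mono2[OF finite subset_UNIV]) simp
        also note pot
        finally show "(\<integral>x. cosh (c * R True x) \<partial>torus_measure) + (\<integral>x. cosh (c * R False x) \<partial>torus_measure) \<le> 12" .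
      qed simp
      also have "\<dots> = (4 * (24 * q powr q) powr (1/q) * (L / sqrt (real N))) powr q"
      proof -
        have "4 * (24 * q powr q) powr (1/q) * (L / sqrt (real N)) = (4 * (L / sqrt (real N))) * (24 * q powr q) powr (1/q)"
          by simp
        then have "(4 * (24 * q powr q) powr (1/q) * (L / sqrt (real N))) powr q
          = (4 * (L / sqrt (real N))) powr q * ((24 * q powr q) powr (1/q)) powr q"
          using L by (simp only:) (subst powr_mult; simp)
        also have "((24 * q powr q) powr (1/q)) powr q = 24 * q powr q"
          using q by (simp add: powr_powr)
        finally show ?thesis by simp
      qed
      finally show ?thesis unfolding D_def .
    qed
    have "card {k. d k \<noteq> 0} \<le> N" using card_mono[OF _ supp] card_image_le[of "{..<N}" \<kappa>] by simp
    with main supp \<kappa>(1) show ?thesis unfolding L_def by (intro exI[of _ d]) blast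
  qed
qed

section \<open>Fourier coefficients of functions in Besov classes\<close>

lemma in_Lp_iff:
  "in_Lp p f \<longleftrightarrow> vperiodic f \<and> f \<in> borel_measurable borel \<and> integrable torus_measure (\<lambda>x. norm (f x) powr p)"
proof (cases "f \<in> borel_measurable borel")
  case True
  then have "(\<lambda>x. norm (f x) powr p) \<in> borel_measurable borel" by simp
  from integrable_torus[OF this] show ?thesis using True by (simp add: in_Lp_def periodic_fun_iff)
qed (simp add: in_Lp_def)

lemma in_Lp_bounded:
  assumes "vperiodic f" "f \<in> borel_measurable borel" "\<And>x. norm (f x) \<le> B" "p > 0"
  shows "in_Lp p f"
  unfolding in_Lp_iff
  by (intro conjI assms(1,2) integrable_torus_bounded[where B="B powr p"])
     (use assms in \<open>auto intro!: powr_mono2\<close>)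

lemma Lp_norm_eq:
  assumes "f \<in> borel_measurable borel"
  shows "Lp_norm p f = (\<integral>x. norm (f x) powr p \<partial>torus_measure) powr (1/p)"
  using assms by (simp add: Lp_norm_def integral_torus)

lemma Lp_norm_nonneg [simp]: "0 \<le> Lp_norm p f"
  by (simp add: Lp_norm_def)

lemma Lp_norm_leI:
  assumes "f \<in> borel_measurable borel" "p > 0" "0 \<le> E" "(\<integral>x. norm (f x) powr p \<partial>torus_measure) \<le> E powr p"
  shows "Lp_norm p f \<le> E"
proof -
  have "Lp_norm p f \<le> (E powr p) powr (1/p)"
    unfolding Lp_norm_eq[OF assms(1)] using assms by (intro powr_mono2) auto
  also have "\<dots> = E" using assms by (simp add: powr_powr)
  finally show ?thesis .
qed

lemma Lp_norm_le_bound: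
  assumes "f \<in> borel_measurable borel" "p > 0" "\<And>x. norm (f x) \<le> B"
  shows "Lp_norm p f \<le> B"
proof (rule Lp_norm_leI[OF assms(1,2)])
  show "0 \<le> B" using assms(3) norm_ge_zero order.trans by blast
  show "(\<integral>x. norm (f x) powr p \<partial>torus_measure) \<le> B powr p"
    using assms by (intro integral_torus_le powr_mono2) auto
qed

lemma integral_eq_Lp_norm_powr:
  assumes "f \<in> borel_measurable borel" "p > 0"
  shows "(\<integral>x. norm (f x) powr p \<partial>torus_measure) = Lp_norm p f powr p"
  using assms by (simp add: Lp_norm_eq powr_powr)

lemma powr_le_one_plus_powr:
  fixes y a p :: real assumes "0 \<le> y" "0 < a" "a \<le> p" shows "y powr a \<le> 1 + y powr p"
proof (cases "y \<le> 1")
  case True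
  then have "y powr a \<le> 1 powr a" using assms by (intro powr_mono2) auto
  then show ?thesis by (simp add: add_increasing2)
next
  case False
  then have "y powr a \<le> y powr p" using assms by (intro powr_mono) auto
  then show ?thesis by linarith
qed

lemma in_Lp_integrable:
  assumes "in_Lp p f" "p \<ge> 1" shows "integrable torus_measure f"
proof (rule Bochner_Integration.integrable_bound)
  show "integrable torus_measure (\<lambda>x. 1 + norm (f x) powr p)" using assms by (simp add: in_Lp_iff)
  have "f \<in> borel_measurable borel" using assms by (simp add: in_Lp_iff)
  then show "f \<in> borel_measurable torus_measure" by measurable
  show "AE x in torus_measure. norm (f x) \<le> norm (1 + norm (f x) powr p)"
    using powr_le_one_plus_powr[of _ 1 p] assms(2) by (intro AE_I2) simp
qed

text \<open>In place of Hoelder's inequality, \<open>(norm (f x) / \<tau>)\<^sup>2\<close> is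
  bounded by 1 plus its p-th power analogue and integrated. Taking \<open>\<tau>\<close> as the norm
  gives the factor 2; if the norm is 0, \<open>\<tau>\<close> tends to 0.\<close>

lemma integral_square_le_Lp_norm:
  fixes f :: "real^'n \<Rightarrow> complex"
  assumes f: "in_Lp p f" and p: "p \<ge> 2"
  shows "integrable torus_measure (\<lambda>x. (norm (f x))\<^sup>2)"
    and "(\<integral>x. (norm (f x))\<^sup>2 \<partial>torus_measure) \<le> 2 * (Lp_norm p f)\<^sup>2"
proof -
  have [measurable]: "f \<in> borel_measurable borel" and i: "integrable torus_measure (\<lambda>x. norm (f x) powr p)"
    using f by (auto simp: in_Lp_iff)
  have le: "(norm (f x))\<^sup>2 \<le> \<tau>\<^sup>2 * (1 + norm (f x) powr p / \<tau> powr p)" if "\<tau> > 0" for \<tau> x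
  proof -
    have "(norm (f x) / \<tau>) powr 2 \<le> 1 + (norm (f x) / \<tau>) powr p"
      using p that by (intro powr_le_one_plus_powr) auto
    then have "(norm (f x) / \<tau>)\<^sup>2 \<le> 1 + norm (f x) powr p / \<tau> powr p"
      using that by (simp add: powr_divide power_divide)
    then have "\<tau>\<^sup>2 * (norm (f x) / \<tau>)\<^sup>2 \<le> \<tau>\<^sup>2 * (1 + norm (f x) powr p / \<tau> powr p)"
      by (intro mult_left_mono) auto
    then show ?thesis using that by (simp add: power_divide)
  qed
  show i2: "integrable torus_measure (\<lambda>x. (norm (f x))\<^sup>2)"
    by (rule Bochner_Integration.integrable_bound[where f="\<lambda>x. 1\<^sup>2 * (1 + norm (f x) powr p / 1 powr p)"])
       (use i le[of 1] in \<open>auto intro!: AE_I2 simp: add_nonneg_nonneg\<close>)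
  define I where "I = (\<integral>x. (norm (f x))\<^sup>2 \<partial>torus_measure)"
  have bound: "I \<le> 2 * \<tau>\<^sup>2" if \<tau>: "\<tau> > 0" "\<tau> \<ge> Lp_norm p f" for \<tau>
  proof -
    have "I \<le> (\<integral>x. \<tau>\<^sup>2 * (1 + norm (f x) powr p / \<tau> powr p) \<partial>torus_measure)"
      unfolding I_def using i i2 le[OF \<tau>(1)] by (intro integral_mono) auto
    also have "\<dots> = \<tau>\<^sup>2 * (1 + Lp_norm p f powr p / \<tau> powr p)"
      using i p by (simp add: integral_eq_Lp_norm_powr)
    also have "\<dots> \<le> \<tau>\<^sup>2 * (1 + 1)"
      using \<tau> p by (intro mult_left_mono add_left_mono) (auto intro!: powr_mono2 simp: divide_le_eq_1)
    finally show ?thesis by simp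
  qed
  have "I \<le> 2 * (Lp_norm p f)\<^sup>2"
  proof (cases "Lp_norm p f > 0")
    case False
    then have "Lp_norm p f = 0" using Lp_norm_nonneg[of p f] by linarith
    have "I \<le> 0 + e" if "e > 0" for e
      using bound[of "sqrt (e/2)"] that \<open>Lp_norm p f = 0\<close> by simp
    then have "I \<le> 0" by (rule field_le_epsilon)
    then show ?thesis by (simp add: \<open>Lp_norm p f = 0\<close>)
  qed (simp add: bound)
  then show "(\<integral>x. (norm (f x))\<^sup>2 \<partial>torus_measure) \<le> 2 * (Lp_norm p f)\<^sup>2" by (simp add: I_def)
qed

lemma in_Lp_diff_op:
  fixes g :: "real^'n \<Rightarrow> complex"
  assumes g: "in_Lp p g" and p: "p > 0"
  shows "in_Lp p (diff_op h g)"
    and "(\<integral>x. norm (diff_op h g x) powr p \<partial>torus_measure) \<le> 2 powr p * 2 * (\<integral>x. norm (g x) powr p \<partial>torus_measure)"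
proof -
  have [measurable]: "g \<in> borel_measurable borel" and i: "integrable torus_measure (\<lambda>x. norm (g x) powr p)"
    and per: "vperiodic g"
    using g by (auto simp: in_Lp_iff)
  have perp: "vperiodic (\<lambda>x. norm (g x) powr p)" using per by (simp add: vperiodic_def)
  have i': "integrable torus_measure (\<lambda>x. norm (g (x + h)) powr p)"
    using torus_integral_translate_real(1)[OF _ perp, of h] i by simp
  have le: "norm (diff_op h g x) powr p \<le> 2 powr p * (norm (g (x + h)) powr p + norm (g x) powr p)" for x
  proof -
    have "norm (diff_op h g x) powr p \<le> (norm (g (x + h)) + norm (g x)) powr p"
      unfolding diff_op_def using p by (intro powr_mono2 norm_triangle_ineq4) auto
    also have "\<dots> \<le> 2 powr p * (norm (g (x + h)) powr p + norm (g x) powr p)"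
      using p by (intro powr_add_le) auto
    finally show ?thesis .
  qed
  have [measurable]: "diff_op h g \<in> borel_measurable borel" unfolding diff_op_def by measurable
  have "vperiodic (diff_op h g)" unfolding vperiodic_def diff_op_def
  proof (intro allI)
    fix x j
    have "g (x + axis j (2*pi) + h) = g (x + h + axis j (2*pi))" by (simp add: add_ac)
    then show "g (x + axis j (2*pi) + h) - g (x + axis j (2*pi)) = g (x + h) - g x"
      using per by (simp add: vperiodic_def)
  qed
  moreover have i3: "integrable torus_measure (\<lambda>x. norm (diff_op h g x) powr p)"
    by (rule Bochner_Integration.integrable_bound[where f="\<lambda>x. 2 powr p * (norm (g (x + h)) powr p + norm (g x) powr p)"])
       (use i i' le in \<open>auto intro!: AE_I2\<close>)
  ultimately show "in_Lp p (diff_op h g)" by (simp add: in_Lp_iff)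
  have "(\<integral>x. norm (diff_op h g x) powr p \<partial>torus_measure) 
     \<le> (\<integral>x. 2 powr p * (norm (g (x + h)) powr p + norm (g x) powr p) \<partial>torus_measure)"
    using i i' i3 le by (intro integral_mono) auto
  also have "\<dots> = 2 powr p * 2 * (\<integral>x. norm (g x) powr p \<partial>torus_measure)"
    using i i' torus_integral_translate_real(2)[OF _ perp, of h] by simp
  finally show "(\<integral>x. norm (diff_op h g x) powr p \<partial>torus_measure) \<le> 2 powr p * 2 * (\<integral>x. norm (g x) powr p \<partial>torus_measure)" .
qed

lemma diff_pow_Suc: "diff_pow (Suc k) h f = diff_op h (diff_pow k h f)"
  by (simp add: diff_pow_def)

lemma diff_pow_0 [simp]: "diff_pow 0 h f = f"
  by (simp add: diff_pow_def)

lemma in_Lp_diff_pow: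
  assumes f: "in_Lp p f" and p: "p > 0"
  shows "in_Lp p (diff_pow k h f) \<and>
    (\<integral>x. norm (diff_pow k h f x) powr p \<partial>torus_measure) \<le> (2 powr p * 2)^k * (\<integral>x. norm (f x) powr p \<partial>torus_measure)"
proof (induction k)
  case (Suc k)
  have "(\<integral>x. norm (diff_pow (Suc k) h f x) powr p \<partial>torus_measure) \<le> 2 powr p * 2 * (\<integral>x. norm (diff_pow k h f x) powr p \<partial>torus_measure)"
    unfolding diff_pow_Suc using Suc p by (intro in_Lp_diff_op) auto
  also have "\<dots> \<le> 2 powr p * 2 * ((2 powr p * 2)^k * (\<integral>x. norm (f x) powr p \<partial>torus_measure))"
    using Suc by (intro mult_left_mono) auto
  finally show ?case using Suc in_Lp_diff_op(1)[of p "diff_pow k h f" h] p by (simp add: diff_pow_Suc mult.assoc)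
qed (simp add: f)

lemma fcoef_diff_pow:
  assumes f: "in_Lp p f" and p: "p \<ge> 1"
  shows "fcoef (diff_pow k h f) n = (char_exp n h - 1)^k * fcoef f n"
proof (induction k)
  case (Suc k)
  let ?g = "diff_pow k h f"
  have g: "in_Lp p ?g" using in_Lp_diff_pow[OF f] p by simp
  then have gm: "?g \<in> borel_measurable borel" "vperiodic ?g" by (auto simp: in_Lp_iff)
  have gi: "integrable torus_measure ?g" using in_Lp_integrable[OF g p] .
  have "fcoef (diff_pow (Suc k) h f) n = fcoef (\<lambda>x. ?g (x + h)) n - fcoef ?g n"
    unfolding diff_pow_Suc diff_op_def using gi torus_integral_translate(1)[OF gm] by (intro fcoef_diff) auto
  also have "\<dots> = (char_exp n h - 1) * fcoef ?g n" by (simp add: fcoef_translate[OF gm] algebra_simps)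
  finally show ?case using Suc by simp
qed simp

text \<open>\<open>modulus\<close> is a supremum of reals and is meaningful only for bounded sets;
  the crude exponential constant in \<open>k\<close> is enough for that.\<close>

lemma bdd_above_Lp_norm_diff_pow:
  assumes "in_Lp p f" "p > 0"
  shows "bdd_above ((\<lambda>h. Lp_norm p (diff_pow k h f)) ` H)"
proof (rule bdd_aboveI2)
  fix h
  have g: "in_Lp p (diff_pow k h f)" "(\<integral>x. norm (diff_pow k h f x) powr p \<partial>torus_measure) 
      \<le> (2 powr p * 2)^k * (\<integral>x. norm (f x) powr p \<partial>torus_measure)" using in_Lp_diff_pow[OF assms] by auto
  then show "Lp_norm p (diff_pow k h f) \<le> ((2 powr p * 2)^k * (\<integral>x. norm (f x) powr p \<partial>torus_measure)) powr (1/p)"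
    using assms by (subst Lp_norm_eq) (auto simp: in_Lp_iff intro!: powr_mono2)
qed

lemma Lp_norm_le_modulus:
  assumes "in_Lp p f" "p > 0" "norm h \<le> t"
  shows "Lp_norm p (diff_pow k h f) \<le> modulus k p f t"
  unfolding modulus_def
  by (rule cSUP_upper[OF _ bdd_above_Lp_norm_diff_pow[OF assms(1,2)]]) (simp add: assms(3))

lemma modulus_mono:
  assumes "in_Lp p f" "p > 0" "0 \<le> s" "s \<le> t"
  shows "modulus k p f s \<le> modulus k p f t"
  unfolding modulus_def
  by (rule cSUP_subset_mono[OF _ bdd_above_Lp_norm_diff_pow[OF assms(1,2)]]) (use assms in auto)

lemma modulus_nonneg:
  assumes "in_Lp p f" "p > 0" "0 \<le> t" shows "0 \<le> modulus k p f t"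
proof -
  have "Lp_norm p (diff_pow k 0 f) \<le> modulus k p f t"
    using assms by (intro Lp_norm_le_modulus) auto
  then show ?thesis using Lp_norm_nonneg[of p "diff_pow k 0 f"] by linarith
qed

lemma besov_norm_infty_le_1D:
  assumes "besov_norm k r p \<infinity> f \<le> 1"
  shows "bdd_above ((\<lambda>t. t powr (-r) * modulus k p f t) ` {0<..})"
    and "Lp_norm p f + (SUP t\<in>{0<..}. t powr (-r) * modulus k p f t) \<le> 1"
  using assms by (auto simp: besov_norm_def top_unique simp del: ennreal_plus split: if_splits)

lemma besov_norm_le_1D:
  assumes "besov_norm k r p \<theta> f \<le> 1" "\<theta> \<noteq> \<infinity>"
  defines "I \<equiv> (\<integral>\<^sup>+ t\<in>{0<..}. ennreal ((t powr (-r) * modulus k p f t) powr (enn2real \<theta>) / t) \<partial>lborel)"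
  shows "I \<noteq> \<infinity>" and "Lp_norm p f + enn2real I powr (1 / enn2real \<theta>) \<le> 1"
  using assms(1,2) unfolding besov_norm_def I_def[symmetric]
  by (auto simp: Let_def top_unique simp del: ennreal_plus split: if_splits)

lemma Lp_norm_le_besov_norm:
  assumes "besov_norm k r p \<theta> f \<le> 1" "in_Lp p f" "p > 0"
  shows "Lp_norm p f \<le> 1"
proof (cases "\<theta> = \<infinity>")
  case True
  note B = besov_norm_infty_le_1D[OF assms(1)[unfolded True]]
  have "0 \<le> (SUP t\<in>{0<..}. t powr (-r) * modulus k p f t)"
    by (rule cSUP_upper2[OF B(1), of 1]) (auto simp: modulus_nonneg[OF assms(2,3)])
  then show ?thesis using B(2) by linarith
next
  case False
  have "0 \<le> enn2real (\<integral>\<^sup>+ t\<in>{0<..}. ennreal ((t powr (-r) * modulus k p f t) powr (enn2real \<theta>) / t) \<partial>lborel) powr (1 / enn2real \<theta>)"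
    by simp
  with besov_norm_le_1D(2)[OF assms(1) False] show ?thesis by linarith
qed

text \<open>Embeds the class into the Nikolskii class, the case of infinite parameter. For finite
  \<open>\<theta>\<close> the integral is restricted to \<open>{t..2*t}\<close>, where monotonicity
  of the modulus bounds the integrand from below by a constant.\<close>

lemma besov_class_modulus_le:
  fixes f :: "real^'n \<Rightarrow> complex"
  assumes f: "f \<in> besov_class k r p \<theta>" and p: "p > 0" and \<theta>: "1 \<le> \<theta>" and t: "t > 0" and r: "r > 0"
  shows "modulus k p f t \<le> 2 * (2 * t) powr r"
proof -
  have L: "in_Lp p f" and b: "besov_norm k r p \<theta> f \<le> 1" using f by (auto simp: besov_class_def)
  let ?w = "modulus k p f"
  note w0 = modulus_nonneg[OF L p]
  show ?thesis
  proof (cases "\<theta> = \<infinity>")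
    case True
    let ?S = "(\<lambda>t. t powr (-r) * ?w t) ` {0<..}"
    note B = besov_norm_infty_le_1D[OF b[unfolded True]]
    have bdd: "bdd_above ?S" by (rule B)
    have "Lp_norm p f + Sup ?S \<le> 1" by (rule B)
    then have "Sup ?S \<le> 1" using Lp_norm_nonneg[of p f] by linarith
    moreover have "t powr (-r) * ?w t \<le> Sup ?S" using t bdd by (intro cSUP_upper) auto
    ultimately have "t powr (-r) * ?w t \<le> 1" by linarith
    then have "?w t \<le> t powr r" using t by (simp add: powr_minus divide_simps)
    also have "\<dots> \<le> (2 * t) powr r" using t r by (intro powr_mono2) auto
    also have "\<dots> \<le> 2 * (2 * t) powr r" by simp
    finally show ?thesis .
  next
    case False
    define T where "T = enn2real \<theta>"
    define I where "I = (\<integral>\<^sup>+ u\<in>{0<..}. ennreal ((u powr (-r) * ?w u) powr T / u) \<partial>lborel)"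
    have "1 \<le> T"
    proof -
      have "enn2real 1 \<le> enn2real \<theta>"
        using \<theta> False by (intro enn2real_mono) (auto simp: less_top)
      then show ?thesis by (simp add: T_def)
    qed
    have I: "I \<noteq> \<infinity>" and le: "Lp_norm p f + enn2real I powr (1/T) \<le> 1"
      using besov_norm_le_1D[OF b False] by (simp_all add: I_def T_def)
    have "enn2real I powr (1/T) \<le> 1" using le Lp_norm_nonneg[of p f] by linarith
    then have "enn2real I \<le> 1"
    proof -
      have "(enn2real I powr (1/T)) powr T \<le> 1 powr T"
        using \<open>1 \<le> T\<close> \<open>enn2real I powr (1/T) \<le> 1\<close> by (intro powr_mono2) auto
      then show ?thesis using \<open>1 \<le> T\<close> by (simp add: powr_powr)
    qed
    then have "ennreal (enn2real I) \<le> ennreal 1" by (rule ennreal_leI)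
    moreover have "ennreal (enn2real I) = I" using I by (intro ennreal_enn2real) (simp add: less_top)
    ultimately have I1: "I \<le> ennreal 1" by simp
    \<comment> \<open>Minorant of the integrand on \<open>{t..2*t}\<close>: the increasing modulus
      is taken at the left end, the decreasing weights at the right end.\<close>
    define A where "A = ((2*t) powr (-r) * ?w t) powr T / (2*t)"
    have "ennreal (A * t) = (\<integral>\<^sup>+ u\<in>{t..2*t}. ennreal A \<partial>lborel)"
      using t by (simp add: nn_integral_cmult_indicator ennreal_mult'')
    also have "\<dots> \<le> I"
      unfolding I_def
    proof (rule nn_integral_mono)
      fix u
      have "A \<le> (u powr (-r) * ?w u) powr T / u" if u: "u \<in> {t..2*t}"
      proof -
        have "(2*t) powr (-r) \<le> u powr (-r)" using u t r by (intro powr_mono2') auto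
        moreover have "?w t \<le> ?w u" using u t by (intro modulus_mono[OF L p]) auto
        ultimately have "(2*t) powr (-r) * ?w t \<le> u powr (-r) * ?w u" using w0[of t] t by (intro mult_mono) auto
        then have "((2*t) powr (-r) * ?w t) powr T \<le> (u powr (-r) * ?w u) powr T"
          using \<open>1 \<le> T\<close> w0[of t] t by (intro powr_mono2) auto
        then show ?thesis unfolding A_def using u t by (intro frac_le) auto
      qed
      then show "ennreal A * indicator {t..2*t} u \<le> ennreal ((u powr (-r) * ?w u) powr T / u) * indicator {0<..} u"
        using t by (auto simp: indicator_def intro!: ennreal_leI)
    qed
    also note I1
    finally have "A * t \<le> 1" by (simp del: ennreal_1)
    then have "((2*t) powr (-r) * ?w t) powr T \<le> 2" using t by (simp add: A_def)
    \<comment> \<open>Replaces the root \<open>2 powr (1/T)\<close> by 2, so that the constant does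
      not depend on \<open>\<theta>\<close>.\<close>
    also have "\<dots> \<le> 2 powr T" using powr_mono[OF \<open>1 \<le> T\<close>, of 2] by simp
    finally have "\<not> 2 < (2*t) powr (-r) * ?w t"
      using powr_less_mono2[of T 2 "(2*t) powr (-r) * ?w t"] \<open>1 \<le> T\<close> by force
    then show ?thesis using t by (simp add: powr_minus divide_simps)
  qed
qed

section \<open>Dyadic shells of frequencies\<close>

text \<open>Level 0 is the zero frequency alone; level s > 0 means that the largest coordinate
  modulus lies in [2^(s-1), 2^s).\<close>

definition level :: "int^'n \<Rightarrow> nat" where "level k = (LEAST s. k \<in> ibox (2^s))"

definition dyadic :: "nat \<Rightarrow> (int^'n) set" where "dyadic s = {k. level k = s}"

lemma in_ibox_level: "k \<in> ibox (2 ^ level k)"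
proof -
  have "\<exists>s. k \<in> ibox (2^s)"
  proof -
    define m where "m = nat (\<Sum>j\<in>UNIV. \<bar>k$j\<bar>)"
    have "\<bar>k$j\<bar> < 2^m" for j
    proof -
      have "\<bar>k$j\<bar> \<le> (\<Sum>j\<in>UNIV. \<bar>k$j\<bar>)" by (rule member_le_sum) auto
      also have "\<dots> = int m" by (simp add: m_def sum_nonneg)
      also have "\<dots> < 2^m" by (metis of_nat_less_two_power)
      finally show ?thesis .
    qed
    then show ?thesis by (intro exI[of _ m]) (simp add: ibox_def)
  qed
  then show ?thesis unfolding level_def by (rule LeastI_ex)
qed

lemma level_le_iff: "level k \<le> s \<longleftrightarrow> k \<in> ibox (2^s)"
proof
  assume "level k \<le> s"
  then have "(2::nat) ^ level k \<le> 2 ^ s" by (intro power_increasing) auto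
  then show "k \<in> ibox (2^s)" using in_ibox_level[of k] ibox_mono by blast
next
  assume "k \<in> ibox (2^s)"
  then show "level k \<le> s" unfolding level_def by (rule Least_le)
qed

lemma dyadic_subset: "dyadic s \<subseteq> ibox (2^s)"
  using level_le_iff by (auto simp: dyadic_def)

lemma finite_dyadic [simp]: "finite (dyadic s)"
  by (rule finite_subset[OF dyadic_subset]) simp

lemma card_dyadic_le: "card (dyadic s :: (int^'n) set) \<le> (2 * 2^s) ^ CARD('n)"
  using card_mono[OF finite_ibox dyadic_subset] card_ibox_le order.trans by blast

text \<open>Below shell \<open>s\<close> the two kernels agree; above shell \<open>s + 1\<close>
  both vanish, as the wider one stops short of 2^(s+1).\<close>

lemma sigma_mult_eq_0_level:
  assumes "level k \<noteq> s" "level k \<noteq> s + 1" shows "sigma_mult s k = 0"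
proof (cases "level k < s")
  case True
  then have "k \<in> ibox (2^(s-1))" by (simp flip: level_le_iff)
  then have "k \<in> ibox (Suc (2^(s-1)))" using ibox_mono[of "2^(s-1)" "Suc (2^(s-1))"] by auto
  then show ?thesis using True by (intro sigma_mult_eq_0') auto
next
  case False
  then have "\<not> level k \<le> s + 1" using assms by linarith
  then show ?thesis unfolding level_le_iff by (rule sigma_mult_eq_0)
qed

lemma sigma_block_dyadic:
  fixes g :: "real^'n \<Rightarrow> complex"
  assumes g: "g \<in> borel_measurable borel" "vperiodic g" "integrable torus_measure g"
  shows "sigma_block s g x = (\<Sum>k\<in>dyadic s. of_real (sigma_mult s k) * fcoef g k * char_exp k x)
     + (\<Sum>k\<in>dyadic (s+1). of_real (sigma_mult s k) * fcoef g k * char_exp k x)"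
proof -
  have "dyadic s \<union> dyadic (s+1) \<subseteq> ibox (2^(s+1))"
    unfolding dyadic_def by (auto simp only: level_le_iff[symmetric])
  then have "sigma_block s g x = (\<Sum>k\<in>dyadic s \<union> dyadic (s+1). of_real (sigma_mult s k) * fcoef g k * char_exp k x)"
    unfolding sigma_block_eq[OF g]
    by (intro sum.mono_neutral_right) (auto simp: dyadic_def sigma_mult_eq_0_level)
  then show ?thesis by (subst (asm) sum.union_disjoint) (simp_all, auto simp: dyadic_def)
qed

lemma sum_UN_le:
  fixes F :: "'a \<Rightarrow> real"
  assumes "finite J" "\<And>j. finite (B j)" "\<And>n. 0 \<le> F n"
  shows "(\<Sum>n\<in>(\<Union>j\<in>J. B j). F n) \<le> (\<Sum>j\<in>J. \<Sum>n\<in>B j. F n)"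
  using assms(1)
proof (induction J)
  case (insert j J)
  have "finite (\<Union>j\<in>J. B j)" using insert assms(2) by auto
  then have "(\<Sum>n\<in>(\<Union>j\<in>insert j J. B j). F n) \<le> sum F (B j) + sum F (\<Union>j\<in>J. B j)"
    using sum.union_inter[of "B j" "\<Union>j\<in>J. B j" F] assms(2)[of j] sum_nonneg[of "B j \<inter> (\<Union>j\<in>J. B j)" F] assms(3) by simp
  then show ?case using insert by simp
qed simp

lemma norm_axis_eq: "norm (axis j a :: real^'n) = \<bar>a\<bar>"
  by (simp add: norm_eq_sqrt_inner inner_axis_axis)

text \<open>The shell is covered by the sets \<open>B j\<close> on which coordinate \<open>j\<close>
  is large. On \<open>B j\<close> a k-th difference in direction \<open>j\<close> does not decrease
  Fourier coefficients, so Bessel's inequality for that difference bounds the coefficients of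
  \<open>f\<close> by the modulus of smoothness.\<close>

lemma besov_class_dyadic_square_sum:
  fixes f :: "real^'n \<Rightarrow> complex"
  assumes f: "f \<in> besov_class k r p \<theta>" and p: "p \<ge> 2" and \<theta>: "1 \<le> \<theta>" and r: "r > 0"
  shows "(\<Sum>n\<in>dyadic s. (norm (fcoef f n))\<^sup>2) \<le> (2 + 8 * real CARD('n) * (2*pi) powr (2*r)) * 2 powr (- 2 * r * real s)"
proof -
  have L: "in_Lp p f" using f by (auto simp: besov_class_def)
  have p0: "p > 0" using p by simp
  show ?thesis
  \<comment> \<open>Differences annihilate the zero frequency, so shell 0 is handled by the L_p norm
    itself; this gives the summand 2 of the constant.\<close>
  proof (cases "s = 0")
    case True
    have "besov_norm k r p \<theta> f \<le> 1" using f by (simp add: besov_class_def)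
    then have "Lp_norm p f \<le> 1" using L p0 by (rule Lp_norm_le_besov_norm)
    then have "2 * (Lp_norm p f)\<^sup>2 \<le> 2" by (simp add: power_le_one)
    have "(\<Sum>n\<in>dyadic s. (norm (fcoef f n))\<^sup>2) \<le> (\<integral>x. (norm (f x))\<^sup>2 \<partial>torus_measure)"
      using L integral_square_le_Lp_norm(1)[OF L p] by (intro bessel_inequality) (auto simp: in_Lp_iff)
    also have "\<dots> \<le> 2" using integral_square_le_Lp_norm(2)[OF L p] \<open>2 * (Lp_norm p f)\<^sup>2 \<le> 2\<close> by linarith
    finally show ?thesis using True by (simp add: add_increasing2)
  next
    case False
    \<comment> \<open>With this step the phase \<open>\<bar>n$j\<bar> * t\<close> lies in [pi/2, pi]
      for \<open>n\<close> in \<open>B j\<close>, so its cosine is not positive and the factor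
      \<open>char_exp n h - 1\<close> has modulus at least 1.\<close>
    define t where "t = pi / 2^s"
    have t: "t > 0" by (simp add: t_def)
    define B where "B j = {n\<in>ibox (2^s) :: (int^'n) set. 2^(s-1) \<le> \<bar>n$j\<bar>}" for j
    have finB: "finite (B j)" for j unfolding B_def by (rule finite_subset[of _ "ibox (2^s)"]) auto
    have Bj: "(\<Sum>n\<in>B j. (norm (fcoef f n))\<^sup>2) \<le> 8 * (2*t) powr (2*r)" for j
    proof -
      define h :: "real^'n" where "h = axis j t"
      have h: "norm h \<le> t" using t by (simp add: h_def norm_axis_eq)
      let ?g = "diff_pow k h f"
      have Lg: "in_Lp p ?g" using in_Lp_diff_pow[OF L p0] by blast
      have ge1: "1 \<le> norm (char_exp n h - 1)" if "n \<in> B j" for n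
      proof -
        define a where "a = \<bar>of_int (n$j) * t\<bar>"
        have "\<bar>n$j\<bar> < 2^s" "2^(s-1) \<le> \<bar>n$j\<bar>" using that by (auto simp: B_def ibox_def)
        then have "real_of_int \<bar>n$j\<bar> < 2^s" "2^(s-1) \<le> real_of_int \<bar>n$j\<bar>" 
          by (metis of_int_less_iff of_int_numeral of_int_power, metis of_int_le_iff of_int_numeral of_int_power)
        then have "2^(s-1) * t \<le> a" "a < 2^s * t" using t by (auto simp: a_def abs_mult)
        moreover have "2^(s-1) * t = pi / 2" using False by (cases s) (auto simp: t_def)
        moreover have "2^s * t = pi" by (simp add: t_def)
        ultimately have a: "pi/2 \<le> a" "a \<le> pi" by auto
        have "cos (pi - a) \<ge> 0" using a by (intro cos_ge_zero) auto
        then have "cos a \<le> 0" by simp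
        then have "cos (of_int (n$j) * t) \<le> 0" unfolding a_def by simp
        then have "Re (char_exp n h - 1) \<le> -1" by (simp add: h_def char_exp_axis)
        then show ?thesis using abs_Re_le_cmod[of "char_exp n h - 1"] by linarith
      qed
      have "(\<Sum>n\<in>B j. (norm (fcoef f n))\<^sup>2) \<le> (\<Sum>n\<in>B j. (norm (fcoef ?g n))\<^sup>2)"
      proof (rule sum_mono)
        fix n assume "n \<in> B j"
        have "1 * norm (fcoef f n) \<le> norm (char_exp n h - 1)^k * norm (fcoef f n)"
          using ge1[OF \<open>n \<in> B j\<close>] by (intro mult_right_mono one_le_power) auto
        then have "norm (fcoef f n) \<le> norm (fcoef ?g n)"
          using p by (subst fcoef_diff_pow[OF L]) (auto simp: norm_mult norm_power)
        then show "(norm (fcoef f n))\<^sup>2 \<le> (norm (fcoef ?g n))\<^sup>2" by (intro power_mono) auto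
      qed
      also have "\<dots> \<le> (\<integral>x. (norm (?g x))\<^sup>2 \<partial>torus_measure)"
        using Lg integral_square_le_Lp_norm(1)[OF Lg p] finB by (intro bessel_inequality) (auto simp: in_Lp_iff)
      also have "\<dots> \<le> 2 * (Lp_norm p ?g)\<^sup>2" by (rule integral_square_le_Lp_norm(2)[OF Lg p])
      also have "\<dots> \<le> 2 * (2 * (2*t) powr r)\<^sup>2"
        using Lp_norm_le_modulus[OF L p0 h, of k] besov_class_modulus_le[OF f p0 \<theta> t r]
        by (intro mult_left_mono power_mono) auto
      also have "\<dots> = 8 * (2*t) powr (2*r)"
        using t by (simp add: power_mult_distrib powr_power mult.commute)
      finally show ?thesis .
    qed
    have cover: "dyadic s \<subseteq> (\<Union>j\<in>UNIV. B j)"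
    proof
      fix n :: "int^'n" assume n: "n \<in> dyadic s"
      then have "\<not> level n \<le> s - 1" using False by (simp add: dyadic_def)
      then have "n \<notin> ibox (2^(s-1))" by (simp add: level_le_iff)
      then obtain j where "2^(s-1) \<le> \<bar>n$j\<bar>" by (auto simp: ibox_def not_less)
      then show "n \<in> (\<Union>j\<in>UNIV. B j)" using n dyadic_subset[of s] by (auto simp: B_def)
    qed
    have "(\<Sum>n\<in>dyadic s. (norm (fcoef f n))\<^sup>2) \<le> (\<Sum>n\<in>(\<Union>j\<in>UNIV. B j). (norm (fcoef f n))\<^sup>2)"
      using cover finB by (intro sum_mono2) auto
    also have "\<dots> \<le> (\<Sum>j\<in>UNIV. \<Sum>n\<in>B j. (norm (fcoef f n))\<^sup>2)"
      using finB by (intro sum_UN_le) auto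
    also have "\<dots> \<le> (\<Sum>j\<in>(UNIV::'n set). 8 * (2*t) powr (2*r))" by (intro sum_mono Bj)
    also have "\<dots> = 8 * real CARD('n) * (2*pi) powr (2*r) * 2 powr (- 2 * r * real s)"
    proof -
      have "(2*t) powr (2*r) = (2*pi) powr (2*r) * (2 powr (- real s)) powr (2*r)"
        by (simp add: t_def powr_minus powr_realpow powr_divide divide_inverse powr_mult)
      then show ?thesis by (simp add: powr_powr mult_ac)
    qed
    also have "\<dots> \<le> (2 + 8 * real CARD('n) * (2*pi) powr (2*r)) * 2 powr (- 2 * r * real s)"
      by (intro mult_right_mono) auto
    finally show ?thesis .
  qed
qed

text \<open>Cauchy-Schwarz against the number of frequencies, at most a constant times 2^(s d); its
  square root lowers the exponent from r to r - d/2.\<close>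

lemma besov_class_dyadic_sum:
  fixes f :: "real^'n \<Rightarrow> complex"
  assumes f: "f \<in> besov_class k r p \<theta>" and p: "p \<ge> 2" and \<theta>: "1 \<le> \<theta>" and r: "r > 0"
  defines "K \<equiv> sqrt (2 ^ CARD('n) * (2 + 8 * real CARD('n) * (2*pi) powr (2*r)))"
  shows "(\<Sum>n\<in>dyadic s. norm (fcoef f n)) \<le> K * 2 powr (- (r - real CARD('n) / 2) * real s)"
proof -
  let ?d = "real CARD('n)" and ?M = "2 + 8 * real CARD('n) * (2*pi) powr (2*r)"
  have M: "?M \<ge> 0" by simp
  have "(\<Sum>n\<in>dyadic s. norm (fcoef f n))\<^sup>2 \<le> (\<Sum>n\<in>dyadic s. (norm (fcoef f n))\<^sup>2) * (\<Sum>n\<in>(dyadic s :: (int^'n) set). 1\<^sup>2)"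
    using Cauchy_Schwarz_ineq_sum[of "\<lambda>n. norm (fcoef f n)" "\<lambda>_. 1" "dyadic s"] by simp
  also have "\<dots> \<le> (?M * 2 powr (- 2 * r * real s)) * (2 * 2^s) ^ CARD('n)"
  proof (rule mult_mono)
    have "real (card (dyadic s :: (int^'n) set)) \<le> real ((2 * 2^s) ^ CARD('n))"
      using card_dyadic_le of_nat_mono by blast
    then show "(\<Sum>n\<in>(dyadic s :: (int^'n) set). 1\<^sup>2) \<le> (2 * 2^s :: real) ^ CARD('n)" by simp
  qed (use besov_class_dyadic_square_sum[OF f p \<theta> r, of s] in \<open>auto intro!: sum_nonneg\<close>)
  also have "(2 * 2^s :: real) ^ CARD('n) = 2 ^ CARD('n) * 2 powr (real s * ?d)"
    by (simp add: power_mult_distrib powr_realpow[symmetric] powr_powr)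
  also have "?M * 2 powr (- 2 * r * real s) * (2 ^ CARD('n) * 2 powr (real s * ?d)) = (2 ^ CARD('n) * ?M) * 2 powr ((- (r - ?d / 2) * real s) * 2)"
    by (simp add: powr_add[symmetric] algebra_simps)
  also have "\<dots> = (K * 2 powr (- (r - ?d / 2) * real s))\<^sup>2"
    using M by (simp add: K_def power_mult_distrib powr_power mult.commute)
  finally show ?thesis
    by (rule power2_le_imp_le) (simp add: K_def)
qed

section \<open>The upper bound\<close>

text \<open>Three regimes: the budget \<open>N\<close> covers the shell and everything is kept;
  \<open>N = 0\<close>, where the sum of coefficient moduli bounds the discarded part; otherwise
  sampling. \<open>max 1 N\<close> lets one condition serve the last two, and the guard of
  \<open>EN\<close> permits \<open>E = 0\<close> in the first. The indices \<open>s\<close> and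
  \<open>s - 1\<close> are the blocks that see shell \<open>s\<close>; for \<open>s = 0\<close> they
  coincide.\<close>

lemma block_approximation:
  fixes a :: "int^'n \<Rightarrow> complex"
  assumes q: "q > 0"
  defines "C \<equiv> max 1 (4 * (24 * q powr q) powr (1/q))"
  assumes E: "0 \<le> E"
    and EN: "N < card (dyadic s :: (int^'n) set) \<Longrightarrow> C * (\<Sum>k\<in>dyadic s. norm (a k)) / sqrt (real (max 1 N)) \<le> E"
  shows "\<exists>c. {k. c k \<noteq> 0} \<subseteq> dyadic s \<and> card {k. c k \<noteq> 0} \<le> N \<and>
     (\<forall>s'\<in>{s, s - 1}. (\<integral>x. norm (\<Sum>k\<in>dyadic s. of_real (sigma_mult s' k) * (a k - c k) * char_exp k x) powr q \<partial>torus_measure)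
       \<le> E powr q)"
proof -
  let ?L = "\<Sum>k\<in>dyadic s. norm (a k)"
  have L0: "0 \<le> ?L" by (simp add: sum_nonneg)
  have C1: "1 \<le> C" by (simp add: C_def)
  consider "card (dyadic s :: (int^'n) set) \<le> N" | "N < card (dyadic s :: (int^'n) set)" "N = 0"
    | "N < card (dyadic s :: (int^'n) set)" "N \<ge> 1" by linarith
  then show ?thesis
  proof cases
    case 1
    let ?c = "\<lambda>k. if k \<in> dyadic s then a k else 0"
    have sub: "{k. ?c k \<noteq> 0} \<subseteq> dyadic s" by auto
    have "card {k. ?c k \<noteq> 0} \<le> N" using card_mono[OF finite_dyadic sub] 1 by simp
    then show ?thesis using sub q by (intro exI[of _ ?c]) simp
  next
    case 2
    have LE: "?L \<le> E"
    proof -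
      have "1 * ?L \<le> C * ?L" using C1 L0 by (intro mult_right_mono)
      then show ?thesis using EN 2 by simp
    qed
    have "norm (\<Sum>k\<in>dyadic s. of_real (sigma_mult s' k) * (a k - 0) * char_exp k x) powr q \<le> E powr q" for s' x
    proof (rule powr_mono2)
      have "norm (\<Sum>k\<in>dyadic s. of_real (sigma_mult s' k) * (a k - 0) * char_exp k x) \<le> ?L"
        by (intro sum_norm_le) (simp add: norm_mult mult_left_le_one_le abs_sigma_mult_le_1)
      then show "norm (\<Sum>k\<in>dyadic s. of_real (sigma_mult s' k) * (a k - 0) * char_exp k x) \<le> E" using LE by linarith
    qed (use q in auto)
    then have "(\<integral>x. norm (\<Sum>k\<in>dyadic s. of_real (sigma_mult s' k) * (a k - 0) * char_exp k x) powr q \<partial>torus_measure) \<le> E powr q" for s'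
      by (intro integral_torus_le) auto
    then show ?thesis by (intro exI[of _ "\<lambda>_. 0"]) auto
  next
    case 3
    obtain c where c: "{k. c k \<noteq> 0} \<subseteq> dyadic s" "card {k. c k \<noteq> 0} \<le> N" 
      "\<And>b. (\<integral>x. norm (\<Sum>k\<in>dyadic s. of_real (sigma_mult (if b then s else s - 1) k) * (a k - c k) * char_exp k x) powr q \<partial>torus_measure)
       \<le> (4 * (24 * q powr q) powr (1/q) * (?L / sqrt (real N))) powr q"
      using sparse_block_approximation[OF q finite_dyadic 3(2), where \<mu>="\<lambda>b. sigma_mult (if b then s else s - 1)" and a=a]
        abs_sigma_mult_le_1 by blast
    have "4 * (24 * q powr q) powr (1/q) * (?L / sqrt (real N)) \<le> C * (?L / sqrt (real N))"
      using L0 by (intro mult_right_mono) (auto simp: C_def)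
    also have "\<dots> \<le> E" using EN 3 by simp
    finally have "(4 * (24 * q powr q) powr (1/q) * (?L / sqrt (real N))) powr q \<le> E powr q"
      using q L0 by (intro powr_mono2) auto
    then have "(\<integral>x. norm (\<Sum>k\<in>dyadic s. of_real (sigma_mult s' k) * (a k - c k) * char_exp k x) powr q \<partial>torus_measure) \<le> E powr q"
      if "s' \<in> {s, s - 1}" for s'
      using c(3)[of True] c(3)[of False] that by (auto split: if_splits)
    then show ?thesis using c by (intro exI[of _ c]) auto
  qed
qed

text \<open>\<open>best_mterm\<close> requires exactly \<open>m\<close> frequencies, so a smaller
  selection is padded by frequencies with coefficient 0.\<close>

lemma extend_finite_set:
  assumes "infinite (UNIV :: 'a set)" "finite (S :: 'a set)" "card S \<le> m"
  shows "\<exists>\<Theta>. S \<subseteq> \<Theta> \<and> finite \<Theta> \<and> card \<Theta> = m"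
proof -
  have "infinite (UNIV - S)" using assms by simp
  then obtain B where B: "finite B" "card B = m - card S" "B \<subseteq> UNIV - S"
    using infinite_arbitrarily_large by blast
  then have "card (S \<union> B) = m" using assms by (subst card_Un_disjoint) auto
  then show ?thesis using B assms by (intro exI[of _ "S \<union> B"]) auto
qed

lemma infinite_int_vec: "infinite (UNIV :: (int^'n) set)"
proof
  assume "finite (UNIV :: (int^'n) set)"
  moreover have "inj (\<lambda>i::int. (\<chi> j. i) :: int^'n)" by (rule injI) (simp add: vec_eq_iff)
  ultimately have "finite (UNIV :: int set)" using finite_imageD[of "\<lambda>i::int. (\<chi> j. i) :: int^'n" UNIV] 
    by (meson finite_subset subset_UNIV)
  then show False using infinite_UNIV_int by simp
qed

lemma powr_add_le_max:
  fixes a b q :: real assumes "q \<ge> 1" "0 \<le> a" "0 \<le> b"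
  shows "2 powr q * (a powr q + b powr q) \<le> (4 * (a + b)) powr q"
proof -
  have "a powr q \<le> (a + b) powr q" "b powr q \<le> (a + b) powr q" using assms by (auto intro!: powr_mono2)
  then have "2 powr q * (a powr q + b powr q) \<le> 2 powr q * (2 * (a + b) powr q)" by (intro mult_left_mono) auto
  also have "\<dots> \<le> 2 powr q * (2 powr q * (a + b) powr q)"
    using powr_mono[OF assms(1), of 2] by (intro mult_left_mono mult_right_mono) auto
  also have "\<dots> = (4 * (a + b)) powr q" using assms by (simp add: powr_mult[symmetric])
  finally show ?thesis .
qed

text \<open>Glues approximations on the shells with budgets \<open>N s\<close> and errors
  \<open>E s\<close>. Block \<open>s\<close> of the remainder meets shells \<open>s\<close> and
  \<open>s + 1\<close>, which gives \<open>4 * (E s + E (Suc s))\<close>; each \<open>E s\<close> is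
  counted at most twice, whence the factor 8.\<close>

lemma best_mterm_le:
  fixes f :: "real^'n \<Rightarrow> complex" and N :: "nat \<Rightarrow> nat" and E :: "nat \<Rightarrow> real"
  assumes q: "q \<ge> 1" and p: "p \<ge> 1" and f: "in_Lp p f"
  defines "C \<equiv> max 1 (4 * (24 * q powr q) powr (1/q))"
  assumes E: "\<And>s. 0 \<le> E s" "summable E"
    and EN: "\<And>s. N s < card (dyadic s :: (int^'n) set) \<Longrightarrow>
       C * (\<Sum>k\<in>dyadic s. norm (fcoef f k)) / sqrt (real (max 1 (N s))) \<le> E s"
    and N: "\<And>s. s \<ge> M \<Longrightarrow> N s = 0" "(\<Sum>s<M. N s) \<le> m"
  shows "best_mterm m q f \<le> ennreal (8 * suminf E)"
proof -
  have q0: "q > 0" using q by simp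
  have "\<forall>s. \<exists>c. {k. c k \<noteq> 0} \<subseteq> dyadic s \<and> card {k. c k \<noteq> 0} \<le> N s \<and>
     (\<forall>s'\<in>{s, s - 1}. (\<integral>x. norm (\<Sum>k\<in>dyadic s. of_real (sigma_mult s' k) * (fcoef f k - c k) * char_exp k x) powr q \<partial>torus_measure)
       \<le> E s powr q)"
    using block_approximation[OF q0 E(1)] EN unfolding C_def by blast
  from choice[OF this] obtain cc where "\<forall>s. {k. cc s k \<noteq> 0} \<subseteq> dyadic s \<and> card {k. cc s k \<noteq> 0} \<le> N s \<and>
     (\<forall>s'\<in>{s, s - 1}. (\<integral>x. norm (\<Sum>k\<in>dyadic s. of_real (sigma_mult s' k) * (fcoef f k - cc s k) * char_exp k x) powr q \<partial>torus_measure)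
       \<le> E s powr q)" ..
  then have cc: "\<And>s. {k. cc s k \<noteq> 0} \<subseteq> dyadic s" "\<And>s. card {k. cc s k \<noteq> 0} \<le> N s"
     "\<And>s s'. s' \<in> {s, s - 1} \<Longrightarrow> (\<integral>x. norm (\<Sum>k\<in>dyadic s. of_real (sigma_mult s' k) * (fcoef f k - cc s k) * char_exp k x) powr q \<partial>torus_measure)
       \<le> E s powr q" by blast+
  \<comment> \<open>Every frequency takes the coefficient chosen on its own shell; the shells are
    disjoint, so the choices do not conflict.\<close>
  define c where "c k = cc (level k) k" for k
  have c_eq: "c k = cc s k" if "k \<in> dyadic s" for k s using that by (simp add: c_def dyadic_def)
  define S where "S = (\<Union>s<M. {k. cc s k \<noteq> 0})"
  have fin: "finite {k. cc s k \<noteq> 0}" for s using cc(1) finite_dyadic finite_subset by blast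
  have "card S \<le> (\<Sum>s<M. card {k. cc s k \<noteq> 0})" unfolding S_def by (rule card_UN_le) simp
  also have "\<dots> \<le> (\<Sum>s<M. N s)" by (intro sum_mono cc)
  finally have cardS: "card S \<le> m" using N(2) by linarith
  have finS: "finite S" unfolding S_def using fin by auto
  obtain \<Theta> where \<Theta>: "S \<subseteq> \<Theta>" "finite \<Theta>" "card \<Theta> = m"
    using extend_finite_set[OF infinite_int_vec finS cardS] by blast
  have c0: "c k = 0" if "k \<notin> \<Theta>" for k
  proof (rule ccontr)
    assume k: "c k \<noteq> 0"
    then have "{l. cc (level k) l \<noteq> 0} \<noteq> {}" unfolding c_def by blast
    then have "card {l. cc (level k) l \<noteq> 0} \<noteq> 0" using fin by simp
    then have "N (level k) \<noteq> 0" using cc(2)[of "level k"] by linarith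
    then have "level k < M" using N(1)[of "level k"] by (cases "M \<le> level k") simp_all
    then have "k \<in> S" using k unfolding S_def c_def by blast
    then show False using that \<Theta> by blast
  qed
  define g where "g x = f x - (\<Sum>k\<in>\<Theta>. c k * char_exp k x)" for x
  have fm [measurable]: "f \<in> borel_measurable borel" and fp: "vperiodic f" using f by (auto simp: in_Lp_iff)
  have fi: "integrable torus_measure f" by (rule in_Lp_integrable[OF f p])
  have gm: "g \<in> borel_measurable borel" unfolding g_def by measurable
  have gp: "vperiodic g" using fp by (simp add: g_def vperiodic_def vperiodic_char_exp[unfolded vperiodic_def, rule_format])
  have gi: "integrable torus_measure g" unfolding g_def using fi by simp
  have gc: "fcoef g k = fcoef f k - c k" for k
    unfolding g_def using c0 by (subst fcoef_diff[OF fi]) (auto simp: fcoef_trig_poly \<Theta>)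
  have blk: "Lp_norm q (sigma_block s g) \<le> 4 * (E s + E (Suc s))" for s
  proof -
    define D where "D s1 x = (\<Sum>k\<in>dyadic s1. of_real (sigma_mult s k) * (fcoef f k - cc s1 k) * char_exp k x)" for s1 x
    have [measurable]: "D s1 \<in> borel_measurable borel" for s1 unfolding D_def by measurable
    have Dq: "(\<integral>x. norm (D s x) powr q \<partial>torus_measure) \<le> E s powr q"
      "(\<integral>x. norm (D (Suc s) x) powr q \<partial>torus_measure) \<le> E (Suc s) powr q"
      unfolding D_def by (rule cc(3); simp)+
    have sb: "sigma_block s g = (\<lambda>x. D s x + D (Suc s) x)"
      by (rule ext) (simp add: sigma_block_dyadic[OF gm gp gi] D_def gc c_eq cong: sum.cong)
    have iD: "integrable torus_measure (\<lambda>x. norm (D s1 x) powr q)" for s1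
    proof (rule integrable_torus_bounded[where B="(\<Sum>k\<in>dyadic s1. norm (fcoef f k - cc s1 k)) powr q"])
      fix x
      have "norm (D s1 x) \<le> (\<Sum>k\<in>dyadic s1. norm (fcoef f k - cc s1 k))"
        unfolding D_def by (intro sum_norm_le) (simp add: norm_mult mult_left_le_one_le abs_sigma_mult_le_1)
      then show "norm (norm (D s1 x) powr q) \<le> (\<Sum>k\<in>dyadic s1. norm (fcoef f k - cc s1 k)) powr q"
        using q by (auto intro!: powr_mono2)
    qed simp
    have "(\<integral>x. norm (sigma_block s g x) powr q \<partial>torus_measure) \<le>
      (\<integral>x. 2 powr q * (norm (D s x) powr q + norm (D (Suc s) x) powr q) \<partial>torus_measure)"
    proof (rule integral_mono_AE')
      show "AE x in torus_measure. norm (sigma_block s g x) powr q \<le> 2 powr q * (norm (D s x) powr q + norm (D (Suc s) x) powr q)"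
      proof (rule AE_I2)
        fix x
        have "norm (sigma_block s g x) powr q \<le> (norm (D s x) + norm (D (Suc s) x)) powr q"
          unfolding sb using q by (intro powr_mono2 norm_triangle_ineq) auto
        then show "norm (sigma_block s g x) powr q \<le> 2 powr q * (norm (D s x) powr q + norm (D (Suc s) x) powr q)"
          using powr_add_le[OF q0, of "norm (D s x)" "norm (D (Suc s) x)"] by simp
      qed
    qed (use iD in auto)
    also have "\<dots> = 2 powr q * ((\<integral>x. norm (D s x) powr q \<partial>torus_measure) + (\<integral>x. norm (D (Suc s) x) powr q \<partial>torus_measure))"
      using iD by simp
    also have "\<dots> \<le> 2 powr q * (E s powr q + E (Suc s) powr q)"
      using Dq by (intro mult_left_mono add_mono) auto
    also have "\<dots> \<le> (4 * (E s + E (Suc s))) powr q" using E(1) q by (intro powr_add_le_max) auto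
    finally show ?thesis using E(1) q0 by (intro Lp_norm_leI) (auto simp: sb add_nonneg_nonneg)
  qed
  have sumE': "summable (\<lambda>s. 4 * (E s + E (Suc s)))"
    using E(2) by (intro summable_mult summable_add) (simp_all add: summable_Suc_iff)
  have "Bq1_norm q g \<le> (\<Sum>s. ennreal (4 * (E s + E (Suc s))))"
    unfolding Bq1_norm_def using blk by (intro suminf_le ennreal_leI) auto
  also have "\<dots> = ennreal (\<Sum>s. 4 * (E s + E (Suc s)))"
    using E sumE' by (intro suminf_ennreal2) (auto simp: add_nonneg_nonneg)
  also have "(\<Sum>s. 4 * (E s + E (Suc s))) = 4 * (suminf E + (\<Sum>s. E (Suc s)))"
    using E(2) by (subst suminf_mult) (simp_all add: suminf_add summable_Suc_iff summable_add)
  also have "(\<Sum>s. E (Suc s)) = suminf E - E 0" using E(2) by (rule suminf_split_head)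
  also have "ennreal (4 * (suminf E + (suminf E - E 0))) \<le> ennreal (8 * suminf E)"
    using E(1)[of 0] by (intro ennreal_leI) simp
  finally have "Bq1_norm q g \<le> ennreal (8 * suminf E)" .
  moreover have "best_mterm m q f \<le> Bq1_norm q g"
    unfolding best_mterm_def
    by (rule INF_lower2[of \<Theta>], use \<Theta> in simp, rule INF_lower2[of c]) (simp_all add: g_def[abs_def])
  ultimately show ?thesis by (rule order.trans[rotated])
qed

lemma geometric_powr_sums:
  assumes "b > 0"
  shows "(\<lambda>j. 2 powr (- b * real j)) sums (1 / (1 - 2 powr (- b)))"
proof -
  have "2 powr (- b * real j) = (2 powr (- b)) ^ j" for j
    by (simp add: powr_realpow[symmetric] powr_powr)
  moreover have "(2::real) powr (- b) < 1"
    using assms powr_less_mono[of "-b" 0 2] by simp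
  ultimately show ?thesis using geometric_sums[of "2 powr (- b)::real"] by simp
qed

lemma besov_upper_bound:
  fixes p q r :: real and \<theta> :: ennreal and k :: nat
  assumes "2 < p" "p < q" "1 \<le> \<theta>" "r > real CARD('n) / 2"
  shows "\<exists>C>0. \<forall>m\<ge>1. best_mterm_class m q (besov_class k r p \<theta> :: (real^'n \<Rightarrow> complex) set)
        \<le> ennreal (C * real m powr (- r / real CARD('n)))"
proof -
  let ?d = "real CARD('n)"
  have d: "?d > 0" by simp
  have r: "r > 0" using assms(4) d by linarith
  define b where "b = r - ?d / 2"
  have b: "b > 0" using assms(4) by (simp add: b_def)
  define K where "K = sqrt (2 ^ CARD('n) * (2 + 8 * ?d * (2*pi) powr (2*r)))"
  define C where "C = max 1 (4 * (24 * q powr q) powr (1/q))"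
  define G where "G = 1 / (1 - 2 powr (- b))"
  define G2 where "G2 = 1 / (1 - 2 powr (- (b/2)))"
  have K: "K \<ge> 0" by (simp add: K_def)
  have C: "C \<ge> 1" by (simp add: C_def)
  have G: "G > 0" "G2 > 0"
    using b powr_less_mono[of "-b" 0 2] powr_less_mono[of "-(b/2)" 0 2] by (auto simp: G_def G2_def)
  have sum1: "(\<lambda>j. 2 powr (- b * real j)) sums G" unfolding G_def using b by (rule geometric_powr_sums)
  have sum2: "(\<lambda>j. 2 powr (- (b/2) * real j)) sums G2" unfolding G2_def using b by (intro geometric_powr_sums) simp
  \<comment> \<open>Total cost in units of 2^(n d): the first summand pays for all frequencies up to
    level n, the geometric sum \<open>G\<close> for the samples on higher shells.\<close>
  define H where "H = 2 ^ CARD('n) + G"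
  have "1 \<le> (2::real) ^ CARD('n)" by (rule one_le_power) simp
  then have H: "H \<ge> 1" unfolding H_def using G(1) by linarith
  have coef: "(\<Sum>n\<in>dyadic s. norm (fcoef f n)) \<le> K * 2 powr (- b * real s)" 
    if "f \<in> besov_class k r p \<theta>" for f :: "real^'n \<Rightarrow> complex" and s
    unfolding K_def b_def using that assms r by (intro besov_class_dyadic_sum) auto
  define C1 where "C1 = 8 * (C * K * G) * H powr (r / ?d)"
  define C2 where "C2 = 8 * (2 * (C * K) * G2) * (H powr (r / ?d) * 2 powr r)"
  have main: "best_mterm m q f \<le> ennreal ((C1 + C2) * real m powr (- r / ?d))"
    if f: "f \<in> besov_class k r p \<theta>" and m: "m \<ge> 1" for f :: "real^'n \<Rightarrow> complex" and m
  proof -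
    have L: "in_Lp p f" using f by (simp add: besov_class_def)
    have C0: "C1 \<ge> 0" "C2 \<ge> 0" using C K G by (auto simp: C1_def C2_def)
    show ?thesis
    proof (cases "real m < H")
      \<comment> \<open>Too few terms for even the scale n = 0. Nothing is selected, and since
        \<open>m\<close> is below \<open>H\<close> the constant absorbs the power of
        \<open>m\<close>.\<close>
      case True
      have "best_mterm m q f \<le> ennreal (8 * (\<Sum>s. C * K * 2 powr (- b * real s)))"
      proof (rule best_mterm_le[where N="\<lambda>_. 0" and M=0 and p=p])
        show "summable (\<lambda>s. C * K * 2 powr (- b * real s))"
          using sum1 by (intro summable_mult) (simp add: sums_iff)
        fix s
        show "max 1 (4 * (24 * q powr q) powr (1 / q)) * (\<Sum>k\<in>dyadic s. norm (fcoef f k)) / sqrt (real (max 1 0)) \<le> C * K * 2 powr (- b * real s)"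
          using mult_left_mono[OF coef[OF f, of s], of C] C by (simp add: C_def mult.assoc)
      qed (use L assms C K in auto)
      also have "(\<Sum>s. C * K * 2 powr (- b * real s)) = C * K * G"
        using sum1 by (subst suminf_mult) (simp_all add: sums_iff)
      also have "8 * (C * K * G) \<le> C1 * real m powr (- r / ?d)"
      proof -
        have "(real m) powr (r / ?d) \<le> H powr (r / ?d)" using True m r by (intro powr_mono2) auto
        then have "1 \<le> H powr (r / ?d) * real m powr (- r / ?d)"
          using m by (simp add: powr_minus field_simps)
        then have "8 * (C * K * G) * 1 \<le> 8 * (C * K * G) * (H powr (r / ?d) * real m powr (- r / ?d))"
          using C K G by (intro mult_left_mono) auto
        then show ?thesis by (simp add: C1_def mult_ac)
      qed
      also have "\<dots> \<le> (C1 + C2) * real m powr (- r / ?d)" using C0 by (intro mult_right_mono) auto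
      finally show ?thesis by (simp add: ennreal_leI)
    next
      case False
      \<comment> \<open>Scales whose total cost fits into \<open>m\<close>. The greatest one is
        used; its successor fails, and this converts 2^(-r n) into m^(-r/d).\<close>
      define P where "P n \<longleftrightarrow> H * 2 ^ (n * CARD('n)) \<le> real m" for n :: nat
      have P0: "P 0" using False by (simp add: P_def)
      have bound: "n \<le> m" if "P n" for n
      proof -
        have "real n \<le> 2 ^ n" using of_nat_less_two_power[of n] by (simp add: less_imp_le)
        also have "\<dots> \<le> 2 ^ (n * CARD('n))" by (intro power_increasing) auto
        also have "\<dots> \<le> H * 2 ^ (n * CARD('n))" using H by simp
        also have "\<dots> \<le> real m" using that by (simp add: P_def)
        finally show ?thesis by simp
      qed
      define n where "n = Greatest P"
      have Pn: "P n" unfolding n_def by (rule GreatestI_nat[where P=P, OF P0 bound])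
      have "\<not> P (Suc n)" using Greatest_le_nat[of P "Suc n" m] bound unfolding n_def by force
      then have mlt: "real m < H * 2 ^ (Suc n * CARD('n))" by (simp add: P_def)
      define y where "y s = 2 powr (real n * ?d - (real s - real n) * b)" for s :: nat
      define N where "N s = (if s \<le> n then card (dyadic s :: (int^'n) set) else nat \<lfloor>y s\<rfloor>)" for s
      \<comment> \<open>Coefficient bound divided by \<open>sqrt (y s)\<close>; the factor 2 pays
        for rounding \<open>y s\<close> to an integer.\<close>
      define E where "E s = (if s \<le> n then 0 else 2 * (C * K) * 2 powr (- r * real n) * 2 powr (- (b/2) * (real s - real n)))" for s
      \<comment> \<open>From here on the exponent in \<open>y s\<close> is negative, so
        \<open>y s < 1\<close> and the budget rounds down to 0.\<close>
      define s0 where "s0 = Suc (n + nat \<lceil>real n * ?d / b\<rceil>)"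
      \<comment> \<open>The errors start at shell n + 1, so the initial term 1 of the geometric
        series is missing from \<open>G2\<close>.\<close>
      have Esums: "E sums (2 * (C * K) * 2 powr (- r * real n) * (G2 - 1))"
      proof -
        have "(\<lambda>j. E (j + n)) sums (2 * (C * K) * 2 powr (- r * real n) * (G2 - 1))"
        proof -
          have "(\<lambda>j. 2 powr (- (b/2) * real (Suc j))) sums (G2 - 1)"
            using sum2 by (subst sums_Suc_iff) simp
          then have "(\<lambda>j. 2 * (C * K) * 2 powr (- r * real n) * 2 powr (- (b/2) * real (Suc j))) sums (2 * (C * K) * 2 powr (- r * real n) * (G2 - 1))"
            by (rule sums_mult)
          then have "(\<lambda>j. E (Suc j + n)) sums (2 * (C * K) * 2 powr (- r * real n) * (G2 - 1))"
            by (simp add: E_def)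
          then show ?thesis using sums_Suc_iff[of "\<lambda>j. E (j + n)"] by (simp add: E_def)
        qed
        moreover have "(\<Sum>i<n. E i) = 0" by (simp add: E_def)
        ultimately show ?thesis using sums_iff_shift'[of E n] sums_iff_shift[of E n] by simp
      qed
      have "best_mterm m q f \<le> ennreal (8 * suminf E)"
      proof (rule best_mterm_le[where N=N and M=s0 and p=p])
        show "summable E" using Esums by (simp add: sums_iff)
        show "0 \<le> E s" for s using C K by (simp add: E_def)
        show "N s = 0" if "s0 \<le> s" for s
        proof -
          have "real n * ?d / b < real s - real n" using that unfolding s0_def by linarith
          then have "real n * ?d - (real s - real n) * b < 0" using b by (simp add: field_simps)
          then have "y s < 2 powr 0" unfolding y_def by (intro powr_less_mono) auto
          then have "y s < 1" by simp
          then have "\<lfloor>y s\<rfloor> \<le> 0" by linarith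
          moreover have "\<not> s \<le> n" using that unfolding s0_def by linarith
          ultimately show ?thesis by (simp add: N_def)
        qed
        show "(\<Sum>s<s0. N s) \<le> m"
        proof -
          have split: "{..<s0} = {..n} \<union> {n<..<s0}" unfolding s0_def by auto
          have "(\<Sum>s<s0. N s) = (\<Sum>s\<le>n. N s) + (\<Sum>s\<in>{n<..<s0}. N s)"
            unfolding split by (rule sum.union_disjoint) auto
          moreover have "(\<Sum>s\<le>n. N s) \<le> (2 * 2^n) ^ CARD('n)"
          proof -
            have "(\<Sum>s\<le>n. N s) = (\<Sum>s\<le>n. card (dyadic s :: (int^'n) set))" by (simp add: N_def)
            also have "\<dots> = card (\<Union>s\<le>n. dyadic s :: (int^'n) set)"
              by (rule card_UN_disjoint[symmetric]) (auto simp: dyadic_def simp del: finite_dyadic intro: finite_dyadic[unfolded dyadic_def])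
            also have "\<dots> \<le> card (ibox (2^n) :: (int^'n) set)"
              by (intro card_mono) (auto simp: dyadic_def simp flip: level_le_iff)
            also have "\<dots> \<le> (2 * 2^n) ^ CARD('n)" by (rule card_ibox_le)
            finally show ?thesis .
          qed
          moreover have "real (\<Sum>s\<in>{n<..<s0}. N s) \<le> 2 ^ (n * CARD('n)) * G"
          proof -
            have "real (\<Sum>s\<in>{n<..<s0}. N s) \<le> (\<Sum>s\<in>{n<..<s0}. y s)"
              unfolding of_nat_sum
            proof (rule sum_mono)
              fix s assume "s \<in> {n<..<s0}"
              moreover have "real (nat \<lfloor>y s\<rfloor>) \<le> y s" using floor_correct[of "y s"] by (simp add: y_def)
              ultimately show "real (N s) \<le> y s" by (simp add: N_def)
            qed
            also have "\<dots> = 2 ^ (n * CARD('n)) * (\<Sum>s\<in>{n<..<s0}. 2 powr (- b * real (s - n)))"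
              unfolding sum_distrib_left
            proof (rule sum.cong[OF refl])
              fix s assume s: "s \<in> {n<..<s0}"
              have "y s = 2 powr (real n * ?d + - b * real (s - n))"
                using s unfolding y_def by (simp add: of_nat_diff algebra_simps)
              also have "\<dots> = 2 powr (real (n * CARD('n))) * 2 powr (- b * real (s - n))"
                by (subst powr_add) simp
              also have "2 powr (real (n * CARD('n))) = (2::real) ^ (n * CARD('n))" by (rule powr_realpow) simp
              finally show "y s = 2 ^ (n * CARD('n)) * 2 powr (- b * real (s - n))" .
            qed
            also have "(\<Sum>s\<in>{n<..<s0}. 2 powr (- b * real (s - n))) = (\<Sum>j\<in>(\<lambda>s. s - n) ` {n<..<s0}. 2 powr (- b * real j))"
              by (subst sum.reindex) (auto intro!: inj_onI)
            also have "\<dots> \<le> G"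
            proof -
              have "(\<Sum>j\<in>(\<lambda>s. s - n) ` {n<..<s0}. 2 powr (- b * real j)) \<le> (\<Sum>j. 2 powr (- b * real j))"
                using sum1 by (intro sum_le_suminf) (auto simp: sums_iff)
              then show ?thesis using sum1 by (simp add: sums_iff)
            qed
            finally show ?thesis by simp
          qed
          ultimately have "real (\<Sum>s<s0. N s) \<le> real ((2 * 2^n) ^ CARD('n)) + 2 ^ (n * CARD('n)) * G"
            by (simp only: of_nat_add of_nat_le_iff add_mono)
          also have "\<dots> = H * 2 ^ (n * CARD('n))"
            by (simp add: H_def power_mult_distrib power_mult algebra_simps)
          also have "\<dots> \<le> real m" using Pn by (simp add: P_def)
          finally show ?thesis by (simp only: of_nat_le_iff)
        qed
        show "max 1 (4 * (24 * q powr q) powr (1 / q)) * (\<Sum>k\<in>dyadic s. norm (fcoef f k)) / sqrt (real (max 1 (N s))) \<le> E s"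
          if "N s < card (dyadic s :: (int^'n) set)" for s
        proof -
          have s: "s > n" using that by (auto simp: N_def split: if_splits)
          have y0: "y s > 0" by (simp add: y_def)
          have Ns: "real (N s) = real_of_int \<lfloor>y s\<rfloor>" using s y0 by (simp add: N_def)
          \<comment> \<open>From 2 on, rounding down loses at most half; below 2 the maximum with 1
            suffices.\<close>
          have "y s / 2 \<le> real (max 1 (N s))"
          proof (cases "y s < 2")
            case False
            then show ?thesis using Ns by linarith
          qed auto
          then have "sqrt (y s) / 2 \<le> sqrt (real (max 1 (N s)))"
          proof -
            have "sqrt (y s / 4) \<le> sqrt (real (max 1 (N s)))" 
              using \<open>y s / 2 \<le> real (max 1 (N s))\<close> y0 by (intro real_sqrt_le_mono) linarith
            then show ?thesis by (simp add: real_sqrt_divide)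
          qed
          then have "C * (\<Sum>k\<in>dyadic s. norm (fcoef f k)) / sqrt (real (max 1 (N s))) \<le> (C * (K * 2 powr (- b * real s))) / (sqrt (y s) / 2)"
            using C K y0 coef[OF f, of s] by (intro frac_le mult_left_mono) (auto simp: sum_nonneg)
          also have "\<dots> = 2 * (C * K) * (2 powr (- b * real s) / sqrt (y s))" by (simp add: field_simps)
          also have "sqrt (y s) = 2 powr ((real n * ?d - (real s - real n) * b) / 2)"
            unfolding y_def by (simp add: powr_half_sqrt[symmetric] powr_powr)
          \<comment> \<open>The choice of \<open>y\<close> pays off: half of the decay in s - n is
            given up to shrink the budgets, the other half stays in the error, and b + d/2 =
            r.\<close>
          also have "2 powr (- b * real s) / \<dots> = 2 powr (- r * real n) * 2 powr (- (b/2) * (real s - real n))"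
            unfolding powr_diff[symmetric] powr_add[symmetric]
            by (rule arg_cong[where f="\<lambda>e. 2 powr e"]) (simp add: b_def field_simps)
          finally show ?thesis using s unfolding C_def[symmetric] E_def by (simp add: mult.assoc)
        qed
      qed (use L assms in auto)
      also have "8 * suminf E \<le> C2 * real m powr (- r / ?d)"
      proof -
        have "suminf E = 2 * (C * K) * 2 powr (- r * real n) * (G2 - 1)" using Esums by (simp add: sums_iff)
        also have "\<dots> \<le> 2 * (C * K) * 2 powr (- r * real n) * G2" using C K by (intro mult_left_mono) auto
        also have "\<dots> \<le> 2 * (C * K) * (H powr (r / ?d) * 2 powr r * real m powr (- r / ?d)) * G2"
        proof (intro mult_right_mono mult_left_mono)
          have "real m powr (r / ?d) \<le> (H * 2 ^ (Suc n * CARD('n))) powr (r / ?d)"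
            using mlt r by (intro powr_mono2) auto
          also have "\<dots> = H powr (r / ?d) * (2 powr (real (Suc n) * ?d)) powr (r / ?d)"
          proof -
            have "(2::real) ^ (Suc n * CARD('n)) = 2 powr (real (Suc n) * ?d)"
              using powr_realpow[of 2 "Suc n * CARD('n)"] by (simp only: of_nat_mult)
            then show ?thesis using H by (simp only:) (subst powr_mult; simp)
          qed
          also have "(2 powr (real (Suc n) * ?d)) powr (r / ?d) = 2 powr (r + r * real n)"
            unfolding powr_powr by (simp add: algebra_simps)
          also have "\<dots> = 2 powr r * 2 powr (r * real n)" by (rule powr_add)
          finally have le: "real m powr (r / ?d) \<le> H powr (r / ?d) * (2 powr r * 2 powr (r * real n))" .
          have e1: "2 powr (- r * real n) = 1 / 2 powr (r * real n)" by (simp add: powr_minus divide_inverse)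
          have e2: "real m powr (- r / ?d) = 1 / real m powr (r / ?d)" by (simp add: powr_minus divide_inverse)
          show "2 powr (- r * real n) \<le> H powr (r / ?d) * 2 powr r * real m powr (- r / ?d)"
            unfolding e1 e2 using le m by (simp add: divide_simps mult_ac)
        qed (use C K G in auto)
        finally show ?thesis by (simp add: C2_def mult_ac)
      qed
      also have "\<dots> \<le> (C1 + C2) * real m powr (- r / ?d)" using C0 by (intro mult_right_mono) auto
      finally show ?thesis by (simp add: ennreal_leI)
    qed
  qed
  show ?thesis
  proof (intro exI[of _ "C1 + C2 + 1"] conjI allI impI)
    show "0 < C1 + C2 + 1" using C K G by (simp add: C1_def C2_def add_nonneg_pos)
    fix m :: nat assume m: "1 \<le> m"
    show "best_mterm_class m q (besov_class k r p \<theta> :: (real^'n \<Rightarrow> complex) set) \<le> ennreal ((C1 + C2 + 1) * real m powr (- r / ?d))"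
      unfolding best_mterm_class_def
    proof (rule SUP_least)
      fix f :: "real^'n \<Rightarrow> complex" assume "f \<in> besov_class k r p \<theta>"
      from main[OF this m] show "best_mterm m q f \<le> ennreal ((C1 + C2 + 1) * real m powr (- r / ?d))"
        by (rule order.trans) (intro ennreal_leI mult_right_mono, auto)
    qed
  qed
qed

section \<open>Rudin-Shapiro polynomials\<close>

fun rudin_shapiro :: "nat \<Rightarrow> complex \<Rightarrow> complex \<times> complex" where
  "rudin_shapiro 0 z = (1, 1)"
| "rudin_shapiro (Suc n) z = (let (P, Q) = rudin_shapiro n z in (P + z^(2^n) * Q, P - z^(2^n) * Q))"

text \<open>The parallelogram law doubles the sum of squares in each step. Admitting
  \<open>\<rho> > 1\<close> gives control off the unit circle: the accumulated power of
  \<open>\<rho>\<close> remains bounded for \<open>\<rho> = exp (1 / 2^n)\<close>.\<close>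

lemma rudin_shapiro_bound:
  assumes "norm z \<le> \<rho>" "1 \<le> \<rho>"
  shows "(norm (fst (rudin_shapiro n z)))\<^sup>2 + (norm (snd (rudin_shapiro n z)))\<^sup>2 \<le> 2^(n+1) * \<rho>^(2^(n+1))"
proof (induction n)
  case 0
  have "1 \<le> \<rho>^2" using assms(2) by (rule one_le_power)
  then show ?case by simp
next
  case (Suc n)
  obtain P Q where PQ: "rudin_shapiro n z = (P, Q)" by force
  have "norm (z^(2^n)) \<le> \<rho>^(2^n)" unfolding norm_power using assms by (intro power_mono) auto
  then have z: "(norm (z^(2^n)))\<^sup>2 \<le> \<rho>^(2^(n+1))"
    using power_mono[of "norm (z^(2^n))" "\<rho>^(2^n)" 2] by (simp add: power_mult[symmetric] mult.commute)
  have \<rho>1: "1 \<le> \<rho>^(2^(n+1))" using assms(2) by (rule one_le_power)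
  have "(norm (P + z^(2^n) * Q))\<^sup>2 + (norm (P - z^(2^n) * Q))\<^sup>2 = 2 * ((norm P)\<^sup>2 + (norm (z^(2^n) * Q))\<^sup>2)"
    unfolding cmod_power2 by (simp add: power2_eq_square algebra_simps)
  also have "\<dots> = 2 * (1 * (norm P)\<^sup>2 + (norm (z^(2^n)))\<^sup>2 * (norm Q)\<^sup>2)" by (simp only: norm_mult power_mult_distrib mult_1)
  also have "\<dots> \<le> 2 * (\<rho>^(2^(n+1)) * (norm P)\<^sup>2 + \<rho>^(2^(n+1)) * (norm Q)\<^sup>2)"
    using z \<rho>1 by (intro mult_left_mono add_mono mult_right_mono) auto
  also have "\<dots> = 2 * \<rho>^(2^(n+1)) * ((norm P)\<^sup>2 + (norm Q)\<^sup>2)" by (simp add: algebra_simps)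
  also have "\<dots> \<le> 2 * \<rho>^(2^(n+1)) * (2^(n+1) * \<rho>^(2^(n+1)))"
    using Suc PQ assms by (intro mult_left_mono) auto
  also have "\<dots> = 2^(Suc n+1) * (\<rho>^(2^(n+1)) * \<rho>^(2^(n+1)))" by simp
  also have "\<rho>^(2^(n+1)) * \<rho>^(2^(n+1)) = \<rho>^(2^(Suc n+1))" by (simp add: power_add[symmetric])
  finally show ?case by (simp add: PQ)
qed

lemma rudin_shapiro_coeffs:
  "\<exists>\<epsilon> \<delta>. (\<forall>k. norm (\<epsilon> k) = 1 \<and> norm (\<delta> k) = 1) \<and>
     (\<forall>z. fst (rudin_shapiro n z) = (\<Sum>k<2^n. \<epsilon> k * z^k) \<and> snd (rudin_shapiro n z) = (\<Sum>k<2^n. \<delta> k * z^k))"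
proof (induction n)
  case 0
  show ?case by (intro exI[of _ "\<lambda>_. 1"]) simp
next
  case (Suc n)
  then obtain \<epsilon> \<delta> where ed: "\<And>k. norm (\<epsilon> k) = 1" "\<And>k. norm (\<delta> k) = 1"
    "\<And>z. fst (rudin_shapiro n z) = (\<Sum>k<2^n. \<epsilon> k * z^k)" "\<And>z. snd (rudin_shapiro n z) = (\<Sum>k<2^n. \<delta> k * z^k)"
    by blast
  have split: "(\<Sum>k<2^n. \<epsilon> k * z^k) + \<sigma> * (z^(2^n) * (\<Sum>k<2^n. \<delta> k * z^k))
      = (\<Sum>k<2^Suc n. (if k < 2^n then \<epsilon> k else \<sigma> * \<delta> (k - 2^n)) * z^k)" for \<sigma> z
  proof -
    have eq: "{..<2^Suc n} = {..<2^n} \<union> {2^n..<2^Suc n::nat}" by auto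
    have "(\<Sum>k<2^Suc n. (if k < 2^n then \<epsilon> k else \<sigma> * \<delta> (k - 2^n)) * z^k)
      = (\<Sum>k<2^n. \<epsilon> k * z^k) + (\<Sum>k\<in>{2^n..<2^Suc n}. \<sigma> * \<delta> (k - 2^n) * z^k)"
      unfolding eq by (subst sum.union_disjoint) auto
    also have "(\<Sum>k\<in>{2^n..<2^Suc n}. \<sigma> * \<delta> (k - 2^n) * z^k) = (\<Sum>k<2^n. \<sigma> * \<delta> k * z^(k + 2^n))"
      using sum.shift_bounds_nat_ivl[of "\<lambda>k. \<sigma> * \<delta> (k - 2^n) * z^k" 0 "2^n" "2^n"]
      by (simp add: atLeast0LessThan mult_2)
    also have "\<dots> = \<sigma> * (z^(2^n) * (\<Sum>k<2^n. \<delta> k * z^k))"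
      by (simp add: sum_distrib_left power_add mult_ac)
    finally show ?thesis by simp
  qed
  show ?case
    by (rule exI[of _ "\<lambda>k. if k < 2^n then \<epsilon> k else 1 * \<delta> (k - 2^n)"],
        rule exI[of _ "\<lambda>k. if k < 2^n then \<epsilon> k else (-1) * \<delta> (k - 2^n)"])
       (use ed split[where \<sigma>=1] split[where \<sigma>="-1"] in \<open>auto simp: case_prod_unfold Let_def simp del: power_Suc\<close>)
qed

text \<open>The modulation by \<^term>\<open>3 * 2^n\<close> moves the frequencies to \<^term>\<open>{3 * 2^n..<4 * 2^n :: int}\<close>,
  where the multiplier of \<^term>\<open>sigma_block (n + 2)\<close> is at least one half.\<close>

definition shifted_rs :: "nat \<Rightarrow> complex \<Rightarrow> complex" where
  "shifted_rs n w = exp (\<i> * of_nat (3 * 2^n) * w) * fst (rudin_shapiro n (exp (\<i> * w)))"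

text \<open>In this strip the modulation contributes at most \<open>exp 3\<close> and the growth of
  the polynomial at most \<open>exp 1\<close>, so the bound is that of the real line up to a
  constant.\<close>

lemma shifted_rs_strip_bound:
  assumes "\<bar>Im w\<bar> \<le> 1 / 2^n"
  shows "norm (shifted_rs n w) \<le> exp 4 * sqrt 2 * sqrt (2^n)"
proof -
  define \<rho> where "\<rho> = exp (1 / 2^n :: real)"
  have "norm (exp (\<i> * w)) \<le> \<rho>" using assms by (simp add: \<rho>_def abs_le_iff)
  moreover have "1 \<le> \<rho>" by (simp add: \<rho>_def)
  ultimately have "(norm (fst (rudin_shapiro n (exp (\<i> * w)))))\<^sup>2 \<le> 2^(n+1) * \<rho>^(2^(n+1))"
    using rudin_shapiro_bound[of "exp (\<i> * w)" \<rho> n] zero_le_power2[of "norm (snd (rudin_shapiro n (exp (\<i> * w))))"] by linarith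
  also have "\<rho>^(2^(n+1)) = exp 2" by (simp add: \<rho>_def exp_of_nat_mult[symmetric])
  also have "2^(n+1) * exp 2 = (sqrt 2 * sqrt (2^n) * exp (1::real))\<^sup>2"
    by (simp add: power_mult_distrib exp_of_nat_mult[symmetric] exp_double[symmetric])
  finally have "norm (fst (rudin_shapiro n (exp (\<i> * w)))) \<le> sqrt 2 * sqrt (2^n) * exp 1"
    by (rule power2_le_imp_le) simp
  moreover have "norm (exp (\<i> * of_nat (3 * 2^n) * w)) \<le> exp 3"
  proof -
    have "- Im w * (3 * 2^n) \<le> 1 / 2^n * (3 * 2^n)" using assms by (intro mult_right_mono) (auto simp: abs_le_iff)
    then have "- (3 * 2^n * Im w) \<le> 3" by (simp add: mult.commute)
    then show ?thesis by (simp add: Re_divide)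
  qed
  ultimately have "norm (shifted_rs n w) \<le> exp 3 * (sqrt 2 * sqrt (2^n) * exp 1)"
    unfolding shifted_rs_def norm_mult by (intro mult_mono) auto
  also have "\<dots> = exp 4 * sqrt 2 * sqrt (2^n)" by (simp add: exp_add[symmetric] mult_ac)
  finally show ?thesis .
qed

lemma shifted_rs_coeffs:
  "\<exists>\<epsilon>. (\<forall>i. norm (\<epsilon> i) = 1) \<and> (\<forall>w. shifted_rs n w = (\<Sum>i\<in>{3 * 2^n..<4 * 2^n::int}. \<epsilon> i * exp (\<i> * of_int i * w)))"
proof -
  obtain \<epsilon> where e: "\<And>k. norm (\<epsilon> k) = 1" "\<And>z. fst (rudin_shapiro n z) = (\<Sum>k<2^n. \<epsilon> k * z^k)"
    using rudin_shapiro_coeffs[of n] by blast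
  have eq: "shifted_rs n w = (\<Sum>i\<in>{3 * 2^n..<4 * 2^n::int}. \<epsilon> (nat (i - 3 * 2^n)) * exp (\<i> * of_int i * w))" for w
  proof -
    have "shifted_rs n w = (\<Sum>k<2^n. \<epsilon> k * exp (\<i> * of_int (int k + 3 * 2^n) * w))"
      unfolding shifted_rs_def e sum_distrib_left
    proof (rule sum.cong[OF refl])
      fix k
      have "exp (\<i> * of_nat (3 * 2^n) * w) * exp (\<i> * w) ^ k = exp (\<i> * of_nat (3 * 2^n) * w + of_nat k * (\<i> * w))"
        by (simp only: exp_of_nat_mult[symmetric] exp_add)
      also have "\<i> * of_nat (3 * 2^n) * w + of_nat k * (\<i> * w) = \<i> * of_int (int k + 3 * 2^n) * w"
        by (simp add: algebra_simps)
      finally show "exp (\<i> * of_nat (3 * 2^n) * w) * (\<epsilon> k * exp (\<i> * w) ^ k) = \<epsilon> k * exp (\<i> * of_int (int k + 3 * 2^n) * w)"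
        by (simp only: mult.left_commute)
    qed
    also have "\<dots> = (\<Sum>i\<in>(\<lambda>k. int k + 3 * 2^n) ` {..<2^n}. \<epsilon> (nat (i - 3 * 2^n)) * exp (\<i> * of_int i * w))"
      by (subst sum.reindex) (auto simp: inj_on_def)
    also have "(\<lambda>k. int k + 3 * 2^n) ` {..<2^n} = {3 * 2^n..<4 * 2^n::int}"
    proof (intro set_eqI iffI)
      fix i assume "i \<in> {3 * 2^n..<4 * 2^n::int}"
      then show "i \<in> (\<lambda>k. int k + 3 * 2^n) ` {..<2^n}"
        by (intro image_eqI[of _ _ "nat (i - 3 * 2^n)"]) (auto simp: nat_less_iff)
    next
      fix i assume "i \<in> (\<lambda>k. int k + 3 * 2^n) ` {..<2^n}"
      then obtain k :: nat where k: "k < 2^n" "i = int k + 3 * 2^n" by auto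
      then have "int k < int (2^n)" by (simp only: of_nat_less_iff)
      with k(2) show "i \<in> {3 * 2^n..<4 * 2^n::int}" by simp
    qed
    finally show ?thesis .
  qed
  show ?thesis by (intro exI[of _ "\<lambda>i. \<epsilon> (nat (i - 3 * 2^n))"] conjI allI e(1) eq)
qed

lemma shifted_rs_holomorphic: "shifted_rs n holomorphic_on UNIV"
proof -
  obtain \<epsilon> where e: "\<And>w. shifted_rs n w = (\<Sum>i\<in>{3 * 2^n..<4 * 2^n::int}. \<epsilon> i * exp (\<i> * of_int i * w))"
    using shifted_rs_coeffs[of n] by blast
  show ?thesis unfolding e[abs_def] by (intro holomorphic_intros)
qed

section \<open>Differences estimated by Cauchy's inequality\<close>

text \<open>The form that \<open>diff_op h\<close> takes along the line through \<open>x\<close> in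
  direction \<open>h\<close> once the line parameter is made complex.\<close>

definition unit_diff :: "(complex \<Rightarrow> complex) \<Rightarrow> complex \<Rightarrow> complex" where
  "unit_diff g \<zeta> = g (\<zeta> + 1) - g \<zeta>"

text \<open>Mean value inequality on the narrower strip, which a real unit step does not leave;
  discs of radius \<open>\<rho>\<close> around its points stay in the wider strip, so Cauchy's
  estimate bounds the derivative.\<close>

lemma unit_diff_strip_bound:
  assumes g: "g holomorphic_on UNIV" and A: "\<And>\<zeta>. \<bar>Im \<zeta>\<bar> \<le> R \<Longrightarrow> norm (g \<zeta>) \<le> A"
    and \<rho>: "0 < \<rho>" and \<zeta>: "\<bar>Im \<zeta>\<bar> \<le> R - \<rho>"
  shows "norm (unit_diff g \<zeta>) \<le> A / \<rho>"
proof -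
  let ?S = "{z. Im z \<le> R - \<rho>} \<inter> {z. Im z \<ge> - (R - \<rho>)}"
  have "norm (g (\<zeta> + 1) - g \<zeta>) \<le> A / \<rho> * norm (\<zeta> + 1 - \<zeta>)"
  proof (rule field_differentiable_bound[where f'="deriv g"])
    show "convex ?S" by (intro convex_Int convex_halfspace_Im_le convex_halfspace_Im_ge)
    fix z assume z: "z \<in> ?S"
    show "(g has_field_derivative deriv g z) (at z within ?S)"
      using holomorphic_derivI[OF g open_UNIV, of z] by (rule has_field_derivative_at_within) simp
    have "norm ((deriv ^^ 1) g z) \<le> fact 1 * A / \<rho> ^ 1"
    proof (rule Cauchy_inequality[OF _ _ \<rho>])
      show "g holomorphic_on ball z \<rho>" using g holomorphic_on_subset by blast
      show "continuous_on (cball z \<rho>) g" using g holomorphic_on_imp_continuous_on continuous_on_subset by blast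
      fix x assume "norm (z - x) = \<rho>"
      then have "\<bar>Im z - Im x\<bar> \<le> \<rho>" using abs_Im_le_cmod[of "z - x"] by simp
      then show "norm (g x) \<le> A" using z by (intro A) auto
    qed
    then show "norm (deriv g z) \<le> A / \<rho>" by simp
  qed (use \<zeta> in auto)
  then show ?thesis by (simp add: unit_diff_def)
qed

lemma unit_diff_pow_strip_bound:
  assumes g: "g holomorphic_on UNIV" and A: "\<And>\<zeta>. \<bar>Im \<zeta>\<bar> \<le> R \<Longrightarrow> norm (g \<zeta>) \<le> A" and \<rho>: "0 < \<rho>"
  shows "(unit_diff ^^ k) g holomorphic_on UNIV \<and> (\<forall>\<zeta>. \<bar>Im \<zeta>\<bar> \<le> R - real k * \<rho> \<longrightarrow> norm ((unit_diff ^^ k) g \<zeta>) \<le> A / \<rho>^k)"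
proof (induction k)
  case (Suc k)
  let ?u = "(unit_diff ^^ k) g"
  have hu: "?u holomorphic_on UNIV" using Suc by simp
  have "(\<lambda>\<zeta>. ?u (\<zeta> + 1)) holomorphic_on UNIV"
    by (rule holomorphic_on_compose[of "\<lambda>\<zeta>. \<zeta> + 1" UNIV ?u, unfolded o_def])
       (use holomorphic_on_subset[OF hu] in \<open>auto intro!: holomorphic_intros\<close>)
  then have "unit_diff ?u holomorphic_on UNIV"
    using hu unfolding unit_diff_def[of ?u, abs_def] by (intro holomorphic_on_diff)
  moreover have "norm (unit_diff ?u \<zeta>) \<le> A / \<rho>^k / \<rho>" if "\<bar>Im \<zeta>\<bar> \<le> R - real (Suc k) * \<rho>" for \<zeta>
    by (rule unit_diff_strip_bound[OF hu _ \<rho>, where R="R - real k * \<rho>"]) (use Suc that in \<open>auto simp: algebra_simps\<close>)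
  ultimately show ?case by (simp add: mult.commute)
qed (use g A in simp)

text \<open>Returns from the analytic extension \<open>g\<close> to \<open>f\<close>: on the real
  axis a unit step of the parameter is a shift by \<open>h\<close>.\<close>

lemma unit_diff_pow_eq_diff_pow:
  assumes "\<And>t. g (of_real t) = f (x + t *\<^sub>R h)"
  shows "(unit_diff ^^ k) g (of_real t) = diff_pow k h f (x + t *\<^sub>R h)"
proof (induction k arbitrary: t)
  case (Suc k)
  have "(unit_diff ^^ Suc k) g (of_real t) = (unit_diff ^^ k) g (of_real (t + 1)) - (unit_diff ^^ k) g (of_real t)"
    by (simp add: unit_diff_def)
  also have "\<dots> = diff_pow k h f (x + (t + 1) *\<^sub>R h) - diff_pow k h f (x + t *\<^sub>R h)"
    by (simp only: Suc)
  finally show ?case by (simp add: diff_pow_Suc diff_op_def algebra_simps)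
qed (simp add: assms)

section \<open>Tensor product test polynomials\<close>

definition test_poly :: "nat \<Rightarrow> real^'n \<Rightarrow> complex" where
  "test_poly n x = (\<Prod>j\<in>UNIV. shifted_rs n (of_real (x$j)))"

definition test_freqs :: "nat \<Rightarrow> (int^'n) set" where
  "test_freqs n = {k. \<forall>j. k$j \<in> {3 * 2^n..<4 * 2^n}}"

lemma finite_test_freqs [simp]: "finite (test_freqs n)"
  unfolding test_freqs_def by (rule finite_vec_set) simp

lemma card_test_freqs: "card (test_freqs n :: (int^'n) set) = 2^(n * CARD('n))"
proof -
  have c: "card {3 * 2^n..<4 * 2^n::int} = 2^n" by (simp add: nat_power_eq)
  show ?thesis unfolding test_freqs_def by (subst card_vec_set) (simp_all only: c power_mult finite_atLeastLessThan_int)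
qed

lemma test_poly_coeffs:
  "\<exists>c. (\<forall>k. norm (c k) = 1) \<and> (\<forall>x::real^'n. test_poly n x = (\<Sum>k\<in>test_freqs n. c k * char_exp k x))"
proof -
  obtain \<epsilon> where e: "\<And>i. norm (\<epsilon> i) = 1" 
    "\<And>w. shifted_rs n w = (\<Sum>i\<in>{3 * 2^n..<4 * 2^n::int}. \<epsilon> i * exp (\<i> * of_int i * w))"
    using shifted_rs_coeffs[of n] by blast
  have "test_poly n x = (\<Sum>k\<in>test_freqs n. (\<Prod>j\<in>UNIV. \<epsilon> (k$j)) * char_exp k x)" for x :: "real^'n"
    unfolding test_poly_def e(2) test_freqs_def
    by (subst prod_sum_vec) (simp_all add: prod.distrib char_exp_conv_prod cis_conv_exp mult_ac)
  moreover have "norm (\<Prod>j\<in>UNIV. \<epsilon> (k$j)) = 1" for k :: "int^'n" by (simp add: prod_norm[symmetric] e)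
  ultimately show ?thesis by (intro exI[of _ "\<lambda>k. \<Prod>j\<in>UNIV. \<epsilon> (k$j)"]) auto
qed

lemma test_poly_bound:
  "norm (test_poly n (x :: real^'n)) \<le> (exp 4 * sqrt 2 * sqrt (2^n)) ^ CARD('n)"
proof -
  have "norm (test_poly n x) \<le> (\<Prod>j\<in>(UNIV :: 'n set). exp 4 * sqrt 2 * sqrt (2^n))"
    unfolding test_poly_def prod_norm[symmetric] by (intro prod_mono conjI shifted_rs_strip_bound) auto
  then show ?thesis by simp
qed

text \<open>Plays the role of Bernstein's inequality in the sup norm: each difference costs a factor
  comparable to 2^n times the length of \<open>h\<close>.\<close>

lemma test_poly_diff_pow_bound:
  fixes x h :: "real^'n"
  assumes k: "k > 0"
  shows "norm (diff_pow k h (test_poly n) x) \<le> (exp 4 * sqrt 2 * sqrt (2^n)) ^ CARD('n) * (real k * 2^n * norm h)^k"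
proof (cases "h = 0")
  case True
  obtain k' where "k = Suc k'" using k by (cases k) auto
  then show ?thesis using True by (simp add: diff_pow_Suc diff_op_def)
next
  case False
  let ?A = "(exp 4 * sqrt 2 * sqrt (2^n)) ^ CARD('n) :: real"
  define g where "g \<zeta> = (\<Prod>j\<in>UNIV. shifted_rs n (of_real (x$j) + \<zeta> * of_real (h$j)))" for \<zeta>
  \<comment> \<open>Keeps every coordinate of the complexified line within the strip of
    \<open>shifted_rs_strip_bound\<close>. The \<open>k\<close> differences use up
    \<open>\<rho> = R / k\<close> each, which leaves exactly the real axis.\<close>
  define R where "R = 1 / (2^n * norm h)"
  define \<rho> where "\<rho> = R / real k"
  have R: "R > 0" using False by (simp add: R_def)
  have \<rho>: "\<rho> > 0" using R k by (simp add: \<rho>_def)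
  have "(\<lambda>\<zeta>. shifted_rs n (of_real (x$j) + \<zeta> * of_real (h$j))) holomorphic_on UNIV" for j
    by (rule holomorphic_on_compose[of "\<lambda>\<zeta>. of_real (x$j) + \<zeta> * of_real (h$j)" UNIV "shifted_rs n", unfolded o_def])
       (use holomorphic_on_subset[OF shifted_rs_holomorphic[of n]] in \<open>auto intro!: holomorphic_intros\<close>)
  then have hol: "g holomorphic_on UNIV" unfolding g_def[abs_def] by (intro holomorphic_on_prod)
  have bound: "norm (g \<zeta>) \<le> ?A" if "\<bar>Im \<zeta>\<bar> \<le> R" for \<zeta>
  proof -
    have "norm (g \<zeta>) \<le> (\<Prod>j\<in>(UNIV :: 'n set). exp 4 * sqrt 2 * sqrt (2^n))"
      unfolding g_def prod_norm[symmetric]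
    proof (intro prod_mono conjI shifted_rs_strip_bound)
      fix j :: 'n
      have "\<bar>Im \<zeta>\<bar> * \<bar>h$j\<bar> \<le> R * norm h" using that component_le_norm_cart[of h j] R by (intro mult_mono) auto
      also have "\<dots> = 1 / 2^n" using False by (simp add: R_def)
      finally show "\<bar>Im (of_real (x$j) + \<zeta> * of_real (h$j))\<bar> \<le> 1 / 2^n" by (simp add: abs_mult)
    qed auto
    then show ?thesis by simp
  qed
  have "norm ((unit_diff ^^ k) g 0) \<le> ?A / \<rho>^k"
    using unit_diff_pow_strip_bound[where R=R and k=k, OF hol bound \<rho>] k by (simp add: \<rho>_def)
  moreover have "(unit_diff ^^ k) g 0 = diff_pow k h (test_poly n) x"
    using unit_diff_pow_eq_diff_pow[of g "test_poly n" x h k 0] by (simp add: g_def test_poly_def)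
  moreover have "1 / \<rho>^k = (real k * 2^n * norm h)^k" 
    using False k by (simp add: \<rho>_def R_def power_divide power_mult_distrib field_simps)
  ultimately show ?thesis by (simp add: divide_inverse)
qed

lemma diff_pow_bound:
  assumes "\<And>x. norm (f x) \<le> B"
  shows "norm (diff_pow k h f x) \<le> 2^k * B"
proof (induction k arbitrary: x)
  case (Suc k)
  have "norm (diff_pow (Suc k) h f x) \<le> norm (diff_pow k h f (x + h)) + norm (diff_pow k h f x)"
    unfolding diff_pow_Suc diff_op_def by (rule norm_triangle_ineq4)
  also have "\<dots> \<le> 2^k * B + 2^k * B" by (intro add_mono Suc)
  finally show ?case by (simp add: mult_ac)
qed (simp add: assms)

lemma diff_pow_cmult: "diff_pow k h (\<lambda>x. c * f x) x = c * diff_pow k h f x"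
proof (induction k arbitrary: x)
  case (Suc k)
  then show ?case by (simp add: diff_pow_Suc diff_op_def right_diff_distrib)
qed simp

section \<open>The lower bound\<close>

text \<open>Membership for a function oscillating at scale \<open>\<tau>\<close>: its modulus
  saturates for steps beyond \<open>\<tau>\<close> and decays like the k-th power below. The
  condition on \<open>c\<close> reserves one half for the L_p norm and one half for the smoothness
  part, for all \<open>\<theta>\<close> simultaneously.\<close>

lemma besov_classI:
  fixes f :: "real^'n \<Rightarrow> complex"
  assumes f: "vperiodic f" "f \<in> borel_measurable borel" and p: "p > 0" and \<theta>: "1 \<le> \<theta>"
    and r: "0 < r" "r < real k" and \<tau>: "0 < \<tau>"
    and c: "0 \<le> c" "c * max 1 (1 / (real k - r) + 1 / r) \<le> 1/2"
    and bd: "\<And>x. norm (f x) \<le> c"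
    and d1: "\<And>h x. norm (diff_pow k h f x) \<le> c * \<tau> powr r"
    and d2: "\<And>h x. norm (diff_pow k h f x) \<le> c * \<tau> powr r * (norm h / \<tau>)^k"
  shows "f \<in> besov_class k r p \<theta>"
proof -
  have L: "in_Lp p f" using in_Lp_bounded[OF f bd p] .
  define W where "W = 1 / (real k - r) + 1 / r"
  have W: "W > 0" using r by (simp add: W_def add_pos_pos)
  have ch: "c \<le> 1/2"
  proof -
    have "c * 1 \<le> c * max 1 W" using c(1) by (intro mult_left_mono) auto
    then show ?thesis using c(2) by (simp add: W_def)
  qed
  have Lp: "Lp_norm p f \<le> 1/2" using Lp_norm_le_bound[OF f(2) p bd] ch by linarith
  let ?w = "modulus k p f"
  have diff_meas: "diff_pow k h f \<in> borel_measurable borel" for h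
    using in_Lp_diff_pow[OF L p] by (simp add: in_Lp_iff)
  have w1: "?w t \<le> c * \<tau> powr r" if "t > 0" for t
    unfolding modulus_def using that d1 Lp_norm_le_bound[OF diff_meas p] by (intro cSUP_least) auto
  have w2: "?w t \<le> c * \<tau> powr r * (t / \<tau>)^k" if "t > 0" for t
    unfolding modulus_def
  proof (rule cSUP_least)
    fix h :: "real^'n" assume h: "h \<in> cball 0 t"
    show "Lp_norm p (diff_pow k h f) \<le> c * \<tau> powr r * (t / \<tau>)^k"
    proof (rule Lp_norm_le_bound[OF diff_meas p])
      fix x
      have "c * \<tau> powr r * (norm h / \<tau>)^k \<le> c * \<tau> powr r * (t / \<tau>)^k"
        using c \<tau> h by (intro mult_left_mono power_mono divide_right_mono) auto
      then show "norm (diff_pow k h f x) \<le> c * \<tau> powr r * (t / \<tau>)^k" using d2[of h x] by linarith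
    qed
  qed (use that in auto)
  have w0: "0 \<le> ?w t" if "t > 0" for t using modulus_nonneg[OF L p, of t k] that by simp
  \<comment> \<open>Profile of the weighted modulus: it rises to 1 at \<open>\<tau>\<close> and
    falls afterwards, and its integral against dt/t is 1/(k - r) + 1/r for every
    \<open>\<tau>\<close>.\<close>
  define \<phi> where "\<phi> t = (if t \<le> \<tau> then \<tau> powr (r - real k) * t powr (real k - r) else \<tau> powr r * t powr (- r))" for t
  have w\<phi>: "t powr (- r) * ?w t \<le> c * \<phi> t" if t: "t > 0" for t
  proof (cases "t \<le> \<tau>")
    case True
    have "t powr (- r) * ?w t \<le> t powr (- r) * (c * \<tau> powr r * (t / \<tau>)^k)" using w2[OF t] by (intro mult_left_mono) auto
    also have "(t / \<tau>)^k = t powr real k * \<tau> powr (- real k)"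
      using t \<tau> by (simp add: power_mult_distrib power_inverse powr_minus powr_realpow divide_inverse)
    also have "t powr (- r) * (c * \<tau> powr r * (t powr real k * \<tau> powr (- real k))) = 
        c * (\<tau> powr r * \<tau> powr (- real k)) * (t powr real k * t powr (- r))" by (simp add: mult_ac)
    also have "\<dots> = c * \<phi> t" using True by (simp add: \<phi>_def powr_add[symmetric])
    finally show ?thesis .
  next
    case False
    have "t powr (- r) * ?w t \<le> t powr (- r) * (c * \<tau> powr r)" using w1[OF t] by (intro mult_left_mono) auto
    then show ?thesis using False by (simp add: \<phi>_def mult_ac)
  qed
  have \<phi>1: "\<phi> t \<le> 1" if t: "t > 0" for t
  proof (cases "t \<le> \<tau>")
    case True
    have "\<tau> powr (r - real k) * t powr (real k - r) \<le> \<tau> powr (r - real k) * \<tau> powr (real k - r)"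
      using True t r by (intro mult_left_mono powr_mono2) auto
    then show ?thesis using True \<tau> by (simp add: \<phi>_def powr_add[symmetric])
  next
    case False
    have "\<tau> powr r * t powr (- r) \<le> \<tau> powr r * \<tau> powr (- r)"
      using False \<tau> r by (intro mult_left_mono powr_mono2') auto
    then show ?thesis using False \<tau> by (simp add: \<phi>_def powr_add[symmetric])
  qed
  have \<phi>0: "0 \<le> \<phi> t" for t by (simp add: \<phi>_def)
  show ?thesis
  proof (cases "\<theta> = \<infinity>")
    case True
    have le: "t powr (- r) * ?w t \<le> 1/2" if "t > 0" for t
    proof -
      have "c * \<phi> t \<le> c * 1" using \<phi>1[OF that] c by (intro mult_left_mono) auto
      then show ?thesis using w\<phi>[OF that] ch by linarith
    qed
    have bdd: "bdd_above ((\<lambda>t. t powr (-r) * ?w t) ` {0<..})"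
      by (rule bdd_aboveI2[where M="1/2"]) (use le in auto)
    have "(SUP t\<in>{0<..}. t powr (-r) * ?w t) \<le> 1/2" by (rule cSUP_least) (use le in auto)
    then have "besov_norm k r p \<theta> f \<le> 1"
      using True bdd Lp by (simp add: besov_norm_def del: ennreal_plus)
    then show ?thesis using L by (simp add: besov_class_def)
  next
    case False
    define T where "T = enn2real \<theta>"
    have T: "1 \<le> T"
    proof -
      have "enn2real 1 \<le> enn2real \<theta>" using \<theta> False by (intro enn2real_mono) (auto simp: less_top)
      then show ?thesis by (simp add: T_def)
    qed
    define I where "I = (\<integral>\<^sup>+ t\<in>{0<..}. ennreal ((t powr (-r) * ?w t) powr T / t) \<partial>lborel)"
    have "I \<le> (\<integral>\<^sup>+ t. ennreal (c powr T * \<tau> powr (r - real k)) * (ennreal (t powr (real k - r - 1)) * indicator {0..\<tau>} t)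
        + ennreal (c powr T * \<tau> powr r) * (ennreal (t powr (- r - 1)) * indicator {\<tau>..} t) \<partial>lborel)"
      unfolding I_def
    proof (rule nn_integral_mono)
      fix t :: real
      show "ennreal ((t powr (-r) * ?w t) powr T / t) * indicator {0<..} t \<le>
        ennreal (c powr T * \<tau> powr (r - real k)) * (ennreal (t powr (real k - r - 1)) * indicator {0..\<tau>} t)
        + ennreal (c powr T * \<tau> powr r) * (ennreal (t powr (- r - 1)) * indicator {\<tau>..} t)"
      proof (cases "t > 0")
        case t: True
        have "(t powr (-r) * ?w t) powr T \<le> (c * \<phi> t) powr T"
          using w\<phi>[OF t] w0[OF t] T by (intro powr_mono2) auto
        also have "\<dots> = c powr T * \<phi> t powr T" using c \<phi>0 by (simp add: powr_mult)
        \<comment> \<open>As the profile is at most 1 and \<open>T\<close> at least 1, one integral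
          serves all finite \<open>\<theta>\<close>.\<close>
        also have "\<dots> \<le> c powr T * \<phi> t powr 1"
        proof (rule mult_left_mono)
          show "\<phi> t powr T \<le> \<phi> t powr 1"
          proof (cases "\<phi> t = 0")
            case False
            then show ?thesis using \<phi>0[of t] \<phi>1[OF t] T by (intro powr_mono') auto
          qed simp
        qed simp
        also have "\<phi> t powr 1 = \<phi> t" using \<phi>0[of t] by simp
        finally have le: "(t powr (-r) * ?w t) powr T / t \<le> c powr T * \<phi> t / t" using t by (intro divide_right_mono) auto
        show ?thesis
        proof (cases "t \<le> \<tau>")
          case True
          have "c powr T * \<phi> t / t = (c powr T * \<tau> powr (r - real k)) * t powr (real k - r - 1)"
            using True t by (simp add: \<phi>_def powr_diff)
          then have "ennreal ((t powr (-r) * ?w t) powr T / t) \<le> ennreal (c powr T * \<tau> powr (r - real k)) * ennreal (t powr (real k - r - 1))"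
            using le by (simp add: ennreal_mult[symmetric] ennreal_leI)
          then show ?thesis using True t by (simp add: add_increasing2)
        next
          case False
          have "c powr T * \<phi> t / t = (c powr T * \<tau> powr r) * t powr (- r - 1)"
            using False t by (simp add: \<phi>_def powr_diff)
          then have "ennreal ((t powr (-r) * ?w t) powr T / t) \<le> ennreal (c powr T * \<tau> powr r) * ennreal (t powr (- r - 1))"
            using le by (simp add: ennreal_mult[symmetric] ennreal_leI)
          then show ?thesis using False t by simp
        qed
      qed simp
    qed
    also have "\<dots> = ennreal (c powr T * \<tau> powr (r - real k)) * (\<integral>\<^sup>+ t. ennreal (t powr (real k - r - 1)) * indicator {0..\<tau>} t \<partial>lborel)
        + ennreal (c powr T * \<tau> powr r) * (\<integral>\<^sup>+ t. ennreal (t powr (- r - 1)) * indicator {\<tau>..} t \<partial>lborel)"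
      by (subst nn_integral_add) (auto simp: nn_integral_cmult)
    also have "(\<integral>\<^sup>+ t. ennreal (t powr (real k - r - 1)) * indicator {0..\<tau>} t \<partial>lborel) = ennreal (\<tau> powr (real k - r) / (real k - r))"
      using nn_integral_has_integral_lebesgue'[OF _ has_integral_powr_from_0[of "real k - r - 1" \<tau>]] r \<tau> by simp
    also have "(\<integral>\<^sup>+ t. ennreal (t powr (- r - 1)) * indicator {\<tau>..} t \<partial>lborel) = ennreal (\<tau> powr (- r) / r)"
      using nn_integral_has_integral_lebesgue'[OF _ has_integral_powr_to_inf[of "- r - 1" \<tau>]] r \<tau> by simp
    also have "ennreal (c powr T * \<tau> powr (r - real k)) * ennreal (\<tau> powr (real k - r) / (real k - r))
       + ennreal (c powr T * \<tau> powr r) * ennreal (\<tau> powr (- r) / r) = 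
       ennreal (c powr T * (\<tau> powr (r - real k) * \<tau> powr (real k - r)) / (real k - r) + c powr T * (\<tau> powr r * \<tau> powr (- r)) / r)"
      using r by (simp add: ennreal_mult[symmetric] ennreal_plus[symmetric] mult.assoc del: ennreal_plus)
    also have "c powr T * (\<tau> powr (r - real k) * \<tau> powr (real k - r)) / (real k - r) + c powr T * (\<tau> powr r * \<tau> powr (- r)) / r = c powr T * W"
      using \<tau> by (simp add: powr_add[symmetric] W_def distrib_left)
    finally have Ile: "I \<le> ennreal (c powr T * W)" .
    then have I: "I \<noteq> \<infinity>" by (metis ennreal_less_top infinity_ennreal_def leD)
    have "enn2real I \<le> c powr T * W" using Ile W by (simp add: enn2real_leI)
    then have "enn2real I powr (1/T) \<le> (c powr T * W) powr (1/T)" using T by (intro powr_mono2) auto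
    also have "\<dots> = c * W powr (1/T)" using c T W by (simp add: powr_mult powr_powr)
    also have "\<dots> \<le> c * max 1 W"
    proof (rule mult_left_mono)
      have "W powr (1/T) \<le> max 1 W powr (1/T)" using W T by (intro powr_mono2) auto
      also have "\<dots> \<le> max 1 W powr 1" using T by (intro powr_mono) auto
      finally show "W powr (1/T) \<le> max 1 W" by simp
    qed (rule c)
    also have "\<dots> \<le> 1/2" using c(2) by (simp add: W_def)
    finally have "Lp_norm p f + enn2real I powr (1/T) \<le> 1" using Lp by linarith
    then have "besov_norm k r p \<theta> f \<le> 1"
      using False I unfolding besov_norm_def T_def[symmetric] I_def[symmetric] by (simp add: Let_def del: ennreal_plus)
    then show ?thesis using L by (simp add: besov_class_def)
  qed
qed

text \<open>On these frequencies the kernel of order \<open>2^(n+2)\<close> still has multiplier 1,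
  while that of order \<open>2^(n+1)\<close> has already fallen to one half or less.\<close>

lemma sigma_mult_test_freqs:
  assumes k: "k \<in> (test_freqs n :: (int^'n) set)"
  shows "1/2 \<le> sigma_mult (n + 2) k" and "k \<in> ibox (2^(n+2+1))"
proof -
  have kj: "3 * 2^n \<le> k$j" "k$j < 4 * 2^n" for j using k by (auto simp: test_freqs_def)
  have "vmult (2^(n+2)) k = 1"
    using kj by (intro vmult_eq_1) (auto simp: abs_of_nonneg order.trans[OF _ kj(1)] less_imp_le mult.commute)
  moreover have "vmult (2^(n+1)) k \<le> 1/2"
  proof -
    \<comment> \<open>One arbitrary coordinate suffices, since the remaining factors of the
      multiplier are at most 1.\<close>
    fix j :: 'n
    have "\<bar>k$j\<bar> \<ge> int (3 * 2^n)" using kj(1)[of j] by simp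
    then have "vcoef (2^(n+1)) (k$j) \<le> (2 * real (2^(n+1)) - real (3 * 2^n)) / real (2^(n+1))"
      by (intro vcoef_le) auto
    also have "\<dots> = 1/2" by (simp add: field_simps)
    finally show ?thesis using vmult_le_vcoef[of "2^(n+1)" k j] by linarith
  qed
  ultimately show "1/2 \<le> sigma_mult (n + 2) k" by (simp add: sigma_mult_def)
  show "k \<in> ibox (2^(n+2+1))"
  proof -
    have "\<bar>k$j\<bar> < 8 * 2^n" for j
    proof -
      have "0 \<le> k$j" using kj(1)[of j] by (rule order.trans[rotated]) simp
      then show ?thesis using kj(2)[of j] by (simp add: abs_of_nonneg)
    qed
    then show ?thesis by (simp add: ibox_def mult.commute)
  qed
qed

text \<open>The single block \<open>n + 2\<close> is enough. At least half of the test frequencies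
  avoid \<open>\<Theta>\<close> and keep a coefficient of modulus at least gamma/2 there. With M the
  number of test frequencies, Bessel gives M/2 * (gamma/2)^2 <= 2 * (\<open>Lp_norm q T\<close>)^2,
  whence the divisor 4.\<close>

lemma Bq1_norm_ge_test:
  fixes f :: "real^'n \<Rightarrow> complex"
  assumes q: "q \<ge> 2" and \<gamma>: "\<gamma> \<ge> 0" and f: "\<And>x. f x = (\<Sum>k\<in>test_freqs n. a k * char_exp k x)" "\<And>k. norm (a k) = \<gamma>"
    and \<Theta>: "finite \<Theta>" "2 * card \<Theta> \<le> 2^(n * CARD('n))"
  shows "ennreal (\<gamma> * sqrt (2^(n * CARD('n))) / 4) \<le> Bq1_norm q (\<lambda>x. f x - (\<Sum>k\<in>\<Theta>. c k * char_exp k x))"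
proof -
  define g where "g x = f x - (\<Sum>k\<in>\<Theta>. c k * char_exp k x)" for x
  have gm: "g \<in> borel_measurable borel" unfolding g_def f(1) by measurable
  have gp: "vperiodic g" by (simp add: g_def f(1) vperiodic_def vperiodic_char_exp[unfolded vperiodic_def, rule_format])
  have fi: "integrable torus_measure f" unfolding f(1)[abs_def] by simp
  have gi: "integrable torus_measure g" unfolding g_def using fi by simp
  have gc: "fcoef g k = a k" if "k \<in> test_freqs n - \<Theta>" for k
    unfolding g_def using that \<Theta> by (subst fcoef_diff[OF fi]) (auto simp: fcoef_trig_poly f(1)[abs_def])
  define T where "T = sigma_block (n + 2) g"
  have T: "T = (\<lambda>x. \<Sum>k\<in>ibox (2^(n+2+1)). (of_real (sigma_mult (n+2) k) * fcoef g k) * char_exp k x)"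
    unfolding T_def by (rule ext) (simp only: sigma_block_eq[OF gm gp gi])
  have Tm [measurable]: "T \<in> borel_measurable borel" unfolding T by measurable
  have Tp: "vperiodic T" by (simp add: T vperiodic_def vperiodic_char_exp[unfolded vperiodic_def, rule_format])
  have "norm (T x) \<le> (\<Sum>k\<in>ibox (2^(n+2+1)). norm (of_real (sigma_mult (n+2) k) * fcoef g k))" for x
    unfolding T by (intro sum_norm_le) (simp add: norm_mult)
  then have TL: "in_Lp q T" using q by (intro in_Lp_bounded[OF Tp Tm]) auto
  have Tc: "\<gamma> / 2 \<le> norm (fcoef T k)" if k: "k \<in> test_freqs n - \<Theta>" for k
  proof -
    have "fcoef T k = of_real (sigma_mult (n+2) k) * a k"
      using k sigma_mult_test_freqs(2)[of k n] unfolding T by (subst fcoef_trig_poly) (auto simp: gc)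
    then have "norm (fcoef T k) = \<bar>sigma_mult (n+2) k\<bar> * \<gamma>" by (simp add: norm_mult f)
    moreover have "1/2 * \<gamma> \<le> \<bar>sigma_mult (n+2) k\<bar> * \<gamma>"
      using k sigma_mult_test_freqs(1)[of k n] \<gamma> by (intro mult_right_mono) auto
    ultimately show ?thesis by simp
  qed
  let ?N = "2^(n * CARD('n)) :: real"
  have "card (test_freqs n :: (int^'n) set) \<le> card (test_freqs n - \<Theta>) + card \<Theta>"
    using card_Un_le[of "test_freqs n - \<Theta>" \<Theta>] card_mono[of "(test_freqs n - \<Theta>) \<union> \<Theta>" "test_freqs n"] \<Theta>(1) by force
  then have "2^(n * CARD('n)) \<le> 2 * card (test_freqs n - \<Theta>)" using \<Theta>(2) unfolding card_test_freqs by linarith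
  then have "real (2^(n * CARD('n))) \<le> real (2 * card (test_freqs n - \<Theta>))" by (simp only: of_nat_le_iff)
  then have cardQ: "?N / 2 \<le> real (card (test_freqs n - \<Theta>))" by simp
  have "?N / 2 * (\<gamma> / 2)\<^sup>2 \<le> real (card (test_freqs n - \<Theta>)) * (\<gamma> / 2)\<^sup>2"
    using cardQ by (intro mult_right_mono) auto
  also have "\<dots> = (\<Sum>k\<in>test_freqs n - \<Theta>. (\<gamma> / 2)\<^sup>2)" by simp
  also have "\<dots> \<le> (\<Sum>k\<in>test_freqs n - \<Theta>. (norm (fcoef T k))\<^sup>2)"
    using Tc \<gamma> by (intro sum_mono power_mono) auto
  also have "\<dots> \<le> (\<integral>x. (norm (T x))\<^sup>2 \<partial>torus_measure)"
    using integral_square_le_Lp_norm(1)[OF TL q] by (intro bessel_inequality[OF Tm]) auto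
  also have "\<dots> \<le> 2 * (Lp_norm q T)\<^sup>2" by (rule integral_square_le_Lp_norm(2)[OF TL q])
  finally have "(\<gamma> * sqrt ?N / 4)\<^sup>2 \<le> (Lp_norm q T)\<^sup>2"
    by (simp add: power_mult_distrib power_divide mult.commute)
  then have "\<gamma> * sqrt ?N / 4 \<le> Lp_norm q T" by (rule power2_le_imp_le) simp
  then have "ennreal (\<gamma> * sqrt ?N / 4) \<le> ennreal (Lp_norm q (sigma_block (n+2) g))" by (simp add: T_def ennreal_leI)
  also have "\<dots> \<le> Bq1_norm q g"
  proof -
    define F where "F s = ennreal (Lp_norm q (sigma_block s g))" for s
    have "sum F {n+2} \<le> suminf F" by (rule sum_le_suminf) (auto intro: summableI)
    then have "F (n+2) \<le> suminf F" by simp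
    then show ?thesis unfolding Bq1_norm_def F_def .
  qed
  finally show ?thesis unfolding g_def[abs_def] .
qed

lemma besov_lower_bound:
  fixes p q r :: real and \<theta> :: ennreal and k :: nat
  assumes "p > 0" "q \<ge> 2" "1 \<le> \<theta>" "r > 0" "real k > r"
  shows "\<exists>C>0. \<forall>m\<ge>1. ennreal (C * real m powr (- r / real CARD('n)))
        \<le> best_mterm_class m q (besov_class k r p \<theta> :: (real^'n \<Rightarrow> complex) set)"
proof -
  let ?d = "CARD('n)"
  have k: "k > 0" using assms by (cases k) auto
  define W where "W = max 1 (1 / (real k - r) + 1 / r)"
  \<comment> \<open>Collects the constants of both difference estimates: \<open>2^k\<close> for
    large steps, \<open>real k^k\<close> for small ones. Then \<open>c0\<close> is normalised to
    meet the condition of \<open>besov_classI\<close>.\<close>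
  define B where "B = (exp 4 * sqrt 2) ^ ?d * (2^k + real k^k)"
  define c0 where "c0 = 1 / (2 * W * B)"
  have W: "W \<ge> 1" by (simp add: W_def)
  have "B > 0" by (simp add: B_def add_pos_nonneg)
  have c0: "c0 > 0" using W \<open>B > 0\<close> by (simp add: c0_def)
  have c0B: "c0 * B * W \<le> 1/2" using W \<open>B > 0\<close> by (simp add: c0_def)
  \<comment> \<open>The factor \<open>2 powr (- r)\<close> pays for passing from n - 1 to n, and
    \<open>2 powr (- r / real ?d)\<close> for asking for \<open>2 * m\<close> frequencies rather
    than \<open>m\<close>.\<close>
  define C where "C = c0 / 4 * (2 powr (- r) * 2 powr (- r / real ?d))"
  have "C > 0" using c0 by (simp add: C_def)
  have main: "ennreal (C * real m powr (- r / real ?d)) \<le> best_mterm_class m q (besov_class k r p \<theta> :: (real^'n \<Rightarrow> complex) set)"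
    if m: "m \<ge> 1" for m
  proof -
    \<comment> \<open>At least twice as many test frequencies as removed ones; minimality makes 2^n
      at most comparable to m^(1/d).\<close>
    define n where "n = (LEAST n. 2 * m \<le> 2^(n * ?d))"
    have ex: "2 * m \<le> 2^((2 * m) * ?d)"
    proof -
      have "2 * m \<le> 2^(2 * m)" using less_exp[of "2 * m"] by (rule less_imp_le)
      also have "(2::nat)^(2 * m) \<le> 2^((2 * m) * ?d)" by (intro power_increasing) auto
      finally show ?thesis .
    qed
    have n: "2 * m \<le> 2^(n * ?d)" unfolding n_def by (rule LeastI[of "\<lambda>n. 2 * m \<le> 2^(n * ?d)", OF ex])
    have "n \<noteq> 0" using n m by (cases n) auto
    then have "\<not> 2 * m \<le> 2^((n - 1) * ?d)" unfolding n_def by (intro not_less_Least) simp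
    then have "real (2^((n - 1) * ?d)) \<le> real (2 * m)" by (simp only: of_nat_le_iff not_le less_imp_le)
    then have n1: "2 powr (real (n - 1) * real ?d) \<le> 2 * real m"
      using powr_realpow[of 2 "(n - 1) * ?d"] by simp
    define \<tau> :: real where "\<tau> = 1 / 2^n"
    \<comment> \<open>Dividing by the order of the sup norm of \<open>test_poly n\<close> gives
      \<open>f\<close> the size \<open>\<tau> powr r\<close> required by the class. The same root
      reappears in the L_2 lower bound and cancels.\<close>
    define \<gamma> where "\<gamma> = c0 * \<tau> powr r / sqrt (2^n) ^ ?d"
    define f where "f x = of_real \<gamma> * test_poly n x" for x :: "real^'n"
    have \<tau>: "0 < \<tau>" "\<tau> \<le> 1" by (simp_all add: \<tau>_def)
    have \<tau>r: "\<tau> powr r \<le> 1" using \<tau> assms powr_mono2[of r \<tau> 1] by simp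
    have \<gamma>: "\<gamma> > 0" using c0 \<tau> by (simp add: \<gamma>_def)
    have amp: "\<gamma> * (exp 4 * sqrt 2 * sqrt (2^n)) ^ ?d = c0 * \<tau> powr r * (exp 4 * sqrt 2) ^ ?d"
      by (simp add: \<gamma>_def power_mult_distrib)
    obtain e where e: "\<And>k. norm (e k) = 1" "\<And>x::real^'n. test_poly n x = (\<Sum>k\<in>test_freqs n. e k * char_exp k x)"
      using test_poly_coeffs[of n] by metis
    have fsum: "f x = (\<Sum>k\<in>test_freqs n. (of_real \<gamma> * e k) * char_exp k x)" for x
      by (simp add: f_def e sum_distrib_left mult_ac)
    have fb: "norm (f x) \<le> c0 * \<tau> powr r * (exp 4 * sqrt 2) ^ ?d" for x
    proof -
      have "norm (f x) \<le> \<gamma> * (exp 4 * sqrt 2 * sqrt (2^n)) ^ ?d"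
        unfolding f_def norm_mult using \<gamma> test_poly_bound[of n x] by simp
      then show ?thesis by (simp only: amp)
    qed
    have B1: "(exp 4 * sqrt 2) ^ ?d * 2^k \<le> B" "(exp 4 * sqrt 2) ^ ?d * real k^k \<le> B" "(exp 4 * sqrt 2) ^ ?d \<le> B"
    proof -
      show b: "(exp 4 * sqrt 2) ^ ?d * 2^k \<le> B" "(exp 4 * sqrt 2) ^ ?d * real k^k \<le> B"
        unfolding B_def by (intro mult_left_mono; simp)+
      have "(exp 4 * sqrt 2) ^ ?d * 1 \<le> (exp 4 * sqrt 2) ^ ?d * 2^k" by (intro mult_left_mono one_le_power) auto
      then show "(exp 4 * sqrt 2) ^ ?d \<le> B" using b by linarith
    qed
    have mem: "f \<in> besov_class k r p \<theta>"
    proof (rule besov_classI[where \<tau>=\<tau> and c="c0 * B"])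
      show "vperiodic f" unfolding fsum[abs_def]
        by (simp add: vperiodic_def vperiodic_char_exp[unfolded vperiodic_def, rule_format])
      show "f \<in> borel_measurable borel" unfolding fsum[abs_def] by measurable
      show "c0 * B * max 1 (1 / (real k - r) + 1 / r) \<le> 1/2" using c0B by (simp add: W_def)
      fix x
      have "c0 * \<tau> powr r * (exp 4 * sqrt 2) ^ ?d \<le> c0 * 1 * B"
        using c0 \<tau>r B1 by (intro mult_mono) auto
      then show "norm (f x) \<le> c0 * B" using fb[of x] by simp
    next
      fix h x :: "real^'n"
      have "norm (diff_pow k h f x) \<le> 2^k * (c0 * \<tau> powr r * (exp 4 * sqrt 2) ^ ?d)" by (rule diff_pow_bound[OF fb])
      also have "\<dots> = c0 * \<tau> powr r * ((exp 4 * sqrt 2) ^ ?d * 2^k)" by (simp only: mult_ac)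
      also have "\<dots> \<le> c0 * \<tau> powr r * B" using c0 B1 by (intro mult_left_mono) auto
      finally show "norm (diff_pow k h f x) \<le> c0 * B * \<tau> powr r" by (simp add: mult_ac)
      have "norm (diff_pow k h f x) = \<gamma> * norm (diff_pow k h (test_poly n) x)"
        unfolding f_def[abs_def] diff_pow_cmult norm_mult using \<gamma> by simp
      also have "\<dots> \<le> \<gamma> * ((exp 4 * sqrt 2 * sqrt (2^n)) ^ ?d * (real k * 2^n * norm h)^k)"
        using \<gamma> test_poly_diff_pow_bound[OF k, of h n x] by (intro mult_left_mono) auto
      also have "\<dots> = c0 * \<tau> powr r * ((exp 4 * sqrt 2) ^ ?d * real k^k) * (norm h / \<tau>)^k"
      proof -
        have "(real k * 2^n * norm h)^k = real k^k * (norm h / \<tau>)^k" by (simp add: \<tau>_def power_mult_distrib)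
        then show ?thesis using amp by (simp only: mult.assoc[symmetric])
      qed
      also have "\<dots> \<le> c0 * \<tau> powr r * B * (norm h / \<tau>)^k"
        using c0 B1 \<tau> by (intro mult_left_mono mult_right_mono) auto
      finally show "norm (diff_pow k h f x) \<le> c0 * B * \<tau> powr r * (norm h / \<tau>)^k" by (simp add: mult_ac)
    qed (use assms \<tau> c0 \<open>B > 0\<close> in auto)
    have lower: "ennreal (\<gamma> * sqrt (2^(n * ?d)) / 4) \<le> best_mterm m q f"
      unfolding best_mterm_def
    proof (intro INF_greatest)
      fix \<Theta> :: "(int^'n) set" and c assume "\<Theta> \<in> {\<Theta>. finite \<Theta> \<and> card \<Theta> = m}"
      then show "ennreal (\<gamma> * sqrt (2^(n * ?d)) / 4) \<le> Bq1_norm q (\<lambda>x. f x - (\<Sum>k\<in>\<Theta>. c k * char_exp k x))"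
        using assms \<gamma> n e(1) by (intro Bq1_norm_ge_test[OF _ _ fsum]) (auto simp: norm_mult)
    qed
    have "sqrt (2^(n * ?d)) = sqrt (2^n) ^ ?d" by (simp add: power_mult real_sqrt_power)
    then have "\<gamma> * sqrt (2^(n * ?d)) / 4 = c0 / 4 * \<tau> powr r" by (simp add: \<gamma>_def)
    moreover have "C * real m powr (- r / real ?d) \<le> c0 / 4 * \<tau> powr r"
    proof -
      have "(2 * real m) powr (- r / real ?d) \<le> (2 powr (real (n - 1) * real ?d)) powr (- r / real ?d)"
        using n1 assms by (intro powr_mono2') auto
      also have "\<dots> = 2 powr (r - r * real n)"
        using \<open>n \<noteq> 0\<close> unfolding powr_powr by (simp add: of_nat_diff algebra_simps)
      also have "\<dots> = 2 powr r * \<tau> powr r"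
      proof -
        have "\<tau> = 2 powr (- real n)" by (simp add: \<tau>_def powr_minus powr_realpow divide_inverse)
        then have "\<tau> powr r = 2 powr (- r * real n)" by (simp add: powr_powr mult.commute)
        then show ?thesis by (simp add: powr_add[symmetric])
      qed
      finally have "2 powr (- r) * (2 * real m) powr (- r / real ?d) \<le> 2 powr (- r) * (2 powr r * \<tau> powr r)"
        by (intro mult_left_mono) auto
      also have "\<dots> = \<tau> powr r" by (simp add: mult.assoc[symmetric] powr_add[symmetric])
      finally have "c0 / 4 * (2 powr (- r) * (2 * real m) powr (- r / real ?d)) \<le> c0 / 4 * \<tau> powr r"
        using c0 by (intro mult_left_mono) auto
      then show ?thesis by (simp add: C_def powr_mult mult_ac)
    qed
    ultimately have "ennreal (C * real m powr (- r / real ?d)) \<le> ennreal (\<gamma> * sqrt (2^(n * ?d)) / 4)"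
      by (intro ennreal_leI) linarith
    also note lower
    also have "best_mterm m q f \<le> best_mterm_class m q (besov_class k r p \<theta> :: (real^'n \<Rightarrow> complex) set)"
      unfolding best_mterm_class_def using mem by (rule SUP_upper)
    finally show ?thesis .
  qed
  then show ?thesis using \<open>C > 0\<close> by blast
qed

theorem theorem2:
  fixes p q r :: real and \<theta> :: ennreal and k :: nat
  assumes "2 < p" and "p < q" and "1 \<le> \<theta>"
    and "r > real CARD('n) / 2" and "real k > r"
  shows "\<exists>C1 C2. 0 < C1 \<and> C1 < C2 \<and> (\<forall>m::nat. m \<ge> 1 \<longrightarrow>
     ennreal (C1 * real m powr (- r / real CARD('n)))
        \<le> best_mterm_class m q (besov_class k r p \<theta> :: (real^'n \<Rightarrow> complex) set) \<and>
     best_mterm_class m q (besov_class k r p \<theta> :: (real^'n \<Rightarrow> complex) set)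
        \<le> ennreal (C2 * real m powr (- r / real CARD('n))))"
proof -
  have r: "r > 0" using assms(4) by (rule order.strict_trans[rotated]) simp
  obtain A where A: "A > 0" "\<And>m. m \<ge> 1 \<Longrightarrow> ennreal (A * real m powr (- r / real CARD('n)))
      \<le> best_mterm_class m q (besov_class k r p \<theta> :: (real^'n \<Rightarrow> complex) set)"
    using besov_lower_bound[of p q \<theta> r k, where 'n='n] assms r by auto
  obtain B where B: "B > 0" "\<And>m. m \<ge> 1 \<Longrightarrow> best_mterm_class m q (besov_class k r p \<theta> :: (real^'n \<Rightarrow> complex) set)
      \<le> ennreal (B * real m powr (- r / real CARD('n)))"
    using besov_upper_bound[OF assms(1-4), of k] by blast
  \<comment> \<open>The upper constant is enlarged to \<open>A + B\<close> to make the two constants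
    strictly ordered.\<close>
  have "ennreal (B * real m powr (- r / real CARD('n))) \<le> ennreal ((A + B) * real m powr (- r / real CARD('n)))" for m
    using A(1) by (intro ennreal_leI mult_right_mono) auto
  note upper = order.trans[OF B(2) this]
  show ?thesis
  proof (rule exI[of _ A], rule exI[of _ "A + B"], intro conjI allI impI)
    show "A < A + B" using B(1) by simp
  qed (simp_all only: A upper)
qed

end
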